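(* Let $(M,\varphi,\xi,\eta,g)$ be a normal almost paracontact metric three-manifold, and set $b_1=\frac12\mathrm{div}\,\xi$ and $b_2=\frac12\mathrm{tr}(\varphi\nabla\xi)$. 1) If $(M,\varphi,\xi,\eta,g)$ is an unsteady almost paracontact Ricci soliton, i.e. $\mathcal L_\xi g+\varrho=\lambda g$ for a real constant $\lambda\neq0$, then $\xi$ is Killing and $(M,g)$ has constant sectional curvature $k=-b_2^2<0$. 2) If $(M,\varphi,\xi,\eta,g)$ is a steady almost paracontact Ricci soliton, i.e. $\mathcal L_\xi g+\varrho=0$, then, with respect to a local $\varphi$-basis $\{\xi,e,\varphi e\}$, $$b_2=\varepsilon b_1=\pm b_1,\qquad \xi(b_1)=-2b_1^2,\qquad r=-4b_1,\qquad (e-\varepsilon\varphi e)(b_1)=0,$$ where $r$ is the scalar curvature and $\varepsilon\in\{1,-1\}$.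
   Context: An almost paracontact structure on a connected smooth $3$-manifold $M$ is a triple $(\varphi,\xi,\eta)$ of a $(1,1)$-tensor, a global vector field and a $1$-form with $\varphi(\xi)=0$, $\eta\circ\varphi=0$, $\eta(\xi)=1$, $\varphi^2=\mathrm{Id}-\eta\otimes\xi$, and such that the $\pm1$-eigenbundles of $\varphi|_{\ker\eta}$ both have rank $1$. It is an almost paracontact metric structure together with a pseudo-Riemannian metric $g$ if $g(\varphi X,\varphi Y)=-g(X,Y)+\eta(X)\eta(Y)$; then $\eta=g(\xi,\cdot)$. It is normal if $[\varphi,\varphi]-2d\eta\otimes\xi=0$, where $[\varphi,\varphi]$ is the Nijenhuis torsion of $\varphi$ and $d\eta(X,Y)=\frac12\big(X\eta(Y)-Y\eta(X)-\eta([X,Y])\big)$; in dimension three this is equivalent to $h:=\frac12\mathcal L_\xi\varphi=0$. A (local) $\varphi$-basis is a pseudo-orthonormal local frame $\{\xi,e,\varphi e\}$ with $\xi,e$ space-like unit and $\varphi e$ time-like unit. With respect to a $\varphi$-basis, a normal almost paracontact metric three-manifold is described by $[\xi,e]=-b_1e+(a_3-b_2)\varphi e$, $[\xi,\varphi e]=(a_3-b_2)e-b_1\varphi e$, $[e,\varphi e]=2b_2\xi+a_4e-a_5\varphi e$ for smooth functions $b_1,b_2,a_3,a_4,a_5$, where $b_1,b_2$ are the globally defined functions given above ($\nabla$ is the Levi-Civita connection). $\varrho$ is the Ricci tensor (standard sign, positive on round spheres). The manifold is an almost paracontact Ricci soliton if $\mathcal L_\xi g+\varrho=\lambda g$ for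 some real constant $\lambda$; it is steady if $\lambda=0$ and unsteady if $\lambda\ne0$. *)

theory Defs
  imports "HOL-Analysis.Analysis"
begin

subsection \<open>Smooth maps between open subsets of normed spaces\<close>

primrec Ck_on :: "nat \<Rightarrow> 'a::real_normed_vector set \<Rightarrow> ('a \<Rightarrow> 'b::real_normed_vector) \<Rightarrow> bool" where
  "Ck_on 0 S f = continuous_on S f"
| "Ck_on (Suc k) S f =
    ((\<forall>x\<in>S. f differentiable (at x)) \<and>
     (\<forall>v. Ck_on k S (\<lambda>x. frechet_derivative f (at x) v)))"

definition smooth_on :: "'a::real_normed_vector set \<Rightarrow> ('a \<Rightarrow> 'b::real_normed_vector) \<Rightarrow> bool" where
  "smooth_on S f \<longleftrightarrow> (\<forall>k. Ck_on k S f)"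


subsection \<open>Smooth three-manifolds and tensor fields\<close>

type_synonym R3 = "real^3"
type_synonym 'a chart = "'a set \<times> ('a \<Rightarrow> R3)"

abbreviation chart_dom :: "'a chart \<Rightarrow> 'a set" where
  "chart_dom c \<equiv> fst c"

abbreviation coord :: "'a chart \<Rightarrow> 'a \<Rightarrow> R3" where
  "coord c \<equiv> snd c"

definition param :: "'a chart \<Rightarrow> R3 \<Rightarrow> 'a" where
  "param c = inv_into (chart_dom c) (coord c)"

definition chart_img :: "'a chart \<Rightarrow> R3 set" where
  "chart_img c = coord c ` chart_dom c"

definition transition :: "'a chart \<Rightarrow> 'a chart \<Rightarrow> R3 \<Rightarrow> R3" where
  "transition c d = coord d \<circ> param c"

definition jac :: "'a chart \<Rightarrow> 'a chart \<Rightarrow> R3 \<Rightarrow> R3 \<Rightarrow> R3" where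
  "jac c d x v = frechet_derivative (transition c d) (at x) v"

definition is_chart :: "'a::topological_space chart \<Rightarrow> bool" where
  "is_chart c \<longleftrightarrow>
     open (chart_dom c) \<and> open (chart_img c) \<and>
     homeomorphism (chart_dom c) (chart_img c) (coord c) (param c)"

text \<open>The underlying manifold is the whole type; \<open>A\<close> is a smooth atlas, not necessarily maximal.\<close>

definition connected_smooth_3manifold ::
    "'a::{t2_space, second_countable_topology} chart set \<Rightarrow> bool" where
  "connected_smooth_3manifold A \<longleftrightarrow>
     connected (UNIV :: 'a set) \<and>
     (\<forall>c\<in>A. is_chart c) \<and>
     (\<Union>c\<in>A. chart_dom c) = UNIV \<and>
     (\<forall>c\<in>A. \<forall>d\<in>A. smooth_on (coord c ` (chart_dom c \<inter> chart_dom d)) (transition c d))"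

text \<open>
  A tensor field is the family of its local expressions: \<open>T c x\<close> is the array of components, in
  the chart \<open>c\<close>, at the point with coordinates \<open>x\<close>; it must be smooth in \<open>x\<close> and obey
  the transformation law of its type.  The components of a 1-form are paired with those of a vector
  by \<open>\<bullet>\<close>, a \<open>(1,1)\<close>-tensor acts by \<open>*v\<close>, and a \<open>(0,2)\<close>-tensor is the Gram matrix of a
  bilinear form.  Scalars constructed from tensor fields by the coordinate formulas below are likewise
  families \<open>f c x\<close> of local expressions.
\<close>

type_synonym 'a vec_field = "'a chart \<Rightarrow> R3 \<Rightarrow> R3"
type_synonym 'a one_form = "'a chart \<Rightarrow> R3 \<Rightarrow> R3"
type_synonym 'a endo_field = "'a chart \<Rightarrow> R3 \<Rightarrow> real^3^3"
type_synonym 'a bilin_field = "'a chart \<Rightarrow> R3 \<Rightarrow> real^3^3"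

definition bil :: "real^3^3 \<Rightarrow> R3 \<Rightarrow> R3 \<Rightarrow> real" where
  "bil G u v = u \<bullet> (G *v v)"

definition vector_field_on :: "'a chart set \<Rightarrow> 'a set \<Rightarrow> 'a vec_field \<Rightarrow> bool" where
  "vector_field_on A U X \<longleftrightarrow>
     (\<forall>c\<in>A. smooth_on (coord c ` (U \<inter> chart_dom c)) (X c)) \<and>
     (\<forall>c\<in>A. \<forall>d\<in>A. \<forall>x \<in> coord c ` (U \<inter> chart_dom c \<inter> chart_dom d).
        X d (transition c d x) = jac c d x (X c x))"

definition one_form :: "'a chart set \<Rightarrow> 'a one_form \<Rightarrow> bool" where
  "one_form A \<eta> \<longleftrightarrow>
     (\<forall>c\<in>A. smooth_on (chart_img c) (\<eta> c)) \<and>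
     (\<forall>c\<in>A. \<forall>d\<in>A. \<forall>x \<in> coord c ` (chart_dom c \<inter> chart_dom d). \<forall>v.
        \<eta> d (transition c d x) \<bullet> jac c d x v = \<eta> c x \<bullet> v)"

definition endo_field :: "'a chart set \<Rightarrow> 'a endo_field \<Rightarrow> bool" where
  "endo_field A \<phi> \<longleftrightarrow>
     (\<forall>c\<in>A. smooth_on (chart_img c) (\<phi> c)) \<and>
     (\<forall>c\<in>A. \<forall>d\<in>A. \<forall>x \<in> coord c ` (chart_dom c \<inter> chart_dom d). \<forall>v.
        \<phi> d (transition c d x) *v jac c d x v = jac c d x (\<phi> c x *v v))"

definition pseudo_riemannian_metric :: "'a chart set \<Rightarrow> 'a bilin_field \<Rightarrow> bool" where
  "pseudo_riemannian_metric A g \<longleftrightarrow>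
     (\<forall>c\<in>A. smooth_on (chart_img c) (g c)) \<and>
     (\<forall>c\<in>A. \<forall>d\<in>A. \<forall>x \<in> coord c ` (chart_dom c \<inter> chart_dom d). \<forall>v w.
        bil (g d (transition c d x)) (jac c d x v) (jac c d x w) = bil (g c x) v w) \<and>
     (\<forall>c\<in>A. \<forall>x\<in>chart_img c. transpose (g c x) = g c x \<and> invertible (g c x))"


subsection \<open>Differential geometry in coordinates\<close>

text \<open>
  Here vector fields, 1-forms, endomorphism fields and metrics are given by their components on an
  open subset of \<open>R3\<close>.
\<close>

definition dderiv :: "(R3 \<Rightarrow> 'b::real_normed_vector) \<Rightarrow> R3 \<Rightarrow> R3 \<Rightarrow> 'b" where
  "dderiv f x v = frechet_derivative f (at x) v"

definition lie_bracket :: "(R3 \<Rightarrow> R3) \<Rightarrow> (R3 \<Rightarrow> R3) \<Rightarrow> R3 \<Rightarrow> R3" where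
  "lie_bracket X Y x = dderiv Y x (X x) - dderiv X x (Y x)"

definition ext_deriv :: "(R3 \<Rightarrow> R3) \<Rightarrow> (R3 \<Rightarrow> R3) \<Rightarrow> (R3 \<Rightarrow> R3) \<Rightarrow> R3 \<Rightarrow> real" where
  "ext_deriv \<eta> X Y x =
     (1/2) * (dderiv (\<lambda>y. \<eta> y \<bullet> Y y) x (X x) - dderiv (\<lambda>y. \<eta> y \<bullet> X y) x (Y x)
              - \<eta> x \<bullet> lie_bracket X Y x)"

definition nijenhuis :: "(R3 \<Rightarrow> real^3^3) \<Rightarrow> (R3 \<Rightarrow> R3) \<Rightarrow> (R3 \<Rightarrow> R3) \<Rightarrow> R3 \<Rightarrow> R3" where
  "nijenhuis \<phi> X Y x =
     \<phi> x *v (\<phi> x *v lie_bracket X Y x)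
     + lie_bracket (\<lambda>y. \<phi> y *v X y) (\<lambda>y. \<phi> y *v Y y) x
     - \<phi> x *v lie_bracket (\<lambda>y. \<phi> y *v X y) Y x
     - \<phi> x *v lie_bracket X (\<lambda>y. \<phi> y *v Y y) x"

definition lie_deriv_metric ::
    "(R3 \<Rightarrow> R3) \<Rightarrow> (R3 \<Rightarrow> real^3^3) \<Rightarrow> (R3 \<Rightarrow> R3) \<Rightarrow> (R3 \<Rightarrow> R3) \<Rightarrow> R3 \<Rightarrow> real" where
  "lie_deriv_metric \<xi> g X Y x =
     dderiv (\<lambda>y. bil (g y) (X y) (Y y)) x (\<xi> x)
     - bil (g x) (lie_bracket \<xi> X x) (Y x) - bil (g x) (X x) (lie_bracket \<xi> Y x)"

text \<open>\<open>christoffel g x k i j\<close> has upper index \<open>k\<close> and lower indices \<open>i j\<close>.\<close>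

definition christoffel :: "(R3 \<Rightarrow> real^3^3) \<Rightarrow> R3 \<Rightarrow> 3 \<Rightarrow> 3 \<Rightarrow> 3 \<Rightarrow> real" where
  "christoffel g x k i j =
     (1/2) * (\<Sum>l\<in>UNIV. matrix_inv (g x) $ k $ l *
        (dderiv (\<lambda>y. g y $ j $ l) x (axis i 1) + dderiv (\<lambda>y. g y $ i $ l) x (axis j 1)
         - dderiv (\<lambda>y. g y $ i $ j) x (axis l 1)))"

text \<open>\<open>cov_deriv g X Y\<close> is the Levi-Civita derivative of \<open>Y\<close> in the direction of \<open>X\<close>.\<close>

definition cov_deriv :: "(R3 \<Rightarrow> real^3^3) \<Rightarrow> (R3 \<Rightarrow> R3) \<Rightarrow> (R3 \<Rightarrow> R3) \<Rightarrow> R3 \<Rightarrow> R3" where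
  "cov_deriv g X Y x =
     dderiv Y x (X x) + (\<chi> k. \<Sum>i\<in>UNIV. \<Sum>j\<in>UNIV. christoffel g x k i j * X x $ i * Y x $ j)"

text \<open>The endomorphism sending \<open>X\<close> to the derivative of \<open>Z\<close> in the direction of \<open>X\<close>.\<close>

definition nabla :: "(R3 \<Rightarrow> real^3^3) \<Rightarrow> (R3 \<Rightarrow> R3) \<Rightarrow> R3 \<Rightarrow> real^3^3" where
  "nabla g Z x = (\<chi> i j. cov_deriv g (\<lambda>_. axis j 1) Z x $ i)"

definition divergence :: "(R3 \<Rightarrow> real^3^3) \<Rightarrow> (R3 \<Rightarrow> R3) \<Rightarrow> R3 \<Rightarrow> real" where
  "divergence g Z x = trace (nabla g Z x)"

definition curvature ::
    "(R3 \<Rightarrow> real^3^3) \<Rightarrow> (R3 \<Rightarrow> R3) \<Rightarrow> (R3 \<Rightarrow> R3) \<Rightarrow> (R3 \<Rightarrow> R3) \<Rightarrow> R3 \<Rightarrow> R3" where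
  "curvature g X Y Z x =
     cov_deriv g X (cov_deriv g Y Z) x - cov_deriv g Y (cov_deriv g X Z) x
     - cov_deriv g (lie_bracket X Y) Z x"

text \<open>
  The curvature is tensorial, so its value on tangent vectors at \<open>x\<close> may be computed with the
  extensions having constant components.
\<close>

definition riem :: "(R3 \<Rightarrow> real^3^3) \<Rightarrow> R3 \<Rightarrow> R3 \<Rightarrow> R3 \<Rightarrow> R3 \<Rightarrow> R3" where
  "riem g x u v w = curvature g (\<lambda>_. u) (\<lambda>_. v) (\<lambda>_. w) x"

text \<open>The trace of \<open>u \<mapsto> R(u,v)w\<close>; this sign is positive on round spheres.\<close>

definition ricci :: "(R3 \<Rightarrow> real^3^3) \<Rightarrow> R3 \<Rightarrow> R3 \<Rightarrow> R3 \<Rightarrow> real" where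
  "ricci g x v w = (\<Sum>i\<in>UNIV. riem g x (axis i 1) v w $ i)"

definition scalar_curvature :: "(R3 \<Rightarrow> real^3^3) \<Rightarrow> R3 \<Rightarrow> real" where
  "scalar_curvature g x =
     (\<Sum>i\<in>UNIV. \<Sum>j\<in>UNIV. matrix_inv (g x) $ i $ j * ricci g x (axis i 1) (axis j 1))"

definition plane_gram :: "(R3 \<Rightarrow> real^3^3) \<Rightarrow> R3 \<Rightarrow> R3 \<Rightarrow> R3 \<Rightarrow> real" where
  "plane_gram g x u v = bil (g x) u u * bil (g x) v v - (bil (g x) u v)\<^sup>2"

definition sectional_curvature :: "(R3 \<Rightarrow> real^3^3) \<Rightarrow> R3 \<Rightarrow> R3 \<Rightarrow> R3 \<Rightarrow> real" where
  "sectional_curvature g x u v = bil (g x) (riem g x u v v) u / plane_gram g x u v"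


subsection \<open>Almost paracontact metric three-manifolds\<close>

definition almost_paracontact ::
    "'a::{t2_space, second_countable_topology} chart set \<Rightarrow> 'a endo_field \<Rightarrow> 'a vec_field \<Rightarrow>
     'a one_form \<Rightarrow> bool" where
  "almost_paracontact A \<phi> \<xi> \<eta> \<longleftrightarrow>
     connected_smooth_3manifold A \<and>
     endo_field A \<phi> \<and> vector_field_on A UNIV \<xi> \<and> one_form A \<eta> \<and>
     (\<forall>c\<in>A. \<forall>x\<in>chart_img c.
        \<phi> c x *v \<xi> c x = 0 \<and>
        (\<forall>v. \<eta> c x \<bullet> (\<phi> c x *v v) = 0) \<and>
        \<eta> c x \<bullet> \<xi> c x = 1 \<and>
        (\<forall>v. \<phi> c x *v (\<phi> c x *v v) = v - (\<eta> c x \<bullet> v) *\<^sub>R \<xi> c x) \<and>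
        dim {v. \<eta> c x \<bullet> v = 0 \<and> \<phi> c x *v v = v} = 1 \<and>
        dim {v. \<eta> c x \<bullet> v = 0 \<and> \<phi> c x *v v = - v} = 1)"

definition almost_paracontact_metric ::
    "'a::{t2_space, second_countable_topology} chart set \<Rightarrow> 'a endo_field \<Rightarrow> 'a vec_field \<Rightarrow>
     'a one_form \<Rightarrow> 'a bilin_field \<Rightarrow> bool" where
  "almost_paracontact_metric A \<phi> \<xi> \<eta> g \<longleftrightarrow>
     almost_paracontact A \<phi> \<xi> \<eta> \<and> pseudo_riemannian_metric A g \<and>
     (\<forall>c\<in>A. \<forall>x\<in>chart_img c. \<forall>v w.
        bil (g c x) (\<phi> c x *v v) (\<phi> c x *v w) =
          - bil (g c x) v w + (\<eta> c x \<bullet> v) * (\<eta> c x \<bullet> w))"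

text \<open>
  Identities between tensors defined by differentiating vector fields are required for all smooth
  vector fields on every chart domain.
\<close>

definition normal_structure ::
    "'a chart set \<Rightarrow> 'a endo_field \<Rightarrow> 'a vec_field \<Rightarrow> 'a one_form \<Rightarrow> bool" where
  "normal_structure A \<phi> \<xi> \<eta> \<longleftrightarrow>
     (\<forall>c\<in>A. \<forall>X Y. smooth_on (chart_img c) X \<longrightarrow> smooth_on (chart_img c) Y \<longrightarrow>
        (\<forall>x\<in>chart_img c.
           nijenhuis (\<phi> c) X Y x - (2 * ext_deriv (\<eta> c) X Y x) *\<^sub>R \<xi> c x = 0))"

definition normal_almost_paracontact_metric ::
    "'a::{t2_space, second_countable_topology} chart set \<Rightarrow> 'a endo_field \<Rightarrow> 'a vec_field \<Rightarrow>
     'a one_form \<Rightarrow> 'a bilin_field \<Rightarrow> bool" where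
  "normal_almost_paracontact_metric A \<phi> \<xi> \<eta> g \<longleftrightarrow>
     almost_paracontact_metric A \<phi> \<xi> \<eta> g \<and> normal_structure A \<phi> \<xi> \<eta>"

definition b1 :: "'a vec_field \<Rightarrow> 'a bilin_field \<Rightarrow> 'a chart \<Rightarrow> R3 \<Rightarrow> real" where
  "b1 \<xi> g c x = (1/2) * divergence (g c) (\<xi> c) x"

definition b2 ::
    "'a endo_field \<Rightarrow> 'a vec_field \<Rightarrow> 'a bilin_field \<Rightarrow> 'a chart \<Rightarrow> R3 \<Rightarrow> real" where
  "b2 \<phi> \<xi> g c x = (1/2) * trace (\<phi> c x ** nabla (g c) (\<xi> c) x)"

definition ricci_soliton ::
    "'a chart set \<Rightarrow> 'a vec_field \<Rightarrow> 'a bilin_field \<Rightarrow> real \<Rightarrow> bool" where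
  "ricci_soliton A \<xi> g l \<longleftrightarrow>
     (\<forall>c\<in>A. \<forall>X Y. smooth_on (chart_img c) X \<longrightarrow> smooth_on (chart_img c) Y \<longrightarrow>
        (\<forall>x\<in>chart_img c.
           lie_deriv_metric (\<xi> c) (g c) X Y x + ricci (g c) x (X x) (Y x)
             = l * bil (g c x) (X x) (Y x)))"

definition killing :: "'a chart set \<Rightarrow> 'a vec_field \<Rightarrow> 'a bilin_field \<Rightarrow> bool" where
  "killing A \<xi> g \<longleftrightarrow>
     (\<forall>c\<in>A. \<forall>X Y. smooth_on (chart_img c) X \<longrightarrow> smooth_on (chart_img c) Y \<longrightarrow>
        (\<forall>x\<in>chart_img c. lie_deriv_metric (\<xi> c) (g c) X Y x = 0))"

definition constant_sectional_curvature :: "'a chart set \<Rightarrow> 'a bilin_field \<Rightarrow> real \<Rightarrow> bool" where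
  "constant_sectional_curvature A g k \<longleftrightarrow>
     (\<forall>c\<in>A. \<forall>x\<in>chart_img c. \<forall>u v.
        plane_gram (g c) x u v \<noteq> 0 \<longrightarrow> sectional_curvature (g c) x u v = k)"

text \<open>\<open>e\<close> generates the local \<open>\<phi>\<close>-basis \<open>\<xi>, e, \<phi> e\<close> on the open set \<open>U\<close>.\<close>

definition phi_basis ::
    "'a::topological_space chart set \<Rightarrow> 'a endo_field \<Rightarrow> 'a vec_field \<Rightarrow> 'a bilin_field \<Rightarrow>
     'a set \<Rightarrow> 'a vec_field \<Rightarrow> bool" where
  "phi_basis A \<phi> \<xi> g U e \<longleftrightarrow>
     open U \<and> vector_field_on A U e \<and>
     (\<forall>c\<in>A. \<forall>x \<in> coord c ` (U \<inter> chart_dom c).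
        let G = bil (g c x); Xi = \<xi> c x; E = e c x; F = \<phi> c x *v e c x in
          G Xi Xi = 1 \<and> G E E = 1 \<and> G F F = - 1 \<and>
          G Xi E = 0 \<and> G Xi F = 0 \<and> G E F = 0)"

end

theory Submission
  imports Defs
begin

text \<open>
  In a local orthonormal frame \<open>\<xi>, e, f = \<phi> e\<close>, normality forces \<open>\<nabla>\<xi> = b1 (Id - \<eta> \<otimes> \<xi>) + b2 \<phi>\<close>, so that
  \<open>L\<^sub>\<xi> g = 2 b1 (g - \<eta> \<otimes> \<eta>)\<close>, and the first Bianchi identity gives \<open>\<xi>(b2) = -2 b1 b2\<close>.  For a soliton
  with constant \<open>l\<close>, the Ricci equations in the directions containing \<open>\<xi>\<close> read
  \<open>\<xi>(b1) + b1\<^sup>2 + b2\<^sup>2 = -l/2\<close>, \<open>e(b1) = f(b2)\<close> and \<open>f(b1) = e(b2)\<close>, and the second Bianchi identity gives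
  \<open>\<xi>(b1) = -2 b1\<^sup>2\<close>.  Hence \<open>l = 2 (b1\<^sup>2 - b2\<^sup>2)\<close>, and differentiating along \<open>\<xi>\<close> yields \<open>b1 l = 0\<close>.

  If \<open>l = 0\<close>, then \<open>u v = 0\<close> for \<open>u = b1 + b2\<close> and \<open>v = b1 - b2\<close>.  To obtain one sign near a point where
  both vanish, note that the zero set of \<open>u\<close> is invariant under the flows of \<open>\<xi>\<close> and \<open>e - f\<close>, that of
  \<open>v\<close> under the flow of \<open>e + f\<close>, and these three fields are independent: if both functions were nonzero
  at nearby points, they would be nonzero at a common point.
\<close>

section \<open>Calculus of smooth maps\<close>

text \<open>Why the second Bianchi identity closes up: in dimension three the Ricci tensor
  determines the curvature. For a soliton the planes of \<xi>, e and \<xi>, f have curvature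
  \<open>l/2\<close>, that of e, f has \<open>l/2 - 2 b1\<close>, and the mixed components vanish.
  So \<open>b1\<close> is the only function left to differentiate. In the unsteady case
  \<open>b1 = 0\<close>, every curvature is \<open>l/2\<close>, and its constancy is that of
  \<open>l\<close>.

  The obstacle in the steady case is the sign. Two smooth functions with product zero may vanish on
  opposite sides of a surface, so \<open>u v = 0\<close> alone gives no neighbourhood on which one
  of them vanishes. Transport excludes this: from a point with \<open>u\<close> nonzero one moves
  along two fields, from a point with \<open>v\<close> nonzero along the third, and the two end
  points must be matched. That is a system of three equations in three parameters, close to an
  invertible linear one, hence solvable by Brouwer. Euler polygons of fixed mesh serve as the
  curves: they depend continuously on the parameters, and a discrete growth estimate keeps
  \<open>u\<close> and \<open>v\<close> away from zero.\<close>

lemma Ck_on_cong: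
  assumes "open S" "\<And>x. x \<in> S \<Longrightarrow> f x = g x" "Ck_on k S f"
  shows "Ck_on k S g"
  using assms(2,3)
proof (induction k arbitrary: f g)
  case 0
  then show ?case using continuous_on_cong[of S S f g] by simp
next
  case (Suc k)
  have D: "g differentiable at x" "frechet_derivative f (at x) = frechet_derivative g (at x)"
    if "x \<in> S" for x
  proof -
    have f: "f differentiable at x" using Suc.prems that by simp
    show "frechet_derivative f (at x) = frechet_derivative g (at x)"
      by (rule frechet_derivative_transform_within_open[OF f assms(1) that Suc.prems(1)])
    show "g differentiable at x"
      using f unfolding differentiable_def
      by (metis has_derivative_transform_within_open assms(1) that Suc.prems(1))
  qed
  show ?case using Suc.IH[of "\<lambda>x. frechet_derivative f (at x) _"] Suc.prems(2) D by simp
qed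

lemma Ck_on_SucD: "Ck_on (Suc k) S f \<Longrightarrow> Ck_on k S f"
proof (induction k arbitrary: f)
  case 0
  then show ?case
    by (auto intro!: continuous_at_imp_continuous_on differentiable_imp_continuous_within)
next
  case (Suc k)
  then show ?case by (metis Ck_on.simps(2))
qed

lemma Ck_on_subset: "Ck_on k S f \<Longrightarrow> W \<subseteq> S \<Longrightarrow> Ck_on k W f"
  by (induction k arbitrary: f) (auto intro: continuous_on_subset)

lemma Ck_on_const: "Ck_on k S (\<lambda>x. c)"
  by (induction k arbitrary: c) auto

lemma Ck_on_add:
  assumes "open S" "Ck_on k S f" "Ck_on k S g"
  shows "Ck_on k S (\<lambda>x. f x + g x)"
  using assms(2,3)
proof (induction k arbitrary: f g)
  case 0
  then show ?case by (auto intro: continuous_on_add)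
next
  case (Suc k)
  have D: "frechet_derivative (\<lambda>x. f x + g x) (at x) v
      = frechet_derivative f (at x) v + frechet_derivative g (at x) v" if "x \<in> S" for x v
  proof -
    have "((\<lambda>x. f x + g x) has_derivative
       (\<lambda>v. frechet_derivative f (at x) v + frechet_derivative g (at x) v)) (at x)"
      using Suc.prems that by (intro has_derivative_add) (auto simp: frechet_derivative_works[symmetric])
    from frechet_derivative_at[OF this] show ?thesis by metis
  qed
  have "Ck_on k S (\<lambda>x. frechet_derivative (\<lambda>x. f x + g x) (at x) v)" for v
    by (rule Ck_on_cong[OF assms(1) _ Suc.IH[of "\<lambda>x. frechet_derivative f (at x) v"
          "\<lambda>x. frechet_derivative g (at x) v"]]) (use D Suc.prems in auto)
  then show ?case using Suc.prems by auto
qed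

text \<open>The product rule pairs a derivative with an undifferentiated factor; the latter enters
  one order below its regularity, hence \<open>Ck_on_SucD\<close>.\<close>

lemma Ck_on_bilinear:
  assumes "bounded_bilinear B" "open S" "Ck_on k S f" "Ck_on k S g"
  shows "Ck_on k S (\<lambda>x. B (f x) (g x))"
  using assms(3,4)
proof (induction k arbitrary: f g)
  case 0
  then show ?case using bounded_bilinear.continuous_on[OF assms(1)] by auto
next
  case (Suc k)
  have H: "((\<lambda>x. B (f x) (g x)) has_derivative
       (\<lambda>v. B (f x) (frechet_derivative g (at x) v) + B (frechet_derivative f (at x) v) (g x))) (at x)"
    if "x \<in> S" for x
    using Suc.prems that
    by (intro bounded_bilinear.FDERIV[OF assms(1)]) (auto simp: frechet_derivative_works[symmetric])
  have D: "B (f x) (frechet_derivative g (at x) v) + B (frechet_derivative f (at x) v) (g x)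
      = frechet_derivative (\<lambda>x. B (f x) (g x)) (at x) v" if "x \<in> S" for x v
    using frechet_derivative_at[OF H[OF that]] by metis
  have "Ck_on k S (\<lambda>x. frechet_derivative (\<lambda>x. B (f x) (g x)) (at x) v)" for v
    by (rule Ck_on_cong[OF assms(2) D], assumption, rule Ck_on_add[OF assms(2)]; rule Suc.IH)
       (use Suc.prems Ck_on_SucD in auto)
  moreover have "\<forall>x\<in>S. (\<lambda>x. B (f x) (g x)) differentiable at x"
    using H unfolding differentiable_def by blast
  ultimately show ?case unfolding Ck_on.simps(2) by blast
qed

text \<open>Covers reciprocals (\<open>n = 2\<close>, \<open>a = -1\<close>) and inverse square roots (\<open>n = 3\<close>, \<open>a = -1/2\<close>).\<close>

lemma Ck_on_autonomous:
  fixes f h :: "'a::real_normed_vector \<Rightarrow> real"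
  assumes S: "open S" and f: "\<And>k. Ck_on k S f"
    and h: "\<And>x. x \<in> S \<Longrightarrow>
      (h has_derivative (\<lambda>v. a * (frechet_derivative f (at x) v * h x ^ n))) (at x)"
  shows "Ck_on k S h"
proof (induction k)
  case 0
  then show ?case
    by (auto intro!: continuous_at_imp_continuous_on has_derivative_continuous[OF h])
next
  case (Suc k)
  \<comment> \<open>Bootstrapping: the derivative of \<open>h\<close> is a polynomial in
    \<open>h\<close> times a derivative of \<open>f\<close>, so it inherits the order already known
    for \<open>h\<close>.\<close>
  have pow: "Ck_on k S (\<lambda>x. h x ^ m)" for m
  proof (induction m)
    case (Suc m)
    then show ?case using Ck_on_bilinear[OF bounded_bilinear_mult S \<open>Ck_on k S h\<close>] by simp
  qed (simp add: Ck_on_const)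
  have "Ck_on k S (\<lambda>x. frechet_derivative h (at x) v)" for v
  proof (rule Ck_on_cong[OF S])
    show "a * (frechet_derivative f (at x) v * h x ^ n) = frechet_derivative h (at x) v"
      if "x \<in> S" for x using frechet_derivative_at[OF h[OF that]] by metis
    show "Ck_on k S (\<lambda>x. a * (frechet_derivative f (at x) v * h x ^ n))"
      using f[of "Suc k"]
      by (intro Ck_on_bilinear[OF bounded_bilinear_mult S] Ck_on_const pow) simp
  qed
  moreover have "\<forall>x\<in>S. h differentiable at x"
    using h unfolding differentiable_def by blast
  ultimately show ?case unfolding Ck_on.simps(2) by blast
qed

section \<open>Closure properties of smooth maps\<close>

lemma smooth_on_cong:
  "open S \<Longrightarrow> (\<And>x. x \<in> S \<Longrightarrow> f x = g x) \<Longrightarrow> smooth_on S f \<Longrightarrow> smooth_on S g"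
  unfolding smooth_on_def using Ck_on_cong by blast

lemma smooth_on_subset: "smooth_on S f \<Longrightarrow> W \<subseteq> S \<Longrightarrow> smooth_on W f"
  unfolding smooth_on_def using Ck_on_subset by blast

lemma smooth_on_imp_continuous_on: "smooth_on S f \<Longrightarrow> continuous_on S f"
  unfolding smooth_on_def by (metis Ck_on.simps(1))

lemma smooth_on_const: "smooth_on S (\<lambda>x. c)"
  unfolding smooth_on_def by (simp add: Ck_on_const)

lemma smooth_on_add:
  "open S \<Longrightarrow> smooth_on S f \<Longrightarrow> smooth_on S g \<Longrightarrow> smooth_on S (\<lambda>x. f x + g x)"
  unfolding smooth_on_def by (simp add: Ck_on_add)

lemma smooth_on_bilinear:
  "bounded_bilinear B \<Longrightarrow> open S \<Longrightarrow> smooth_on S f \<Longrightarrow> smooth_on S g \<Longrightarrow>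
    smooth_on S (\<lambda>x. B (f x) (g x))"
  unfolding smooth_on_def by (simp add: Ck_on_bilinear)

lemma smooth_on_linear:
  assumes "bounded_linear L" "open S" "smooth_on S f"
  shows "smooth_on S (\<lambda>x. L (f x))"
  \<comment> \<open>A linear map is the bilinear map \<open>r *\<^sub>R L x\<close> with the
    constant factor \<open>r = 1\<close>.\<close>
  using smooth_on_bilinear[OF bounded_bilinear.comp1[OF bounded_bilinear_scaleR[THEN bounded_bilinear.flip] assms(1)]
      assms(2,3) smooth_on_const[of S "1::real"]] by simp

lemmas smooth_on_mult = smooth_on_bilinear[OF bounded_bilinear_mult]
lemmas smooth_on_scaleR = smooth_on_bilinear[OF bounded_bilinear_scaleR]
lemmas smooth_on_inner = smooth_on_bilinear[OF bounded_bilinear_inner]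
lemmas smooth_on_nth = smooth_on_linear[OF bounded_linear_vec_nth]

lemma smooth_on_minus: "open S \<Longrightarrow> smooth_on S f \<Longrightarrow> smooth_on S (\<lambda>x. - f x)"
  using smooth_on_linear[OF bounded_linear_minus[OF bounded_linear_ident]] by blast

lemma smooth_on_diff:
  "open S \<Longrightarrow> smooth_on S f \<Longrightarrow> smooth_on S g \<Longrightarrow> smooth_on S (\<lambda>x. f x - g x)"
  using smooth_on_add[OF _ _ smooth_on_minus] by fastforce

lemma smooth_on_sum:
  "open S \<Longrightarrow> (\<And>i. i \<in> I \<Longrightarrow> smooth_on S (f i)) \<Longrightarrow> smooth_on S (\<lambda>x. \<Sum>i\<in>I. f i x)"
  by (induction I rule: infinite_finite_induct) (auto simp: smooth_on_const intro: smooth_on_add)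

lemma smooth_on_vec:
  fixes f :: "'a::real_normed_vector \<Rightarrow> ('b::euclidean_space) ^ 'n"
  assumes "open S" "\<And>i. smooth_on S (\<lambda>x. f x $ i)"
  shows "smooth_on S f"
proof -
  have f_eq: "f = (\<lambda>x. \<Sum>i\<in>UNIV. axis i (f x $ i))"
  proof
    fix x show "f x = (\<Sum>i\<in>UNIV. axis i (f x $ i))"
      by (auto simp: vec_eq_iff axis_def sum.delta)
  qed
  have bl: "bounded_linear (axis i :: 'b \<Rightarrow> 'b ^ 'n)" for i
    by (rule linear_conv_bounded_linear[THEN iffD1]) (auto intro!: linearI simp: vec_eq_iff axis_def)
  have "smooth_on S (\<lambda>x. axis i (f x $ i) :: 'b ^ 'n)" for i
    by (rule smooth_on_linear[OF bl assms])
  then have "smooth_on S (\<lambda>x. \<Sum>i\<in>UNIV. axis i (f x $ i))"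
    by (intro smooth_on_sum assms(1))
  then show ?thesis by (simp flip: f_eq)
qed

lemma bounded_bilinear_matrix_vector:
  "bounded_bilinear ((*v) :: real^'n^'m \<Rightarrow> real^'n \<Rightarrow> real^'m)"
  unfolding bilinear_conv_bounded_bilinear[symmetric] bilinear_def
proof (intro conjI allI)
  show "linear ((*v) A)" for A :: "real^'n^'m" by simp
  show "linear (\<lambda>A :: real^'n^'m. A *v v)" for v
    by (rule linearI) (simp_all add: matrix_vector_mult_add_rdistrib scaleR_matrix_vector_assoc)
qed

lemmas smooth_on_matrix_vector = smooth_on_bilinear[OF bounded_bilinear_matrix_vector]

lemma smooth_on_bil:
  "open S \<Longrightarrow> smooth_on S G \<Longrightarrow> smooth_on S X \<Longrightarrow> smooth_on S Y \<Longrightarrow>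
    smooth_on S (\<lambda>x. bil (G x) (X x) (Y x))"
  unfolding bil_def by (intro smooth_on_inner smooth_on_matrix_vector)

lemma smooth_on_inverse:
  fixes f :: "'a::real_normed_vector \<Rightarrow> real"
  assumes "open S" "smooth_on S f" "\<And>x. x \<in> S \<Longrightarrow> f x \<noteq> 0"
  shows "smooth_on S (\<lambda>x. inverse (f x))"
  unfolding smooth_on_def
proof (rule allI, rule Ck_on_autonomous[where f = f and a = "-1" and n = 2])
  fix x assume "x \<in> S"
  moreover have "(f has_derivative frechet_derivative f (at x)) (at x)"
    using assms(2) \<open>x \<in> S\<close> unfolding smooth_on_def
    by (metis Ck_on.simps(2) frechet_derivative_works)
  ultimately show "((\<lambda>x. inverse (f x)) has_derivative
      (\<lambda>v. -1 * (frechet_derivative f (at x) v * (inverse (f x))\<^sup>2))) (at x)"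
    using assms(3) by (auto intro!: derivative_eq_intros simp: power2_eq_square)
qed (use assms smooth_on_def in auto)

lemma smooth_on_inverse_sqrt:
  fixes f :: "'a::real_normed_vector \<Rightarrow> real"
  assumes "open S" "smooth_on S f" "\<And>x. x \<in> S \<Longrightarrow> f x > 0"
  shows "smooth_on S (\<lambda>x. inverse (sqrt (f x)))"
  unfolding smooth_on_def
proof (rule allI, rule Ck_on_autonomous[where f = f and a = "-1/2" and n = 3])
  fix x assume "x \<in> S"
  moreover have "(f has_derivative frechet_derivative f (at x)) (at x)"
    using assms(2) \<open>x \<in> S\<close> unfolding smooth_on_def
    by (metis Ck_on.simps(2) frechet_derivative_works)
  ultimately have f: "(f has_derivative frechet_derivative f (at x)) (at x)" and pos: "0 < f x"
    using assms(3) by blast+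
  have "((\<lambda>y. inverse (sqrt y)) has_real_derivative - (1/2) * inverse (sqrt (f x)) ^ 3) (at (f x))"
    by (rule derivative_eq_intros DERIV_real_sqrt | use pos in force)+
       (use pos in \<open>simp add: power2_eq_square power3_eq_cube\<close>)
  from has_derivative_compose[OF f this[unfolded has_field_derivative_def]]
  show "((\<lambda>x. inverse (sqrt (f x))) has_derivative
      (\<lambda>v. -1/2 * (frechet_derivative f (at x) v * (inverse (sqrt (f x))) ^ 3))) (at x)"
    by (simp add: mult_ac)
qed (use assms smooth_on_def in auto)

section \<open>Directional derivatives and their symmetry\<close>

lemma smooth_on_has_dderiv:
  "smooth_on S f \<Longrightarrow> x \<in> S \<Longrightarrow> (f has_derivative dderiv f x) (at x)"
  unfolding smooth_on_def dderiv_def by (metis Ck_on.simps(2) frechet_derivative_works)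

lemma dderiv_unique: "(f has_derivative D) (at x) \<Longrightarrow> dderiv f x = D"
  unfolding dderiv_def by (metis frechet_derivative_at)

lemma dderiv_cong:
  assumes "open S" "x \<in> S" "smooth_on S f" "\<And>y. y \<in> S \<Longrightarrow> f y = g y"
  shows "dderiv f x = dderiv g x"
  by (rule dderiv_unique[symmetric],
      rule has_derivative_transform_within_open[OF smooth_on_has_dderiv])
     (use assms in auto)

lemma smooth_on_dderiv_const: "smooth_on S f \<Longrightarrow> smooth_on S (\<lambda>x. dderiv f x v)"
  unfolding smooth_on_def dderiv_def by (metis Ck_on.simps(2))

lemma linear_dderiv: "smooth_on S f \<Longrightarrow> x \<in> S \<Longrightarrow> linear (dderiv f x)"
  using smooth_on_has_dderiv has_derivative_linear by blast

lemma vec_expand: "(v :: real^'n) = (\<Sum>i\<in>UNIV. v $ i *\<^sub>R axis i 1)"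
  by (metis basis_expansion scalar_mult_eq_scaleR)

lemma dderiv_expand:
  assumes "smooth_on S f" "x \<in> S"
  shows "dderiv f x v = (\<Sum>i\<in>UNIV. v $ i *\<^sub>R dderiv f x (axis i 1))"
  by (subst vec_expand[of v])
     (simp add: linear_sum[OF linear_dderiv[OF assms]] linear_scale[OF linear_dderiv[OF assms]])

text \<open>\<open>Ck_on\<close> speaks of constant directions only; expanding \<open>X x\<close> in
  the standard basis reduces a varying direction to those.\<close>

lemma smooth_on_dderiv:
  assumes "open S" "smooth_on S f" "smooth_on S X"
  shows "smooth_on S (\<lambda>x. dderiv f x (X x))"
  by (rule smooth_on_cong[OF assms(1) dderiv_expand[OF assms(2), symmetric]], assumption)
     (intro smooth_on_sum smooth_on_scaleR smooth_on_dderiv_const smooth_on_nth assms)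

lemma has_derivative_comp_line:
  assumes "smooth_on S f" "x + t *\<^sub>R v \<in> S"
  shows "((\<lambda>t. f (x + t *\<^sub>R v)) has_derivative (\<lambda>h. h *\<^sub>R dderiv f (x + t *\<^sub>R v) v)) (at t)"
proof -
  have "((\<lambda>t. x + t *\<^sub>R v) has_derivative (\<lambda>h. h *\<^sub>R v)) (at t)"
    by (auto intro!: derivative_eq_intros)
  from has_derivative_compose[OF this smooth_on_has_dderiv[OF assms]] show ?thesis
    by (simp add: linear_scale[OF linear_dderiv[OF assms]])
qed

lemma DERIV_comp_line:
  fixes f :: "R3 \<Rightarrow> real"
  assumes "smooth_on S f" "x + t *\<^sub>R v \<in> S"
  shows "((\<lambda>t. f (x + t *\<^sub>R v)) has_real_derivative dderiv f (x + t *\<^sub>R v) v) (at t)"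
  using has_derivative_comp_line[OF assms] unfolding has_field_derivative_def
  by (simp add: mult_commute_abs)

text \<open>Two mean value theorems, along \<open>u\<close> for the difference \<open>F\<close> and
  then along \<open>v\<close> for the derivative. The left side is symmetric in \<open>u\<close> and
  \<open>v\<close>, which is the source of the symmetry of second derivatives.\<close>

lemma mixed_difference:
  fixes f :: "R3 \<Rightarrow> real"
  assumes S: "ball x r \<subseteq> S" and f: "smooth_on S f" and h: "0 < h" "h * (norm u + norm v) < r"
  obtains y where "dist x y \<le> h * (norm u + norm v)"
    "f (x + h *\<^sub>R u + h *\<^sub>R v) - f (x + h *\<^sub>R u) - f (x + h *\<^sub>R v) + f x
      = h\<^sup>2 * dderiv (\<lambda>z. dderiv f z u) y v"
proof -
  have near: "dist x (x + a *\<^sub>R u + b *\<^sub>R v) \<le> h * (norm u + norm v)"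
    if "0 \<le> a" "a \<le> h" "0 \<le> b" "b \<le> h" for a b
  proof -
    have "norm (a *\<^sub>R u + b *\<^sub>R v) \<le> a * norm u + b * norm v"
      using norm_triangle_ineq[of "a *\<^sub>R u" "b *\<^sub>R v"] that by simp
    also have "\<dots> \<le> h * norm u + h * norm v"
      using that by (intro add_mono mult_right_mono) auto
    finally have "norm (a *\<^sub>R u + b *\<^sub>R v) \<le> h * (norm u + norm v)" by (simp add: distrib_left)
    moreover have "dist x (x + a *\<^sub>R u + b *\<^sub>R v) = norm (a *\<^sub>R u + b *\<^sub>R v)"
      unfolding dist_norm by (metis add.assoc add_diff_cancel_left' norm_minus_commute)
    ultimately show ?thesis by simp
  qed
  have mem: "x + a *\<^sub>R u + b *\<^sub>R v \<in> S" if "0 \<le> a" "a \<le> h" "0 \<le> b" "b \<le> h" for a b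
    using near[OF that] h(2) S by (meson le_less_trans mem_ball subsetD)
  define F where "F a = f ((x + h *\<^sub>R v) + a *\<^sub>R u) - f (x + a *\<^sub>R u)" for a
  have "\<exists>a>0. a < h \<and> F h - F 0 = (h - 0) *
      (dderiv f ((x + h *\<^sub>R v) + a *\<^sub>R u) u - dderiv f (x + a *\<^sub>R u) u)"
    unfolding F_def
    by (rule MVT2[OF h(1)], intro derivative_intros DERIV_comp_line[OF f])
       (use mem[of _ h] mem[of _ 0] h in \<open>auto simp: add_ac\<close>)
  then obtain a where a: "0 < a" "a < h" and Fa: "F h - F 0 = h *
      (dderiv f ((x + a *\<^sub>R u) + h *\<^sub>R v) u - dderiv f ((x + a *\<^sub>R u) + 0 *\<^sub>R v) u)"
    by (auto simp: add_ac)
  have "\<exists>b>0. b < h \<and>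
      dderiv f ((x + a *\<^sub>R u) + h *\<^sub>R v) u - dderiv f ((x + a *\<^sub>R u) + 0 *\<^sub>R v) u
      = (h - 0) * dderiv (\<lambda>z. dderiv f z u) ((x + a *\<^sub>R u) + b *\<^sub>R v) v"
    by (rule MVT2[OF h(1)], rule DERIV_comp_line[OF smooth_on_dderiv_const[OF f]])
       (use mem[of a] a in auto)
  then obtain b where b: "0 < b" "b < h" and Fb:
      "dderiv f ((x + a *\<^sub>R u) + h *\<^sub>R v) u - dderiv f ((x + a *\<^sub>R u) + 0 *\<^sub>R v) u
      = h * dderiv (\<lambda>z. dderiv f z u) ((x + a *\<^sub>R u) + b *\<^sub>R v) v" by auto
  show ?thesis
  proof (rule that[OF near])
    show "f (x + h *\<^sub>R u + h *\<^sub>R v) - f (x + h *\<^sub>R u) - f (x + h *\<^sub>R v) + f x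
      = h\<^sup>2 * dderiv (\<lambda>z. dderiv f z u) (x + a *\<^sub>R u + b *\<^sub>R v) v"
      using Fa Fb by (simp add: F_def power2_eq_square add_ac)
  qed (use a b in auto)
qed

lemma dderiv_commute_real:
  fixes f :: "R3 \<Rightarrow> real"
  assumes "open S" "smooth_on S f" "x \<in> S"
  shows "dderiv (\<lambda>y. dderiv f y v) x u = dderiv (\<lambda>y. dderiv f y u) x v"
proof (rule ccontr)
  define P where "P = (\<lambda>z. dderiv (\<lambda>y. dderiv f y v) z u)"
  define Q where "Q = (\<lambda>z. dderiv (\<lambda>y. dderiv f y u) z v)"
  assume "\<not> ?thesis"
  \<comment> \<open>Near \<open>x\<close> both \<open>P\<close> and \<open>Q\<close> stay within
    half the gap of their values at \<open>x\<close>, yet the symmetric second difference will force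
    them to share a value there.\<close>
  then have pos: "\<bar>P x - Q x\<bar> / 2 > 0" by (simp add: P_def Q_def)
  have "isCont P x" "isCont Q x"
    unfolding P_def Q_def
    by (rule has_derivative_continuous[OF smooth_on_has_dderiv[OF
        smooth_on_dderiv_const[OF smooth_on_dderiv_const[OF assms(2)]] assms(3)]])+
  then have "\<exists>d>0. \<forall>y. dist y x < d \<longrightarrow> dist (P y) (P x) < \<bar>P x - Q x\<bar> / 2"
      "\<exists>d>0. \<forall>y. dist y x < d \<longrightarrow> dist (Q y) (Q x) < \<bar>P x - Q x\<bar> / 2"
    using pos unfolding continuous_at_eps_delta by blast+
  then obtain d1 d2 where d: "d1 > 0" "d2 > 0"
    "\<And>y. dist x y < d1 \<Longrightarrow> \<bar>P y - P x\<bar> < \<bar>P x - Q x\<bar> / 2"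
    "\<And>y. dist x y < d2 \<Longrightarrow> \<bar>Q y - Q x\<bar> < \<bar>P x - Q x\<bar> / 2"
    unfolding dist_real_def dist_commute[of _ x] by blast
  obtain r0 where r0: "r0 > 0" "ball x r0 \<subseteq> S" using assms(1,3) openE by blast
  define r where "r = min r0 (min d1 d2)"
  \<comment> \<open>The summand \<open>1\<close> keeps the denominator positive for
    \<open>u = v = 0\<close> and makes the parallelogram lie strictly inside the ball.\<close>
  define h where "h = r / (norm u + norm v + 1)"
  have N: "0 < norm u + norm v + 1" by (smt (verit) norm_ge_zero)
  have r: "r > 0" "ball x r \<subseteq> S" using r0 d unfolding r_def by auto
  have h: "0 < h" using r N by (simp add: h_def)
  have "h * (norm u + norm v) < h * (norm u + norm v + 1)" using h by simp
  also have "\<dots> = r" using N by (simp add: h_def)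
  finally have hr: "h * (norm u + norm v) < r" .
  obtain y where y: "dist x y \<le> h * (norm u + norm v)"
    "f (x + h *\<^sub>R u + h *\<^sub>R v) - f (x + h *\<^sub>R u) - f (x + h *\<^sub>R v) + f x = h\<^sup>2 * Q y"
    unfolding Q_def by (rule mixed_difference[OF r(2) assms(2) h hr])
  have hr': "h * (norm v + norm u) < r" using hr by (simp add: add.commute)
  obtain z where z: "dist x z \<le> h * (norm v + norm u)"
    "f (x + h *\<^sub>R v + h *\<^sub>R u) - f (x + h *\<^sub>R v) - f (x + h *\<^sub>R u) + f x = h\<^sup>2 * P z"
    unfolding P_def by (rule mixed_difference[OF r(2) assms(2) h hr'])
  have yz: "dist x y < r" "dist x z < r" using y(1) z(1) hr hr' by linarith+
  have "h\<^sup>2 * Q y = h\<^sup>2 * P z" by (simp add: add_ac flip: y(2) z(2))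
  then have "Q y = P z" using h by simp
  moreover have "\<bar>P z - P x\<bar> < \<bar>P x - Q x\<bar> / 2" "\<bar>Q y - Q x\<bar> < \<bar>P x - Q x\<bar> / 2"
    using d(3)[of z] d(4)[of y] yz unfolding r_def by auto
  ultimately show False by (smt (verit) field_sum_of_halves)
qed

lemma dderiv_nth:
  assumes "smooth_on S f" "x \<in> S"
  shows "dderiv (\<lambda>y. f y $ i) x v = dderiv f x v $ i"
  by (rule fun_cong[OF dderiv_unique[OF bounded_linear.has_derivative[OF bounded_linear_vec_nth
        smooth_on_has_dderiv[OF assms]]]])

lemma dderiv_commute:
  fixes f :: "R3 \<Rightarrow> real^'n"
  assumes S: "open S" and f: "smooth_on S f" and x: "x \<in> S"
  shows "dderiv (\<lambda>y. dderiv f y v) x u = dderiv (\<lambda>y. dderiv f y u) x v"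
proof (rule vec_eq_iff[THEN iffD2], rule allI)
  fix i
  have *: "dderiv (\<lambda>y. dderiv f y v) x u $ i = dderiv (\<lambda>y. dderiv (\<lambda>z. f z $ i) y v) x u" for u v
  proof -
    have "dderiv (\<lambda>y. dderiv f y v) x u $ i = dderiv (\<lambda>y. dderiv f y v $ i) x u"
      by (rule dderiv_nth[OF smooth_on_dderiv_const[OF f] x, symmetric])
    also have "dderiv (\<lambda>y. dderiv f y v $ i) x = dderiv (\<lambda>y. dderiv (\<lambda>z. f z $ i) y v) x"
      by (rule dderiv_cong[OF S x])
         (simp_all add: smooth_on_nth S smooth_on_dderiv_const f dderiv_nth[OF f])
    finally show ?thesis .
  qed
  show "dderiv (\<lambda>y. dderiv f y v) x u $ i = dderiv (\<lambda>y. dderiv f y u) x v $ i"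
    unfolding * by (rule dderiv_commute_real[OF S smooth_on_nth[OF S f] x])
qed

lemma dderiv_const [simp]: "dderiv (\<lambda>y. c) x v = 0"
  by (simp add: dderiv_def)

lemma dderiv_add:
  assumes "smooth_on S f" "smooth_on S h" "x \<in> S"
  shows "dderiv (\<lambda>y. f y + h y) x v = dderiv f x v + dderiv h x v"
  using fun_cong[OF dderiv_unique[OF has_derivative_add[OF
    smooth_on_has_dderiv[OF assms(1,3)] smooth_on_has_dderiv[OF assms(2,3)]]], of v] .

lemma dderiv_diff:
  assumes "smooth_on S f" "smooth_on S h" "x \<in> S"
  shows "dderiv (\<lambda>y. f y - h y) x v = dderiv f x v - dderiv h x v"
  using fun_cong[OF dderiv_unique[OF has_derivative_diff[OF
    smooth_on_has_dderiv[OF assms(1,3)] smooth_on_has_dderiv[OF assms(2,3)]]], of v] .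

lemma dderiv_bilinear:
  assumes "bounded_bilinear B" "smooth_on S f" "smooth_on S h" "x \<in> S"
  shows "dderiv (\<lambda>y. B (f y) (h y)) x v = B (dderiv f x v) (h x) + B (f x) (dderiv h x v)"
  using fun_cong[OF dderiv_unique[OF bounded_bilinear.FDERIV[OF assms(1)
    smooth_on_has_dderiv[OF assms(2,4)] smooth_on_has_dderiv[OF assms(3,4)]]], of v]
  by (simp add: add.commute)

lemmas dderiv_mult = dderiv_bilinear[OF bounded_bilinear_mult]
lemmas dderiv_scaleR = dderiv_bilinear[OF bounded_bilinear_scaleR]
lemmas dderiv_inner = dderiv_bilinear[OF bounded_bilinear_inner]
lemmas dderiv_matrix_vector = dderiv_bilinear[OF bounded_bilinear_matrix_vector]

lemma dderiv_bil:
  assumes "open S" "smooth_on S G" "smooth_on S X" "smooth_on S Y" "x \<in> S"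
  shows "dderiv (\<lambda>y. bil (G y) (X y) (Y y)) x v
    = bil (dderiv G x v) (X x) (Y x) + bil (G x) (dderiv X x v) (Y x) + bil (G x) (X x) (dderiv Y x v)"
  unfolding bil_def
  by (simp add: dderiv_inner[OF assms(3) smooth_on_matrix_vector[OF assms(1,2,4)] assms(5)]
      dderiv_matrix_vector[OF assms(2,4,5)] inner_add_right)

lemma dderiv_field:
  fixes Y :: "R3 \<Rightarrow> R3"
  assumes S: "open S" "smooth_on S Z" "smooth_on S Y" "x \<in> S"
  shows "dderiv (\<lambda>y. dderiv Z y (Y y)) x v
    = dderiv (\<lambda>y. dderiv Z y (Y x)) x v + dderiv Z x (dderiv Y x v)"
proof -
  have Zi: "smooth_on S (\<lambda>y. dderiv Z y (axis i 1))" for i by (rule smooth_on_dderiv_const[OF S(2)])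
  have Yi: "smooth_on S (\<lambda>y. Y y $ i)" for i by (rule smooth_on_nth[OF S(1,3)])
  have gen: "dderiv (\<lambda>y. dderiv Z y (W y)) x v = (\<Sum>i\<in>UNIV.
     dderiv (\<lambda>y. W y $ i) x v *\<^sub>R dderiv Z x (axis i 1)
     + W x $ i *\<^sub>R dderiv (\<lambda>y. dderiv Z y (axis i 1)) x v)" if W: "smooth_on S W" for W
  proof -
    have Wi: "smooth_on S (\<lambda>y. W y $ i)" for i by (rule smooth_on_nth[OF S(1) W])
    have "dderiv (\<lambda>y. dderiv Z y (W y)) x = dderiv (\<lambda>y. \<Sum>i\<in>UNIV. W y $ i *\<^sub>R dderiv Z y (axis i 1)) x"
      by (rule dderiv_cong[OF S(1,4) smooth_on_dderiv[OF S(1,2) W] dderiv_expand[OF S(2)]])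
    also have "\<dots> = (\<lambda>v. \<Sum>i\<in>UNIV. dderiv (\<lambda>y. W y $ i *\<^sub>R dderiv Z y (axis i 1)) x v)"
      by (rule dderiv_unique, rule has_derivative_sum,
          rule smooth_on_has_dderiv[OF smooth_on_scaleR[OF S(1) Wi Zi] S(4)])
    finally show ?thesis by (simp add: dderiv_scaleR[OF Wi Zi S(4)])
  qed
  \<comment> \<open>Comparing \<open>Y\<close> with the constant field of value \<open>Y x\<close>
    isolates the terms in which the coefficients of \<open>Y\<close> are differentiated.\<close>
  show ?thesis unfolding gen[OF S(3)] gen[OF smooth_on_const[of S "Y x"]]
    by (simp add: sum.distrib dderiv_nth[OF S(3,4)] dderiv_expand[OF S(2,4), of "dderiv Y x v"])
qed

lemma smooth_on_lie_bracket:
  "open S \<Longrightarrow> smooth_on S X \<Longrightarrow> smooth_on S Y \<Longrightarrow> smooth_on S (lie_bracket X Y)"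
  unfolding lie_bracket_def[abs_def] by (intro smooth_on_diff smooth_on_dderiv)

text \<open>Each second derivative occurs twice with opposite signs once the order of
  differentiation is exchanged; the terms with nested first derivatives cancel in pairs.\<close>

lemma lie_bracket_jacobi:
  assumes S: "open S" and X: "smooth_on S X" and Y: "smooth_on S Y" and Z: "smooth_on S Z"
    and x: "x \<in> S"
  shows "lie_bracket X (lie_bracket Y Z) x + lie_bracket Y (lie_bracket Z X) x
    + lie_bracket Z (lie_bracket X Y) x = 0"
proof -
  have D: "dderiv (lie_bracket Y Z) x v
     = dderiv (\<lambda>y. dderiv Z y (Y x)) x v + dderiv Z x (dderiv Y x v)
     - (dderiv (\<lambda>y. dderiv Y y (Z x)) x v + dderiv Y x (dderiv Z x v))"
    if "smooth_on S Y" "smooth_on S Z" for Y Z v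
    unfolding lie_bracket_def[abs_def]
    by (simp add: dderiv_diff[OF smooth_on_dderiv[OF S] smooth_on_dderiv[OF S] x]
        dderiv_field[OF S _ _ x] that)
  have C: "dderiv (\<lambda>y. dderiv Z y u) x v = dderiv (\<lambda>y. dderiv Z y v) x u" if "smooth_on S Z" for Z :: "R3 \<Rightarrow> R3" and u v
    by (rule dderiv_commute[OF S that x])
  have L: "dderiv X x (u - v) = dderiv X x u - dderiv X x v" if "smooth_on S X" for X :: "R3 \<Rightarrow> R3" and u v
    using linear_diff[OF linear_dderiv[OF that x]] .
  show ?thesis
    unfolding lie_bracket_def[of _ "lie_bracket _ _"] D[OF Y Z] D[OF Z X] D[OF X Y]
    unfolding lie_bracket_def
    by (simp add: L X Y Z C[OF X, of "Y x" "Z x"] C[OF Y, of "X x" "Z x"] C[OF Z, of "X x" "Y x"])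
qed

section \<open>Smoothness of the inverse matrix\<close>

lemma smooth_on_prod:
  fixes f :: "'i \<Rightarrow> 'a::real_normed_vector \<Rightarrow> real"
  shows "open S \<Longrightarrow> (\<And>i. i \<in> I \<Longrightarrow> smooth_on S (f i)) \<Longrightarrow> smooth_on S (\<lambda>x. \<Prod>i\<in>I. f i x)"
  by (induction I rule: infinite_finite_induct) (auto simp: smooth_on_const intro: smooth_on_mult)

lemma smooth_on_det:
  fixes M :: "'a::real_normed_vector \<Rightarrow> real^'n^'n"
  assumes "open S" "\<And>i j. smooth_on S (\<lambda>x. M x $ i $ j)"
  shows "smooth_on S (\<lambda>x. det (M x))"
  unfolding det_def
  by (intro smooth_on_sum smooth_on_mult smooth_on_const smooth_on_prod assms)

lemma matrix_inv_mult:
  fixes A :: "real^'n^'n"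
  assumes "invertible A"
  shows "A ** matrix_inv A = mat 1" "matrix_inv A ** A = mat 1"
  using someI_ex[of "\<lambda>A'. A ** A' = mat 1 \<and> A' ** A = mat 1"] assms
  unfolding invertible_def matrix_inv_def by blast+

text \<open>Cramer's rule for each column: the inverse is rational in the entries, which makes the
  Christoffel symbols smooth.\<close>

lemma matrix_inv_nth:
  fixes A :: "real^'n^'n"
  assumes "invertible A"
  shows "matrix_inv A $ k $ l = det (\<chi> i j. if j = k then axis l 1 $ i else A $ i $ j) * inverse (det A)"
proof -
  have "A *v column l (matrix_inv A) = axis l 1"
    using matrix_inv_mult(1)[OF assms]
    by (metis matrix_vector_mul_assoc matrix_vector_mul_lid matrix_vector_mult_basis)
  then have "column l (matrix_inv A) = (\<chi> k. det (\<chi> i j. if j = k then axis l 1 $ i else A $ i $ j) / det A)"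
    using cramer[of A] assms invertible_det_nz by blast
  then have "column l (matrix_inv A) $ k = det (\<chi> i j. if j = k then axis l 1 $ i else A $ i $ j) / det A"
    by simp
  then show ?thesis by (simp add: column_def divide_inverse)
qed

lemma smooth_on_matrix_inv_nth:
  fixes G :: "'a::real_normed_vector \<Rightarrow> real^'n^'n"
  assumes S: "open S" and G: "smooth_on S G" and inv: "\<And>x. x \<in> S \<Longrightarrow> invertible (G x)"
  shows "smooth_on S (\<lambda>x. matrix_inv (G x) $ k $ l)"
proof -
  let ?M = "\<lambda>x. \<chi> i j. if j = k then axis l 1 $ i else G x $ i $ j"
  have Gij: "smooth_on S (\<lambda>x. G x $ i $ j)" for i j
    by (rule smooth_on_nth[OF S smooth_on_nth[OF S G]])
  have "smooth_on S (\<lambda>x. ?M x $ i $ j)" for i j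
    by (cases "j = k") (simp_all add: smooth_on_const Gij)
  moreover have "det (G x) \<noteq> 0" if "x \<in> S" for x
    using inv[OF that] invertible_det_nz by blast
  ultimately have "smooth_on S (\<lambda>x. det (?M x) * inverse (det (G x)))"
    by (intro smooth_on_mult[OF S smooth_on_det[OF S] smooth_on_inverse[OF S smooth_on_det[OF S]]] Gij)
  then show ?thesis
    by (rule smooth_on_cong[OF S, rotated]) (simp add: matrix_inv_nth[OF inv])
qed

section \<open>Levi-Civita connection and curvature in coordinates\<close>

text \<open>For the Christoffel symbols \<open>T\<close>, \<open>contract T v *v w\<close> is the
  connection term \<Gamma>(v, w). Splitting it into two bilinear operations lets the general product
  rule differentiate it.\<close>

definition contract :: "real^3^3^3 \<Rightarrow> R3 \<Rightarrow> real^3^3" where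
  "contract T v = (\<chi> k j. \<Sum>i\<in>UNIV. T $ k $ i $ j * v $ i)"

lemma bounded_bilinear_contract: "bounded_bilinear contract"
  unfolding bilinear_conv_bounded_bilinear[symmetric] bilinear_def
  by (auto intro!: linearI simp: contract_def vec_eq_iff sum.distrib distrib_left distrib_right
      sum_distrib_left mult_ac)

lemmas contract_simps =
  bounded_bilinear.add_left[OF bounded_bilinear_contract]
  bounded_bilinear.add_right[OF bounded_bilinear_contract]
  bounded_bilinear.diff_left[OF bounded_bilinear_contract]
  bounded_bilinear.diff_right[OF bounded_bilinear_contract]
  bounded_bilinear.zero_left[OF bounded_bilinear_contract]
  bounded_bilinear.zero_right[OF bounded_bilinear_contract]
  bounded_bilinear.scaleR_left[OF bounded_bilinear_contract]
  bounded_bilinear.scaleR_right[OF bounded_bilinear_contract]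

lemmas mv_simps =
  bounded_bilinear.add_left[OF bounded_bilinear_matrix_vector]
  bounded_bilinear.add_right[OF bounded_bilinear_matrix_vector]
  bounded_bilinear.diff_left[OF bounded_bilinear_matrix_vector]
  bounded_bilinear.diff_right[OF bounded_bilinear_matrix_vector]
  bounded_bilinear.minus_left[OF bounded_bilinear_matrix_vector]
  bounded_bilinear.minus_right[OF bounded_bilinear_matrix_vector]
  bounded_bilinear.zero_left[OF bounded_bilinear_matrix_vector]
  bounded_bilinear.zero_right[OF bounded_bilinear_matrix_vector]
  bounded_bilinear.scaleR_left[OF bounded_bilinear_matrix_vector]
  bounded_bilinear.scaleR_right[OF bounded_bilinear_matrix_vector]

lemma bil_simps:
  "bil G (u + v) w = bil G u w + bil G v w" "bil G w (u + v) = bil G w u + bil G w v"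
  "bil G (u - v) w = bil G u w - bil G v w" "bil G w (u - v) = bil G w u - bil G w v"
  "bil G (- v) w = - bil G v w" "bil G w (- v) = - bil G w v"
  "bil G 0 w = 0" "bil G w 0 = 0"
  "bil G (a *\<^sub>R v) w = a * bil G v w" "bil G w (a *\<^sub>R v) = a * bil G w v"
  by (simp_all add: bil_def mv_simps inner_simps)

lemma bil_expand: "bil M v w = (\<Sum>j\<in>UNIV. \<Sum>l\<in>UNIV. v $ j * M $ j $ l * w $ l)"
  by (simp add: bil_def inner_vec_def matrix_vector_mult_def sum_distrib_left mult_ac)

lemma bil_sym:
  assumes "transpose M = M"
  shows "bil M v w = bil M w v"
  by (metis assms bil_def dot_lmul_matrix inner_commute transpose_matrix_vector)

locale metric_domain =
  fixes S :: "R3 set" and g :: "R3 \<Rightarrow> real^3^3"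
  assumes open_S: "open S" and g_smooth: "smooth_on S g"
    and g_sym: "x \<in> S \<Longrightarrow> transpose (g x) = g x" and g_inv: "x \<in> S \<Longrightarrow> invertible (g x)"
begin

definition chr :: "R3 \<Rightarrow> real^3^3^3" where
  "chr x = (\<chi> k i j. christoffel g x k i j)"

lemma cov_deriv_eq: "cov_deriv g X Y x = dderiv Y x (X x) + contract (chr x) (X x) *v Y x"
  by (simp add: cov_deriv_def contract_def chr_def vec_eq_iff matrix_vector_mult_def
      sum_distrib_right sum.swap[of "\<lambda>i j. _ i j * _"])
     (subst sum.swap, simp)

lemma chr_smooth: "smooth_on S chr"
proof (intro smooth_on_vec open_S)
  have gij: "smooth_on S (\<lambda>x. g x $ i $ j)" for i j
    by (rule smooth_on_nth[OF open_S smooth_on_nth[OF open_S g_smooth]])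
  show "smooth_on S (\<lambda>x. chr x $ k $ i $ j)" for k i j
    unfolding chr_def christoffel_def
    by (simp only: vec_lambda_beta, intro smooth_on_mult[OF open_S] smooth_on_const smooth_on_sum[OF open_S]
        smooth_on_add[OF open_S] smooth_on_diff[OF open_S] smooth_on_dderiv_const gij
        smooth_on_matrix_inv_nth[OF open_S g_smooth g_inv])
qed

lemma cov_deriv_smooth:
  assumes "smooth_on S X" "smooth_on S Y"
  shows "smooth_on S (cov_deriv g X Y)"
  unfolding cov_deriv_eq[abs_def]
  by (rule smooth_on_add[OF open_S smooth_on_dderiv[OF open_S assms(2,1)]
      smooth_on_matrix_vector[OF open_S smooth_on_bilinear[OF bounded_bilinear_contract open_S
      chr_smooth assms(1)] assms(2)]])

lemma bil_commute: "x \<in> S \<Longrightarrow> bil (g x) v w = bil (g x) w v"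
  by (rule bil_sym[OF g_sym])

lemma dderiv_g_sym:
  assumes "x \<in> S"
  shows "bil (dderiv g x u) v w = bil (dderiv g x u) w v"
proof -
  have "dderiv (\<lambda>y. bil (g y) v w) x = dderiv (\<lambda>y. bil (g y) w v) x"
    by (rule dderiv_cong[OF open_S assms smooth_on_bil[OF open_S g_smooth]])
       (auto simp: smooth_on_const bil_commute)
  then show ?thesis
    using dderiv_bil[OF open_S g_smooth smooth_on_const[of S v] smooth_on_const[of S w] assms, of u]
      dderiv_bil[OF open_S g_smooth smooth_on_const[of S w] smooth_on_const[of S v] assms, of u]
    by (simp add: bil_simps)
qed

text \<open>The Koszul formula for constant fields: lowering the upper index removes the inverse of
  \<open>g\<close>. Symmetry of the Christoffel symbols and compatibility with \<open>g\<close>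
  follow from it without indices.\<close>

lemma bil_chr:
  assumes x: "x \<in> S"
  shows "bil (g x) w (contract (chr x) u *v v) =
    (1/2) * (bil (dderiv g x u) v w + bil (dderiv g x v) u w - bil (dderiv g x w) u v)"
proof -
  define d where "d i j l = dderiv g x (axis i 1) $ j $ l" for i j l
  have D: "dderiv (\<lambda>y. g y $ j $ l) x (axis i 1) = d i j l" for i j l
    unfolding d_def
    using dderiv_nth[OF smooth_on_nth[OF open_S g_smooth] x] dderiv_nth[OF g_smooth x] by metis
  have De: "dderiv g x u $ j $ l = (\<Sum>i\<in>UNIV. u $ i * d i j l)" for u j l
    unfolding d_def using dderiv_expand[OF g_smooth x, of u] by simp
  define h where "h = (\<chi> l. (1/2) * (\<Sum>i\<in>UNIV. \<Sum>j\<in>UNIV. (d i j l + d j i l - d l i j) * u $ i * v $ j))"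
  have "contract (chr x) u *v v = matrix_inv (g x) *v h"
    unfolding vec_eq_iff h_def
    by (simp add: contract_def chr_def christoffel_def D matrix_vector_mult_def sum_3 algebra_simps)
  then have "bil (g x) w (contract (chr x) u *v v) = w \<bullet> h"
    unfolding bil_def
    by (simp add: matrix_vector_mul_assoc matrix_inv_mult(1)[OF g_inv[OF x]])
  also have "\<dots> = (1/2) * (bil (dderiv g x u) v w + bil (dderiv g x v) u w - bil (dderiv g x w) u v)"
    unfolding bil_expand De h_def inner_vec_def
    by (simp add: sum_3 algebra_simps)
  finally show ?thesis .
qed

lemma nondegenerate:
  assumes "x \<in> S" "\<And>w. bil (g x) w a = bil (g x) w b"
  shows "a = b"
proof -
  have "g x *v a = g x *v b"
    by (rule vector_eq_rdot[THEN iffD1]) (use assms(2) bil_def inner_commute in metis)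
  then show ?thesis
    by (metis matrix_inv_mult(2)[OF g_inv[OF assms(1)]] matrix_vector_mul_assoc matrix_vector_mul_lid)
qed

lemma contract_chr_commute:
  assumes "x \<in> S"
  shows "contract (chr x) u *v v = contract (chr x) v *v u"
  by (rule nondegenerate[OF assms]) (simp add: bil_chr[OF assms] dderiv_g_sym[OF assms, of _ u v])

lemma torsion_free:
  assumes "x \<in> S"
  shows "cov_deriv g X Y x - cov_deriv g Y X x = lie_bracket X Y x"
  by (simp add: cov_deriv_eq lie_bracket_def contract_chr_commute[OF assms, of "X x"])

lemma metric_compatible:
  assumes "smooth_on S Y" "smooth_on S Z" "x \<in> S"
  shows "dderiv (\<lambda>y. bil (g y) (Y y) (Z y)) x (X x)
    = bil (g x) (cov_deriv g X Y x) (Z x) + bil (g x) (Y x) (cov_deriv g X Z x)"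
proof -
  \<comment> \<open>In the sum of the two Koszul expressions the derivatives of \<open>g\<close>
    along \<open>Y x\<close> and \<open>Z x\<close> cancel by symmetry.\<close>
  have "bil (g x) (contract (chr x) (X x) *v Y x) (Z x) + bil (g x) (Y x) (contract (chr x) (X x) *v Z x)
     = bil (dderiv g x (X x)) (Y x) (Z x)"
    using dderiv_g_sym[OF assms(3)]
    by (simp add: bil_commute[OF assms(3), of _ "Z x"] bil_chr[OF assms(3)] algebra_simps)
  then show ?thesis
    unfolding dderiv_bil[OF open_S g_smooth assms] cov_deriv_eq by (simp add: bil_simps)
qed

lemma cov_deriv_add_left: "x \<in> S \<Longrightarrow> smooth_on S Z \<Longrightarrow>
    cov_deriv g (\<lambda>y. X y + Y y) Z x = cov_deriv g X Z x + cov_deriv g Y Z x"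
  by (simp add: cov_deriv_eq linear_add[OF linear_dderiv] contract_simps mv_simps)

lemma cov_deriv_scaleR_left: "x \<in> S \<Longrightarrow> smooth_on S Z \<Longrightarrow>
    cov_deriv g (\<lambda>y. a y *\<^sub>R X y) Z x = a x *\<^sub>R cov_deriv g X Z x"
  by (simp add: cov_deriv_eq linear_scale[OF linear_dderiv] contract_simps mv_simps algebra_simps)

text \<open>The derivative is tensorial in its direction, so agreement at one point suffices; this
  allows expanding a direction with coefficients frozen at \<open>x\<close>.\<close>

lemma cov_deriv_cong_left: "X x = X' x \<Longrightarrow> cov_deriv g X Z x = cov_deriv g X' Z x"
  by (simp add: cov_deriv_eq)

lemma cov_deriv_cong_right:
  assumes "open W" "x \<in> W" "smooth_on W Z" "\<And>y. y \<in> W \<Longrightarrow> Z y = Z' y"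
  shows "cov_deriv g X Z x = cov_deriv g X Z' x"
  using dderiv_cong[OF assms] assms(2,4) by (simp add: cov_deriv_eq)

lemma cov_deriv_add: "smooth_on W Y \<Longrightarrow> smooth_on W Z \<Longrightarrow> x \<in> W \<Longrightarrow>
    cov_deriv g X (\<lambda>y. Y y + Z y) x = cov_deriv g X Y x + cov_deriv g X Z x"
  by (simp add: cov_deriv_eq dderiv_add mv_simps)

lemma cov_deriv_diff: "smooth_on W Y \<Longrightarrow> smooth_on W Z \<Longrightarrow> x \<in> W \<Longrightarrow>
    cov_deriv g X (\<lambda>y. Y y - Z y) x = cov_deriv g X Y x - cov_deriv g X Z x"
  by (simp add: cov_deriv_eq dderiv_diff mv_simps)

lemma cov_deriv_scaleR: "smooth_on W a \<Longrightarrow> smooth_on W Z \<Longrightarrow> x \<in> W \<Longrightarrow>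
    cov_deriv g X (\<lambda>y. a y *\<^sub>R Z y) x = dderiv a x (X x) *\<^sub>R Z x + a x *\<^sub>R cov_deriv g X Z x"
  by (simp add: cov_deriv_eq dderiv_scaleR mv_simps algebra_simps)

section \<open>The curvature tensor and its identities\<close>

lemma curvature_eq:
  assumes X: "smooth_on S X" and Y: "smooth_on S Y" and Z: "smooth_on S Z" and x: "x \<in> S"
  shows "curvature g X Y Z x =
     contract (dderiv chr x (X x)) (Y x) *v Z x - contract (dderiv chr x (Y x)) (X x) *v Z x
     + contract (chr x) (X x) *v (contract (chr x) (Y x) *v Z x)
     - contract (chr x) (Y x) *v (contract (chr x) (X x) *v Z x)"
proof -
  have D: "dderiv (cov_deriv g Y Z) x v = dderiv (\<lambda>y. dderiv Z y (Y x)) x v + dderiv Z x (dderiv Y x v)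
     + contract (dderiv chr x v) (Y x) *v Z x + contract (chr x) (dderiv Y x v) *v Z x
     + contract (chr x) (Y x) *v dderiv Z x v" if Y: "smooth_on S Y" for Y v
  proof -
    note c = smooth_on_bilinear[OF bounded_bilinear_contract open_S chr_smooth Y]
    show ?thesis unfolding cov_deriv_eq[abs_def]
      by (simp add: dderiv_add[OF smooth_on_dderiv[OF open_S Z Y] smooth_on_matrix_vector[OF open_S c Z] x]
          dderiv_field[OF open_S Z Y x] dderiv_matrix_vector[OF c Z x]
          dderiv_bilinear[OF bounded_bilinear_contract chr_smooth Y x] mv_simps)
  qed
  have L: "dderiv Z x (u - v) = dderiv Z x u - dderiv Z x v" for u v
    using linear_diff[OF linear_dderiv[OF Z x]] .
  \<comment> \<open>Second derivatives of \<open>Z\<close> cancel by symmetry, and derivatives of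
    \<open>X\<close> and \<open>Y\<close> against the bracket term; only values at \<open>x\<close>
    survive, which is tensoriality.\<close>
  show ?thesis
    unfolding curvature_def cov_deriv_eq[of _ "cov_deriv g _ _"] D[OF X] D[OF Y]
    unfolding cov_deriv_eq lie_bracket_def
    by (simp add: L dderiv_commute[OF open_S Z x, of "X x" "Y x"] mv_simps contract_simps)
qed

lemma curvature_eq_riem:
  assumes "smooth_on S X" "smooth_on S Y" "smooth_on S Z" "x \<in> S"
  shows "curvature g X Y Z x = riem g x (X x) (Y x) (Z x)"
  unfolding riem_def curvature_eq[OF assms]
    curvature_eq[OF smooth_on_const smooth_on_const smooth_on_const assms(4)] ..

lemma riem_eq: "x \<in> S \<Longrightarrow> riem g x u v w =
     contract (dderiv chr x u) v *v w - contract (dderiv chr x v) u *v w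
     + contract (chr x) u *v (contract (chr x) v *v w)
     - contract (chr x) v *v (contract (chr x) u *v w)"
  unfolding riem_def by (rule curvature_eq[OF smooth_on_const smooth_on_const smooth_on_const])

lemma riem_linear:
  assumes x: "x \<in> S"
  shows "linear (\<lambda>u. riem g x u v w)" "linear (\<lambda>v. riem g x u v w)" "linear (\<lambda>w. riem g x u v w)"
  unfolding riem_eq[OF x]
  using linear_dderiv[OF chr_smooth x]
  by (auto intro!: linearI simp: linear_add linear_scale mv_simps contract_simps algebra_simps)

lemma riem_antisym: "x \<in> S \<Longrightarrow> riem g x u v w = - riem g x v u w"
  by (simp add: riem_eq)

text \<open>Constant fields commute, so the bracket terms vanish, and symmetry of the connection
  exchanges the last two arguments in each nested derivative.\<close>

lemma riem_bianchi:
  assumes x: "x \<in> S"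
  shows "riem g x u v w + riem g x v w u + riem g x w u v = 0"
proof -
  have "cov_deriv g (\<lambda>_. a) (cov_deriv g (\<lambda>_. b) (\<lambda>_. c)) x
      = cov_deriv g (\<lambda>_. a) (cov_deriv g (\<lambda>_. c) (\<lambda>_. b)) x" for a b c
    by (rule cov_deriv_cong_right[OF open_S x cov_deriv_smooth[OF smooth_on_const smooth_on_const]])
       (simp add: cov_deriv_eq contract_chr_commute)
  note C = this
  have Z: "cov_deriv g (lie_bracket (\<lambda>_. a) (\<lambda>_. b)) (\<lambda>_. c) x = 0" for a b c
    by (simp add: cov_deriv_eq lie_bracket_def contract_simps mv_simps)
  show ?thesis unfolding riem_def curvature_def Z
    using C[of u v w] C[of v w u] C[of w u v] by simp
qed

text \<open>For constant \<open>w\<close> the second derivatives of \<open>g(w, w)\<close> commute,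
  and twice the expression is their antisymmetric part.\<close>

lemma riem_skew_diag:
  assumes x: "x \<in> S"
  shows "bil (g x) (riem g x u v w) w = 0"
proof -
  let ?f = "\<lambda>y. bil (g y) w w" and ?n = "\<lambda>u. cov_deriv g (\<lambda>_. u) (\<lambda>_. w)"
  have f: "smooth_on S ?f" by (intro smooth_on_bil open_S g_smooth smooth_on_const)
  have n: "smooth_on S (?n u)" for u by (intro cov_deriv_smooth smooth_on_const)
  have D1: "dderiv ?f y u = 2 * bil (g y) (?n u y) w" if "y \<in> S" for y u
    using metric_compatible[OF smooth_on_const[of S w] smooth_on_const[of S w] that, of "\<lambda>_. u"]
      bil_commute[OF that, of w] by simp
  have D2: "dderiv (\<lambda>y. dderiv ?f y u) x v
     = 2 * (bil (g x) (cov_deriv g (\<lambda>_. v) (?n u) x) w + bil (g x) (?n u x) (?n v x))" for u v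
  proof -
    have b: "smooth_on S (\<lambda>y. bil (g y) (?n u y) w)"
      by (intro smooth_on_bil open_S g_smooth smooth_on_const n)
    have "dderiv (\<lambda>y. dderiv ?f y u) x = dderiv (\<lambda>y. 2 * bil (g y) (?n u y) w) x"
      by (rule dderiv_cong[OF open_S x smooth_on_dderiv_const[OF f] D1])
    then show ?thesis
      using metric_compatible[OF n[of u] smooth_on_const[of S w] x, of "\<lambda>_. v"]
      by (simp add: dderiv_mult[OF smooth_on_const b x])
  qed
  have "bil (g x) (cov_deriv g (\<lambda>_. u) (?n v) x) w = bil (g x) (cov_deriv g (\<lambda>_. v) (?n u) x) w"
    using dderiv_commute_real[OF open_S f x, of u v] bil_commute[OF x, of "?n u x"]
    by (simp add: D2)
  moreover have "cov_deriv g (lie_bracket (\<lambda>_. u) (\<lambda>_. v)) (\<lambda>_. w) x = 0"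
    by (simp add: cov_deriv_eq lie_bracket_def contract_simps mv_simps)
  ultimately show ?thesis unfolding riem_def curvature_def by (simp add: bil_simps)
qed

lemma riem_skew:
  assumes x: "x \<in> S"
  shows "bil (g x) (riem g x u v w) z = - bil (g x) (riem g x u v z) w"
  using riem_skew_diag[OF x, of u v "w + z"]
  by (simp add: linear_add[OF riem_linear(3)[OF x]] bil_simps riem_skew_diag[OF x])

text \<open>Stated for operators on fields: it is the Jacobi identity for commutators of the maps
  \<open>cov_deriv g X\<close> together with that for the fields. Thus it can be evaluated on a
  frame without a derivative of the tensor \<open>riem\<close>.\<close>

lemma second_bianchi:
  assumes X: "smooth_on S X" and Y: "smooth_on S Y" and Z: "smooth_on S Z" and V: "smooth_on S V"
    and x: "x \<in> S"
  shows "cov_deriv g X (curvature g Y Z V) x + cov_deriv g Y (curvature g Z X V) x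
     + cov_deriv g Z (curvature g X Y V) x
    = curvature g Y Z (cov_deriv g X V) x + curvature g Z X (cov_deriv g Y V) x
     + curvature g X Y (cov_deriv g Z V) x
     + curvature g (lie_bracket X Y) Z V x + curvature g (lie_bracket Y Z) X V x
     + curvature g (lie_bracket Z X) Y V x"
proof -
  note s = cov_deriv_smooth smooth_on_lie_bracket[OF open_S]
  have C: "cov_deriv g X (curvature g Y Z V) x = cov_deriv g X (cov_deriv g Y (cov_deriv g Z V)) x
      - cov_deriv g X (cov_deriv g Z (cov_deriv g Y V)) x - cov_deriv g X (cov_deriv g (lie_bracket Y Z) V) x"
    if "smooth_on S X" "smooth_on S Y" "smooth_on S Z" for X Y Z
    unfolding curvature_def[abs_def]
    by (simp add: cov_deriv_diff[OF smooth_on_diff[OF open_S] _ x] cov_deriv_diff[OF _ _ x] s that V)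
  have "cov_deriv g (\<lambda>y. lie_bracket X (lie_bracket Y Z) y + lie_bracket Y (lie_bracket Z X) y
      + lie_bracket Z (lie_bracket X Y) y) V x = 0"
    unfolding cov_deriv_eq lie_bracket_jacobi[OF open_S X Y Z x]
    by (simp add: contract_simps mv_simps linear_0[OF linear_dderiv[OF V x]])
  then have J: "cov_deriv g (lie_bracket X (lie_bracket Y Z)) V x + cov_deriv g (lie_bracket Y (lie_bracket Z X)) V x
     + cov_deriv g (lie_bracket Z (lie_bracket X Y)) V x = 0"
    by (simp add: cov_deriv_add_left x V)
  have A: "cov_deriv g (lie_bracket (lie_bracket X Y) Z) V x = - cov_deriv g (lie_bracket Z (lie_bracket X Y)) V x"
    for X Y Z
  proof -
    have "lie_bracket (lie_bracket X Y) Z x = -1 *\<^sub>R lie_bracket Z (lie_bracket X Y) x"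
      by (simp add: lie_bracket_def[of _ Z] lie_bracket_def[of Z])
    then have "cov_deriv g (lie_bracket (lie_bracket X Y) Z) V x
      = cov_deriv g (\<lambda>y. -1 *\<^sub>R lie_bracket Z (lie_bracket X Y) y) V x"
      by (rule cov_deriv_cong_left)
    then show ?thesis by (simp only: cov_deriv_scaleR_left[OF x V, of "\<lambda>_. -1"]) simp
  qed
  show ?thesis
    unfolding C[OF X Y Z] C[OF Y Z X] C[OF Z X Y]
    unfolding curvature_def A using J by (simp add: algebra_simps)
qed

text \<open>Compatibility and vanishing torsion cancel the derivatives along \<open>Z\<close> and
  leave the symmetrised derivative of \<open>Z\<close>.\<close>

lemma lie_deriv_metric_eq:
  assumes "smooth_on S X" "smooth_on S Y" "x \<in> S"
  shows "lie_deriv_metric Z g X Y x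
     = bil (g x) (cov_deriv g X Z x) (Y x) + bil (g x) (X x) (cov_deriv g Y Z x)"
  unfolding lie_deriv_metric_def metric_compatible[OF assms] torsion_free[OF assms(3), symmetric]
  by (simp add: bil_simps)

lemma nabla_mult:
  assumes "smooth_on S Z" "x \<in> S"
  shows "nabla g Z x *v v = cov_deriv g (\<lambda>_. v) Z x"
proof -
  have L: "linear (\<lambda>v. cov_deriv g (\<lambda>_. v) Z x)"
    unfolding cov_deriv_eq using linear_dderiv[OF assms]
    by (auto intro!: linearI simp: linear_add linear_scale contract_simps mv_simps algebra_simps)
  have "nabla g Z x = matrix (\<lambda>v. cov_deriv g (\<lambda>_. v) Z x)"
    by (simp add: nabla_def matrix_def)
  then show ?thesis using matrix_vector_mul(2)[OF L] by metis
qed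

end

section \<open>Normal structures in an adapted frame\<close>

text \<open>The structure on an arbitrary open set of coordinates, so that it can be restricted to
  where a frame exists. Normality is stated on \<xi> and a constant field, the case that yields
  invariance of \<phi> and \<eta> along \<xi>.\<close>

locale paracontact_domain = metric_domain +
  fixes \<phi> :: "R3 \<Rightarrow> real^3^3" and \<xi> \<eta> :: "R3 \<Rightarrow> R3"
  assumes phi_smooth: "smooth_on S \<phi>" and xi_smooth: "smooth_on S \<xi>" and eta_smooth: "smooth_on S \<eta>"
    and phi_xi: "x \<in> S \<Longrightarrow> \<phi> x *v \<xi> x = 0"
    and eta_phi: "x \<in> S \<Longrightarrow> \<eta> x \<bullet> (\<phi> x *v v) = 0"
    and eta_xi: "x \<in> S \<Longrightarrow> \<eta> x \<bullet> \<xi> x = 1"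
    and phi_phi: "x \<in> S \<Longrightarrow> \<phi> x *v (\<phi> x *v v) = v - (\<eta> x \<bullet> v) *\<^sub>R \<xi> x"
    and compatible: "x \<in> S \<Longrightarrow>
      bil (g x) (\<phi> x *v v) (\<phi> x *v w) = - bil (g x) v w + (\<eta> x \<bullet> v) * (\<eta> x \<bullet> w)"
    and normal: "x \<in> S \<Longrightarrow>
      nijenhuis \<phi> \<xi> (\<lambda>_. v) x = (2 * ext_deriv \<eta> \<xi> (\<lambda>_. v) x) *\<^sub>R \<xi> x"
begin

lemma eta_eq: "x \<in> S \<Longrightarrow> \<eta> x \<bullet> v = bil (g x) v (\<xi> x)"
  using compatible[of x v "\<xi> x"] by (simp add: phi_xi eta_xi bil_simps)

lemma bil_xi_xi: "x \<in> S \<Longrightarrow> bil (g x) (\<xi> x) (\<xi> x) = 1"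
  using eta_eq[of x "\<xi> x"] by (simp add: eta_xi)

lemma bil_phi_xi: "x \<in> S \<Longrightarrow> bil (g x) (\<phi> x *v v) (\<xi> x) = 0"
  using eta_eq[of x "\<phi> x *v v"] by (simp add: eta_phi)

lemma phi_skew:
  assumes "x \<in> S"
  shows "bil (g x) (\<phi> x *v v) w = - bil (g x) v (\<phi> x *v w)"
  using compatible[OF assms, of v "\<phi> x *v w"] bil_phi_xi[OF assms, of v]
  by (simp add: phi_phi assms eta_phi bil_simps)

text \<open>As \<open>\<phi> \<xi> = 0\<close>, two Nijenhuis terms drop out and a vector in the
  image of \<phi> equals \<open>2 d\<eta>(\<xi>, v) \<xi>\<close>. Applying \<eta> shows that both
  vanish: the first gives the invariance of \<eta>, and the second leaves a defect \<open>?z\<close>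
  annihilated by \<phi> and \<eta>, hence zero.\<close>

lemma dderiv_eta_xi:
  assumes x: "x \<in> S"
  shows "dderiv \<eta> x (\<xi> x) \<bullet> v + \<eta> x \<bullet> dderiv \<xi> x v = 0"
    and bracket_xi_phi_const: "lie_bracket \<xi> (\<lambda>y. \<phi> y *v v) x = \<phi> x *v lie_bracket \<xi> (\<lambda>_. v) x"
proof -
  have phixi: "dderiv (\<lambda>y. \<phi> y *v \<xi> y) x = (\<lambda>_. 0)"
    using dderiv_cong[OF open_S x smooth_on_matrix_vector[OF open_S phi_smooth xi_smooth], of "\<lambda>_. 0"]
    by (simp add: phi_xi fun_eq_iff)
  have phiv: "smooth_on S (\<lambda>y. \<phi> y *v v)" for v
    by (rule smooth_on_matrix_vector[OF open_S phi_smooth smooth_on_const])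
  have Z: "lie_bracket (\<lambda>y. \<phi> y *v \<xi> y) Y x = 0" if "smooth_on S Y" for Y
    by (simp add: lie_bracket_def phixi phi_xi x linear_0[OF linear_dderiv[OF that x]])
  have N: "\<phi> x *v (\<phi> x *v lie_bracket \<xi> (\<lambda>_. v) x) - \<phi> x *v lie_bracket \<xi> (\<lambda>y. \<phi> y *v v) x
     = (2 * ext_deriv \<eta> \<xi> (\<lambda>_. v) x) *\<^sub>R \<xi> x" for v
    using normal[OF x, of v] unfolding nijenhuis_def
    by (simp add: Z[OF smooth_on_const] Z[OF phiv])
  have ext0: "ext_deriv \<eta> \<xi> (\<lambda>_. v) x = 0" for v
    using arg_cong[OF N[of v], of "\<lambda>u. \<eta> x \<bullet> u"] by (simp add: inner_diff_right eta_phi eta_xi x)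
  have etaxi: "dderiv (\<lambda>y. \<eta> y \<bullet> \<xi> y) x = (\<lambda>_. 0)"
    using dderiv_cong[OF open_S x smooth_on_inner[OF open_S eta_smooth xi_smooth], of "\<lambda>_. 1"]
    by (simp add: eta_xi fun_eq_iff)
  show E: "dderiv \<eta> x (\<xi> x) \<bullet> v + \<eta> x \<bullet> dderiv \<xi> x v = 0" for v
    using ext0[of v] unfolding ext_deriv_def etaxi
    by (simp add: dderiv_inner[OF eta_smooth smooth_on_const x] lie_bracket_def inner_simps)
  let ?z = "lie_bracket \<xi> (\<lambda>y. \<phi> y *v v) x - \<phi> x *v lie_bracket \<xi> (\<lambda>_. v) x"
  have "dderiv (\<lambda>y. \<eta> y \<bullet> (\<phi> y *v v)) x = dderiv (\<lambda>y. 0) x"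
    by (rule dderiv_cong[OF open_S x smooth_on_inner[OF open_S eta_smooth phiv] eta_phi])
  then have "\<eta> x \<bullet> dderiv (\<lambda>y. \<phi> y *v v) x (\<xi> x) = - (dderiv \<eta> x (\<xi> x) \<bullet> (\<phi> x *v v))"
    by (simp add: dderiv_inner[OF eta_smooth phiv x] fun_eq_iff)
       (metis add.commute add.inverse_unique)
  then have "\<eta> x \<bullet> ?z = 0"
    using E[of "\<phi> x *v v"] by (simp add: inner_diff_right eta_phi x lie_bracket_def)
  moreover have "\<phi> x *v ?z = 0" using N[of v] ext0[of v] by (simp add: mv_simps)
  ultimately show "lie_bracket \<xi> (\<lambda>y. \<phi> y *v v) x = \<phi> x *v lie_bracket \<xi> (\<lambda>_. v) x"
    using phi_phi[OF x, of ?z] by (simp add: mv_simps)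
qed

text \<open>The Lie derivative of \<phi> is tensorial: the derivatives of \<open>Y\<close>
  contribute equally to both sides.\<close>

lemma bracket_xi_phi:
  assumes x: "x \<in> S" and Y: "smooth_on S Y"
  shows "lie_bracket \<xi> (\<lambda>y. \<phi> y *v Y y) x = \<phi> x *v lie_bracket \<xi> Y x"
  using bracket_xi_phi_const[OF x, of "Y x"]
  by (simp add: lie_bracket_def dderiv_matrix_vector[OF phi_smooth Y x]
      dderiv_matrix_vector[OF phi_smooth smooth_on_const x] mv_simps algebra_simps)

lemma eta_bracket_xi:
  assumes x: "x \<in> S" and Y: "smooth_on S Y"
  shows "\<eta> x \<bullet> lie_bracket \<xi> Y x = dderiv (\<lambda>y. \<eta> y \<bullet> Y y) x (\<xi> x)"
  using dderiv_eta_xi[OF x, of "Y x"]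
  by (simp add: lie_bracket_def dderiv_inner[OF eta_smooth Y x] inner_diff_right)

end

locale paracontact_frame = paracontact_domain +
  fixes e :: "R3 \<Rightarrow> R3"
  assumes e_smooth: "smooth_on S e"
    and bil_e_e: "x \<in> S \<Longrightarrow> bil (g x) (e x) (e x) = 1"
    and bil_e_xi: "x \<in> S \<Longrightarrow> bil (g x) (e x) (\<xi> x) = 0"
begin

section \<open>Linear algebra of the orthonormal frame\<close>

definition f :: "R3 \<Rightarrow> R3" where "f y = \<phi> y *v e y"

lemma f_smooth: "smooth_on S f"
  unfolding f_def[abs_def] by (rule smooth_on_matrix_vector[OF open_S phi_smooth e_smooth])

lemma eta_e: "x \<in> S \<Longrightarrow> \<eta> x \<bullet> e x = 0"
  by (simp add: eta_eq bil_e_xi)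

lemma phi_f: "x \<in> S \<Longrightarrow> \<phi> x *v f x = e x"
  by (simp add: f_def phi_phi eta_e)

lemma orthonormal:
  assumes x: "x \<in> S"
  shows "bil (g x) (\<xi> x) (\<xi> x) = 1" "bil (g x) (e x) (e x) = 1" "bil (g x) (f x) (f x) = -1"
    "bil (g x) (e x) (\<xi> x) = 0" "bil (g x) (\<xi> x) (e x) = 0"
    "bil (g x) (f x) (\<xi> x) = 0" "bil (g x) (\<xi> x) (f x) = 0"
    "bil (g x) (e x) (f x) = 0" "bil (g x) (f x) (e x) = 0"
proof -
  show "bil (g x) (\<xi> x) (\<xi> x) = 1" "bil (g x) (e x) (e x) = 1" "bil (g x) (e x) (\<xi> x) = 0"
    using x by (simp_all add: bil_xi_xi bil_e_e bil_e_xi)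
  then show "bil (g x) (\<xi> x) (e x) = 0" using bil_commute[OF x] by metis
  show fxi: "bil (g x) (f x) (\<xi> x) = 0" by (simp add: f_def bil_phi_xi x)
  then show "bil (g x) (\<xi> x) (f x) = 0" using bil_commute[OF x] by metis
  show "bil (g x) (f x) (f x) = -1" by (simp add: f_def compatible x bil_e_e eta_e)
  have "bil (g x) (f x) (e x) = - bil (g x) (e x) (f x)"
    unfolding f_def by (rule phi_skew[OF x])
  then show "bil (g x) (f x) (e x) = 0" "bil (g x) (e x) (f x) = 0"
    using bil_commute[OF x, of "f x" "e x"] by simp_all
qed

text \<open>The columns of \<open>P\<close> are the frame and the rows of \<open>Q\<close> its dual
  forms, with a minus sign for the time-like \<open>f\<close>. Orthonormality gives
  \<open>Q ** P = mat 1\<close>, and a one-sided inverse of a square matrix is two-sided.\<close>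

lemma frame_expand:
  assumes x: "x \<in> S"
  shows "v = bil (g x) v (\<xi> x) *\<^sub>R \<xi> x + bil (g x) v (e x) *\<^sub>R e x - bil (g x) v (f x) *\<^sub>R f x"
proof -
  define P :: "real^3^3" where
    "P = (\<chi> i j. if j = 1 then \<xi> x $ i else if j = 2 then e x $ i else f x $ i)"
  define Q :: "real^3^3" where
    "Q = (\<chi> j i. if j = 1 then (g x *v \<xi> x) $ i else if j = 2 then (g x *v e x) $ i else - (g x *v f x) $ i)"
  have ip: "(\<Sum>k\<in>UNIV. (g x *v a) $ k * b $ k) = bil (g x) b a" for a b
    by (simp add: bil_def inner_vec_def mult.commute)
  have "Q ** P = mat 1"
    unfolding vec_eq_iff
  proof (intro allI)
    fix i j :: 3
    show "(Q ** P) $ i $ j = (mat 1 :: real^3^3) $ i $ j"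
      using exhaust_3[of i] exhaust_3[of j]
      by (auto simp: P_def Q_def matrix_matrix_mult_def mat_def ip sum_negf orthonormal[OF x])
  qed
  then have "P ** Q = mat 1" using matrix_left_right_inverse by blast
  then have "v = P *v (Q *v v)" by (simp add: matrix_vector_mul_assoc)
  also have "\<dots> = ((g x *v \<xi> x) \<bullet> v) *\<^sub>R \<xi> x + ((g x *v e x) \<bullet> v) *\<^sub>R e x - ((g x *v f x) \<bullet> v) *\<^sub>R f x"
    by (simp add: vec_eq_iff P_def Q_def matrix_vector_mult_def sum_3 inner_vec_def algebra_simps)
  finally show ?thesis by (simp add: bil_def inner_commute)
qed

lemma frame_eqI:
  assumes "x \<in> S" "bil (g x) a (\<xi> x) = bil (g x) b (\<xi> x)" "bil (g x) a (e x) = bil (g x) b (e x)"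
    "bil (g x) a (f x) = bil (g x) b (f x)"
  shows "a = b"
  using frame_expand[OF assms(1), of a] frame_expand[OF assms(1), of b] assms(2-4) by simp

lemma trace_frame:
  assumes x: "x \<in> S" and L: "linear L"
  shows "(\<Sum>i\<in>UNIV. L (axis i 1) $ i)
    = bil (g x) (L (\<xi> x)) (\<xi> x) + bil (g x) (L (e x)) (e x) - bil (g x) (L (f x)) (f x)"
proof -
  have "L (axis i 1) = (g x *v \<xi> x) $ i *\<^sub>R L (\<xi> x) + (g x *v e x) $ i *\<^sub>R L (e x)
      - (g x *v f x) $ i *\<^sub>R L (f x)" for i
  proof -
    have "bil (g x) (axis i 1) w = (g x *v w) $ i" for w
      by (simp add: bil_def inner_axis' inner_commute)
    then show ?thesis
      by (subst frame_expand[OF x, of "axis i 1"])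
         (simp add: linear_add[OF L] linear_diff[OF L] linear_scale[OF L])
  qed
  then show ?thesis
    by (simp add: bil_def inner_vec_def sum.distrib sum_subtractf mult.commute)
qed

text \<open>Connection coefficients; an \<open>f\<close>-component is minus the product with
  \<open>f\<close>, because \<open>f\<close> is time-like. The functions \<open>p\<close>,
  \<open>q\<close>, \<open>s\<close> are the \<open>a_3\<close>, \<open>a_4\<close>,
  \<open>a_5\<close> of the bracket relations of a normal structure.\<close>

definition \<beta>1 :: "R3 \<Rightarrow> real" where "\<beta>1 y = bil (g y) (cov_deriv g e \<xi> y) (e y)"
definition \<beta>2 :: "R3 \<Rightarrow> real" where "\<beta>2 y = - bil (g y) (cov_deriv g e \<xi> y) (f y)"
definition p :: "R3 \<Rightarrow> real" where "p y = - bil (g y) (cov_deriv g \<xi> e y) (f y)"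
definition q :: "R3 \<Rightarrow> real" where "q y = - bil (g y) (cov_deriv g e e y) (f y)"
definition s :: "R3 \<Rightarrow> real" where "s y = - bil (g y) (cov_deriv g f e y) (f y)"

lemma coefficients_smooth: "smooth_on S \<beta>1" "smooth_on S \<beta>2" "smooth_on S p" "smooth_on S q" "smooth_on S s"
  unfolding \<beta>1_def[abs_def] \<beta>2_def[abs_def] p_def[abs_def] q_def[abs_def] s_def[abs_def]
  by (intro smooth_on_minus[OF open_S] smooth_on_bil[OF open_S g_smooth] cov_deriv_smooth
      xi_smooth e_smooth f_smooth)+

text \<open>Constancy of the products leaves nine coefficients, three for each direction. Invariance
  of \<eta> and \<phi> along \<xi> removes four: it makes \<xi> geodesic and determines the
  derivative of \<xi> along \<open>f\<close> from that along \<open>e\<close>.\<close>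

lemma connection:
  assumes x: "x \<in> S"
  shows "cov_deriv g \<xi> \<xi> x = 0"
    and "cov_deriv g e \<xi> x = \<beta>1 x *\<^sub>R e x + \<beta>2 x *\<^sub>R f x"
    and "cov_deriv g f \<xi> x = \<beta>2 x *\<^sub>R e x + \<beta>1 x *\<^sub>R f x"
    and "cov_deriv g \<xi> e x = p x *\<^sub>R f x"
    and "cov_deriv g \<xi> f x = p x *\<^sub>R e x"
    and "cov_deriv g e e x = q x *\<^sub>R f x - \<beta>1 x *\<^sub>R \<xi> x"
    and "cov_deriv g e f x = \<beta>2 x *\<^sub>R \<xi> x + q x *\<^sub>R e x"
    and "cov_deriv g f e x = s x *\<^sub>R f x - \<beta>2 x *\<^sub>R \<xi> x"
    and "cov_deriv g f f x = \<beta>1 x *\<^sub>R \<xi> x + s x *\<^sub>R e x"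
proof -
  note o = orthonormal[OF x] and sm = xi_smooth e_smooth f_smooth
  have M: "bil (g x) (cov_deriv g X Y x) (Z x) = - bil (g x) (cov_deriv g X Z x) (Y x)"
    if "smooth_on S Y" "smooth_on S Z" "\<And>y. y \<in> S \<Longrightarrow> bil (g y) (Y y) (Z y) = c" for X Y Z c
  proof -
    have "dderiv (\<lambda>y. bil (g y) (Y y) (Z y)) x = dderiv (\<lambda>y. c) x"
      by (rule dderiv_cong[OF open_S x smooth_on_bil[OF open_S g_smooth that(1,2)] that(3)])
    then have "dderiv (\<lambda>y. bil (g y) (Y y) (Z y)) x (X x) = 0" by simp
    then show ?thesis
      using metric_compatible[OF that(1,2) x, of X] bil_commute[OF x, of "Y x"] by simp
  qed
  note m = M[OF sm(1) sm(1) orthonormal(1)] M[OF sm(2) sm(2) orthonormal(2)] M[OF sm(3) sm(3) orthonormal(3)]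
  have m0: "bil (g x) (cov_deriv g X \<xi> x) (\<xi> x) = 0" "bil (g x) (cov_deriv g X e x) (e x) = 0"
    "bil (g x) (cov_deriv g X f x) (f x) = 0" for X
    using m[of X] by simp_all
  have mx: "bil (g x) (cov_deriv g X e x) (\<xi> x) = - bil (g x) (cov_deriv g X \<xi> x) (e x)"
    "bil (g x) (cov_deriv g X f x) (\<xi> x) = - bil (g x) (cov_deriv g X \<xi> x) (f x)"
    "bil (g x) (cov_deriv g X f x) (e x) = - bil (g x) (cov_deriv g X e x) (f x)" for X
    by (rule M[OF sm(2) sm(1) orthonormal(4)], assumption)
       (rule M[OF sm(3) sm(1) orthonormal(6)], assumption, rule M[OF sm(3) sm(2) orthonormal(9)])
  let ?B = "lie_bracket \<xi> e x"
  have eta0: "bil (g x) ?B (\<xi> x) = 0"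
  proof -
    have "dderiv (\<lambda>y. \<eta> y \<bullet> e y) x = dderiv (\<lambda>y. 0) x"
      by (rule dderiv_cong[OF open_S x smooth_on_inner[OF open_S eta_smooth e_smooth] eta_e])
    then show ?thesis using eta_bracket_xi[OF x e_smooth] eta_eq[OF x] by simp
  qed
  have Bf: "lie_bracket \<xi> f x = \<phi> x *v ?B"
    unfolding f_def[abs_def] by (rule bracket_xi_phi[OF x e_smooth])
  have B: "?B = cov_deriv g \<xi> e x - cov_deriv g e \<xi> x" "lie_bracket \<xi> f x = cov_deriv g \<xi> f x - cov_deriv g f \<xi> x"
    using torsion_free[OF x] by metis+
  have xi0: "bil (g x) (cov_deriv g \<xi> \<xi> x) (e x) = 0"
    using eta0 unfolding B by (simp add: bil_simps m0 mx)
  have "bil (g x) (\<phi> x *v ?B) (\<xi> x) = 0" by (rule bil_phi_xi[OF x])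
  then have xi1: "bil (g x) (cov_deriv g \<xi> \<xi> x) (f x) = 0"
    unfolding Bf[symmetric] unfolding B by (simp add: bil_simps m0 mx)
  \<comment> \<open>A component of \<open>[\<xi>, f] = \<phi> [\<xi>, e]\<close>, moved across by
    skewness of \<phi>; the coefficient \<open>p\<close> occurs on both sides and cancels.\<close>
  have "bil (g x) (\<phi> x *v ?B) (e x) = - bil (g x) ?B (f x)"
    unfolding f_def by (rule phi_skew[OF x])
  then have fe: "bil (g x) (cov_deriv g f \<xi> x) (e x) = \<beta>2 x"
    unfolding Bf[symmetric] unfolding B by (simp add: bil_simps m0 mx \<beta>2_def)
  have "bil (g x) (\<phi> x *v ?B) (f x) = - bil (g x) ?B (e x)"
    unfolding phi_skew[OF x] phi_f[OF x] ..
  then have ff: "bil (g x) (cov_deriv g f \<xi> x) (f x) = - \<beta>1 x"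
    unfolding Bf[symmetric] unfolding B by (simp add: bil_simps m0 mx \<beta>1_def)
  have be: "bil (g x) (cov_deriv g e \<xi> x) (e x) = \<beta>1 x" "bil (g x) (cov_deriv g e \<xi> x) (f x) = - \<beta>2 x"
    "bil (g x) (cov_deriv g \<xi> e x) (f x) = - p x" "bil (g x) (cov_deriv g e e x) (f x) = - q x"
    "bil (g x) (cov_deriv g f e x) (f x) = - s x"
    by (simp_all add: \<beta>1_def \<beta>2_def p_def q_def s_def)
  show "cov_deriv g \<xi> \<xi> x = 0" "cov_deriv g e \<xi> x = \<beta>1 x *\<^sub>R e x + \<beta>2 x *\<^sub>R f x"
    "cov_deriv g f \<xi> x = \<beta>2 x *\<^sub>R e x + \<beta>1 x *\<^sub>R f x" "cov_deriv g \<xi> e x = p x *\<^sub>R f x"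
    "cov_deriv g \<xi> f x = p x *\<^sub>R e x" "cov_deriv g e e x = q x *\<^sub>R f x - \<beta>1 x *\<^sub>R \<xi> x"
    "cov_deriv g e f x = \<beta>2 x *\<^sub>R \<xi> x + q x *\<^sub>R e x" "cov_deriv g f e x = s x *\<^sub>R f x - \<beta>2 x *\<^sub>R \<xi> x"
    "cov_deriv g f f x = \<beta>1 x *\<^sub>R \<xi> x + s x *\<^sub>R e x"
    by (rule frame_eqI[OF x]; simp add: bil_simps m0 mx xi0 xi1 be fe ff o)+
qed

lemma brackets:
  assumes x: "x \<in> S"
  shows "lie_bracket \<xi> e x = (- \<beta>1 x) *\<^sub>R e x + (p x - \<beta>2 x) *\<^sub>R f x"
    "lie_bracket \<xi> f x = (p x - \<beta>2 x) *\<^sub>R e x + (- \<beta>1 x) *\<^sub>R f x"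
    "lie_bracket f \<xi> x = (\<beta>2 x - p x) *\<^sub>R e x + \<beta>1 x *\<^sub>R f x"
    "lie_bracket e f x = (2 * \<beta>2 x) *\<^sub>R \<xi> x + q x *\<^sub>R e x - s x *\<^sub>R f x"
  using torsion_free[OF x, of \<xi> e] torsion_free[OF x, of \<xi> f] torsion_free[OF x, of f \<xi>] torsion_free[OF x, of e f]
  by (simp_all add: connection[OF x] algebra_simps flip: scaleR_2)

text \<open>On the span of e and f the derivative of \<xi> is
  \<open>\<beta>1 + \<beta>2 \<phi>\<close>, which commutes with \<phi>; therefore \<open>p\<close>,
  \<open>q\<close> and \<open>s\<close> cancel.\<close>

lemma riem_xi:
  assumes x: "x \<in> S"
  defines "\<kappa> \<equiv> dderiv \<beta>1 x (\<xi> x) + (\<beta>1 x)\<^sup>2 + (\<beta>2 x)\<^sup>2"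
    and "\<tau> \<equiv> dderiv \<beta>2 x (\<xi> x) + 2 * \<beta>1 x * \<beta>2 x"
  shows "riem g x (\<xi> x) (e x) (\<xi> x) = \<kappa> *\<^sub>R e x + \<tau> *\<^sub>R f x"
    "riem g x (\<xi> x) (f x) (\<xi> x) = \<tau> *\<^sub>R e x + \<kappa> *\<^sub>R f x"
    "riem g x (e x) (f x) (\<xi> x) = (dderiv \<beta>2 x (e x) - dderiv \<beta>1 x (f x)) *\<^sub>R e x
       + (dderiv \<beta>1 x (e x) - dderiv \<beta>2 x (f x)) *\<^sub>R f x"
proof -
  note sm = xi_smooth e_smooth f_smooth coefficients_smooth
  have L: "cov_deriv g X \<xi> x = b *\<^sub>R cov_deriv g e \<xi> x + c *\<^sub>R cov_deriv g f \<xi> x"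
    if "X x = a *\<^sub>R \<xi> x + b *\<^sub>R e x + c *\<^sub>R f x" for X a b c
  proof -
    have "cov_deriv g X \<xi> x = cov_deriv g (\<lambda>y. a *\<^sub>R \<xi> y + b *\<^sub>R e y + c *\<^sub>R f y) \<xi> x"
      by (rule cov_deriv_cong_left) (rule that)
    then show ?thesis
      by (simp add: cov_deriv_add_left cov_deriv_scaleR_left x xi_smooth connection(1)[OF x])
  qed
  have Ne: "cov_deriv g X (cov_deriv g e \<xi>) x = dderiv \<beta>1 x (X x) *\<^sub>R e x + \<beta>1 x *\<^sub>R cov_deriv g X e x
     + dderiv \<beta>2 x (X x) *\<^sub>R f x + \<beta>2 x *\<^sub>R cov_deriv g X f x" for X
  proof -
    have "cov_deriv g X (cov_deriv g e \<xi>) x = cov_deriv g X (\<lambda>y. \<beta>1 y *\<^sub>R e y + \<beta>2 y *\<^sub>R f y) x"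
      by (rule cov_deriv_cong_right[OF open_S x cov_deriv_smooth[OF sm(2,1)] connection(2)])
    then show ?thesis
      by (simp add: cov_deriv_add[OF smooth_on_scaleR[OF open_S] smooth_on_scaleR[OF open_S] x]
          cov_deriv_scaleR[OF _ _ x] sm)
  qed
  have Nf: "cov_deriv g X (cov_deriv g f \<xi>) x = dderiv \<beta>2 x (X x) *\<^sub>R e x + \<beta>2 x *\<^sub>R cov_deriv g X e x
     + dderiv \<beta>1 x (X x) *\<^sub>R f x + \<beta>1 x *\<^sub>R cov_deriv g X f x" for X
  proof -
    have "cov_deriv g X (cov_deriv g f \<xi>) x = cov_deriv g X (\<lambda>y. \<beta>2 y *\<^sub>R e y + \<beta>1 y *\<^sub>R f y) x"
      by (rule cov_deriv_cong_right[OF open_S x cov_deriv_smooth[OF sm(3,1)] connection(3)])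
    then show ?thesis
      by (simp add: cov_deriv_add[OF smooth_on_scaleR[OF open_S] smooth_on_scaleR[OF open_S] x]
          cov_deriv_scaleR[OF _ _ x] sm)
  qed
  have N0: "cov_deriv g X (cov_deriv g \<xi> \<xi>) x = 0" for X
  proof -
    have "cov_deriv g X (cov_deriv g \<xi> \<xi>) x = cov_deriv g X (\<lambda>y. 0) x"
      by (rule cov_deriv_cong_right[OF open_S x cov_deriv_smooth[OF sm(1,1)] connection(1)])
    then show ?thesis by (simp add: cov_deriv_eq mv_simps)
  qed
  have b1: "cov_deriv g (lie_bracket \<xi> e) \<xi> x = (- \<beta>1 x) *\<^sub>R cov_deriv g e \<xi> x + (p x - \<beta>2 x) *\<^sub>R cov_deriv g f \<xi> x"
    by (rule L[of _ 0]) (simp add: brackets[OF x])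
  have b2: "cov_deriv g (lie_bracket \<xi> f) \<xi> x = (p x - \<beta>2 x) *\<^sub>R cov_deriv g e \<xi> x + (- \<beta>1 x) *\<^sub>R cov_deriv g f \<xi> x"
    by (rule L[of _ 0]) (simp add: brackets[OF x])
  have b3: "cov_deriv g (lie_bracket e f) \<xi> x = q x *\<^sub>R cov_deriv g e \<xi> x + (- s x) *\<^sub>R cov_deriv g f \<xi> x"
    by (rule L[of _ "2 * \<beta>2 x"]) (simp add: brackets[OF x])
  note r = curvature_eq_riem[OF _ _ _ x, symmetric]
  show "riem g x (\<xi> x) (e x) (\<xi> x) = \<kappa> *\<^sub>R e x + \<tau> *\<^sub>R f x"
    "riem g x (\<xi> x) (f x) (\<xi> x) = \<tau> *\<^sub>R e x + \<kappa> *\<^sub>R f x"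
    "riem g x (e x) (f x) (\<xi> x) = (dderiv \<beta>2 x (e x) - dderiv \<beta>1 x (f x)) *\<^sub>R e x
       + (dderiv \<beta>1 x (e x) - dderiv \<beta>2 x (f x)) *\<^sub>R f x"
    unfolding r[OF sm(1,2,1)] r[OF sm(1,3,1)] r[OF sm(2,3,1)] curvature_def Ne Nf N0 b1 b2 b3
    unfolding connection[OF x] \<kappa>_def \<tau>_def
    by (rule frame_eqI[OF x]; simp add: bil_simps orthonormal[OF x] power2_eq_square; simp add: algebra_simps)+
qed

text \<open>Paired with \<xi>, the first Bianchi identity reads \<open>2 \<tau> = 0\<close> for the
  coefficient \<tau> of \<open>riem_xi\<close>.\<close>

lemma xi_beta2:
  assumes x: "x \<in> S"
  shows "dderiv \<beta>2 x (\<xi> x) = - 2 * \<beta>1 x * \<beta>2 x"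
proof -
  have "bil (g x) (riem g x (\<xi> x) (e x) (f x) + riem g x (e x) (f x) (\<xi> x) + riem g x (f x) (\<xi> x) (e x)) (\<xi> x) = 0"
    by (simp add: riem_bianchi[OF x] bil_simps)
  then show ?thesis
    unfolding riem_antisym[OF x, of "f x" "\<xi> x"]
    by (simp add: bil_simps riem_skew[OF x, of _ _ "f x" "\<xi> x"] riem_skew[OF x, of _ _ "e x" "\<xi> x"]
        riem_xi[OF x] orthonormal[OF x])
qed

section \<open>Traces in the frame\<close>

lemma ricci_frame:
  assumes x: "x \<in> S"
  shows "ricci g x v w = bil (g x) (riem g x (\<xi> x) v w) (\<xi> x) + bil (g x) (riem g x (e x) v w) (e x)
     - bil (g x) (riem g x (f x) v w) (f x)"
  unfolding ricci_def by (rule trace_frame[OF x riem_linear(1)[OF x]])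

text \<open>Identifies the frame coefficient with the globally defined \<open>b1\<close>; in the
  trace the \<open>f\<close>-term counts with a minus sign and so adds up with the
  \<open>e\<close>-term.\<close>

lemma b1_eq:
  assumes x: "x \<in> S"
  shows "(1/2) * divergence g \<xi> x = \<beta>1 x"
proof -
  have "divergence g \<xi> x = (\<Sum>i\<in>UNIV. (nabla g \<xi> x *v axis i 1) $ i)"
    by (simp add: divergence_def trace_def matrix_vector_mult_basis column_def)
  also have "\<dots> = 2 * \<beta>1 x"
    unfolding trace_frame[OF x matrix_vector_mul_linear]
    unfolding nabla_mult[OF xi_smooth x]
    using cov_deriv_cong_left[of "\<lambda>_. \<xi> x" x \<xi>] cov_deriv_cong_left[of "\<lambda>_. e x" x e] cov_deriv_cong_left[of "\<lambda>_. f x" x f]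
    by (simp add: connection[OF x] bil_simps orthonormal[OF x])
  finally show ?thesis by simp
qed

lemma b2_eq:
  assumes x: "x \<in> S"
  shows "(1/2) * trace (\<phi> x ** nabla g \<xi> x) = \<beta>2 x"
proof -
  have "trace (\<phi> x ** nabla g \<xi> x) = (\<Sum>i\<in>UNIV. ((\<phi> x ** nabla g \<xi> x) *v axis i 1) $ i)"
    by (simp add: trace_def matrix_vector_mult_basis column_def)
  also have "\<dots> = 2 * \<beta>2 x"
    unfolding trace_frame[OF x matrix_vector_mul_linear]
    unfolding matrix_vector_mul_assoc[symmetric] nabla_mult[OF xi_smooth x]
    using cov_deriv_cong_left[of "\<lambda>_. \<xi> x" x \<xi>] cov_deriv_cong_left[of "\<lambda>_. e x" x e] cov_deriv_cong_left[of "\<lambda>_. f x" x f]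
    by (simp add: connection[OF x] bil_simps mv_simps orthonormal[OF x] phi_f[OF x] f_def[symmetric])
  finally show ?thesis by simp
qed

end

section \<open>Ricci solitons\<close>

context metric_domain begin

lemmas riem_simps =
  linear_add[OF riem_linear(1)] linear_add[OF riem_linear(2)] linear_add[OF riem_linear(3)]
  linear_diff[OF riem_linear(1)] linear_diff[OF riem_linear(2)] linear_diff[OF riem_linear(3)]
  linear_scale[OF riem_linear(1)] linear_scale[OF riem_linear(2)] linear_scale[OF riem_linear(3)]
  linear_neg[OF riem_linear(1)] linear_neg[OF riem_linear(2)] linear_neg[OF riem_linear(3)]
  linear_0[OF riem_linear(1)] linear_0[OF riem_linear(2)] linear_0[OF riem_linear(3)]

lemma riem_self: "x \<in> S \<Longrightarrow> riem g x u u w = 0"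
  by (simp add: riem_eq)

text \<open>Contracting with the inverse metric, \<open>g\<close> yields the dimension 3, and
  \<open>t \<otimes> t\<close> yields \<open>t \<bullet> z\<close> since the inverse sends
  \<open>t\<close> to \<open>z\<close>.\<close>

lemma scalar_curvature_eq:
  assumes x: "x \<in> S" and R: "\<And>v w. ricci g x v w = a * bil (g x) v w + b * (t \<bullet> v) * (t \<bullet> w)"
    and t: "t = g x *v z"
  shows "scalar_curvature g x = 3 * a + b * (t \<bullet> z)"
proof -
  let ?H = "matrix_inv (g x)"
  have gs: "g x $ i $ j = g x $ j $ i" for i j
    using arg_cong[OF g_sym[OF x], of "\<lambda>M. M $ j $ i"] by (simp add: transpose_def)
  have "bil (g x) (axis i 1) (axis j 1) = g x $ j $ i" for i j
    by (simp add: bil_def inner_axis' matrix_vector_mult_basis column_def gs[of i])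
  then have R': "ricci g x (axis i 1) (axis j 1) = a * g x $ j $ i + b * (t $ i * t $ j)" for i j
    unfolding R by (simp add: inner_axis)
  have "scalar_curvature g x = a * (\<Sum>i\<in>UNIV. \<Sum>j\<in>UNIV. ?H $ i $ j * g x $ j $ i)
      + b * (\<Sum>i\<in>UNIV. \<Sum>j\<in>UNIV. t $ i * ?H $ i $ j * t $ j)"
    unfolding scalar_curvature_def R'
    by (simp add: distrib_left sum.distrib sum_distrib_left mult_ac)
  also have "(\<Sum>i\<in>UNIV. \<Sum>j\<in>UNIV. ?H $ i $ j * g x $ j $ i) = trace (?H ** g x)"
    by (simp add: trace_def matrix_matrix_mult_def)
  also have "\<dots> = 3" by (simp add: matrix_inv_mult(2)[OF g_inv[OF x]] trace_I)
  also have "(\<Sum>i\<in>UNIV. \<Sum>j\<in>UNIV. t $ i * ?H $ i $ j * t $ j) = t \<bullet> (?H *v t)"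
    using bil_expand[of ?H t t] by (simp add: bil_def)
  also have "?H *v t = z"
    by (simp add: t matrix_vector_mul_assoc matrix_inv_mult(2)[OF g_inv[OF x]])
  finally show ?thesis by simp
qed

end

text \<open>The soliton equation on constant fields, with the Lie derivative in the form of
  \<open>lie_deriv_metric_eq\<close>.\<close>

locale soliton_frame = paracontact_frame +
  fixes l :: real
  assumes soliton: "x \<in> S \<Longrightarrow>
    bil (g x) (cov_deriv g (\<lambda>_. v) \<xi> x) w + bil (g x) v (cov_deriv g (\<lambda>_. w) \<xi> x) + ricci g x v w
      = l * bil (g x) v w"
begin

text \<open>Only the symmetric part of the derivative of \<xi> contributes; the part
  \<open>\<beta>2 \<phi>\<close> is skew.\<close>

lemma lie_eq:
  assumes x: "x \<in> S"
  shows "bil (g x) (cov_deriv g (\<lambda>_. v) \<xi> x) w + bil (g x) v (cov_deriv g (\<lambda>_. w) \<xi> x)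
    = 2 * \<beta>1 x * (bil (g x) v w - (\<eta> x \<bullet> v) * (\<eta> x \<bullet> w))"
proof -
  have c: "cov_deriv g (\<lambda>_. v) \<xi> x = bil (g x) v (e x) *\<^sub>R (\<beta>1 x *\<^sub>R e x + \<beta>2 x *\<^sub>R f x)
      - bil (g x) v (f x) *\<^sub>R (\<beta>2 x *\<^sub>R e x + \<beta>1 x *\<^sub>R f x)" for v
  proof -
    have "cov_deriv g (\<lambda>_. v) \<xi> x = cov_deriv g (\<lambda>y. bil (g x) v (\<xi> x) *\<^sub>R \<xi> y + (bil (g x) v (e x) *\<^sub>R e y
        + (- bil (g x) v (f x)) *\<^sub>R f y)) \<xi> x"
      by (rule cov_deriv_cong_left) (use frame_expand[OF x, of v] in \<open>simp add: add_diff_eq\<close>)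
    then show ?thesis
      by (simp only: cov_deriv_add_left cov_deriv_scaleR_left x xi_smooth connection[OF x]) simp
  qed
  have bvw: "bil (g x) v w = bil (g x) v (\<xi> x) * bil (g x) w (\<xi> x) + bil (g x) v (e x) * bil (g x) w (e x)
      - bil (g x) v (f x) * bil (g x) w (f x)"
  proof -
    have "bil (g x) v w = bil (g x) v (bil (g x) w (\<xi> x) *\<^sub>R \<xi> x + bil (g x) w (e x) *\<^sub>R e x - bil (g x) w (f x) *\<^sub>R f x)"
      using frame_expand[OF x, of w] by simp
    then show ?thesis by (simp add: bil_simps mult.commute)
  qed
  show ?thesis
    unfolding c eta_eq[OF x] bvw
    by (simp add: bil_simps bil_commute[OF x, of "e x" w] bil_commute[OF x, of "f x" w] algebra_simps)
qed

lemma ricci_eq: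
  assumes x: "x \<in> S"
  shows "ricci g x v w = (l - 2 * \<beta>1 x) * bil (g x) v w + 2 * \<beta>1 x * (\<eta> x \<bullet> v) * (\<eta> x \<bullet> w)"
  using soliton[OF x, of v w] unfolding lie_eq[OF x] by (simp add: algebra_simps)

lemma ricci_consequences:
  assumes x: "x \<in> S"
  shows kappa: "dderiv \<beta>1 x (\<xi> x) + (\<beta>1 x)\<^sup>2 + (\<beta>2 x)\<^sup>2 = - l / 2"
    and e_beta1: "dderiv \<beta>1 x (e x) = dderiv \<beta>2 x (f x)"
    and f_beta1: "dderiv \<beta>1 x (f x) = dderiv \<beta>2 x (e x)"
    and riem_e_f_e: "riem g x (e x) (f x) (e x) = (2 * \<beta>1 x - l / 2) *\<^sub>R f x"
    and riem_e_f_f: "riem g x (e x) (f x) (f x) = (2 * \<beta>1 x - l / 2) *\<^sub>R e x"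
proof -
  note o = orthonormal[OF x] and R = ricci_frame[OF x]
  note an = riem_antisym[OF x, of "e x" "\<xi> x"] riem_antisym[OF x, of "f x" "\<xi> x"] riem_antisym[OF x, of "f x" "e x"]
  note E = eta_xi[OF x] eta_e[OF x]
  have Ef: "\<eta> x \<bullet> f x = 0" by (simp add: eta_eq[OF x] o)
  show k: "dderiv \<beta>1 x (\<xi> x) + (\<beta>1 x)\<^sup>2 + (\<beta>2 x)\<^sup>2 = - l / 2"
    using ricci_eq[OF x, of "\<xi> x" "\<xi> x"] unfolding R an
    by (simp add: riem_self[OF x] riem_xi[OF x] bil_simps o E)
  show e1: "dderiv \<beta>1 x (e x) = dderiv \<beta>2 x (f x)"
    using ricci_eq[OF x, of "e x" "\<xi> x"] unfolding R an
    by (simp add: riem_self[OF x] riem_xi[OF x] bil_simps o E)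
  show f1: "dderiv \<beta>1 x (f x) = dderiv \<beta>2 x (e x)"
    using ricci_eq[OF x, of "f x" "\<xi> x"] unfolding R an
    by (simp add: riem_self[OF x] riem_xi[OF x] bil_simps o E Ef)
  have rx: "riem g x (\<xi> x) (e x) (\<xi> x) = (- l / 2) *\<^sub>R e x" "riem g x (e x) (f x) (\<xi> x) = 0"
    using riem_xi[OF x] k xi_beta2[OF x] e1 f1 by simp_all
  note sk = riem_skew_diag[OF x] riem_skew[OF x, of _ _ "e x" "\<xi> x"] riem_skew[OF x, of _ _ "f x" "\<xi> x"]
    riem_skew[OF x, of _ _ "f x" "e x"]
  \<comment> \<open>Ric(e, e) equals \<open>l - 2 \<beta>1\<close>, of which the plane of \<xi> and
    e supplies \<open>l/2\<close>; the remainder is the curvature term of e and f.\<close>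
  have m: "bil (g x) (riem g x (e x) (f x) (e x)) (f x) = - (2 * \<beta>1 x - l / 2)"
    using ricci_eq[OF x, of "e x" "e x"] unfolding R an
    by (simp add: riem_self[OF x] sk bil_simps o E rx)
  show "riem g x (e x) (f x) (e x) = (2 * \<beta>1 x - l / 2) *\<^sub>R f x"
    by (rule frame_eqI[OF x]; simp add: bil_simps o m sk rx)
  show "riem g x (e x) (f x) (f x) = (2 * \<beta>1 x - l / 2) *\<^sub>R e x"
    by (rule frame_eqI[OF x]; simp add: bil_simps o m sk rx)
qed

lemma riem_table:
  assumes x: "x \<in> S"
  shows "riem g x (\<xi> x) (e x) (\<xi> x) = (- l / 2) *\<^sub>R e x"
    "riem g x (\<xi> x) (f x) (\<xi> x) = (- l / 2) *\<^sub>R f x"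
    "riem g x (e x) (f x) (\<xi> x) = 0"
    "riem g x (\<xi> x) (e x) (e x) = (l / 2) *\<^sub>R \<xi> x"
    "riem g x (\<xi> x) (e x) (f x) = 0"
    "riem g x (\<xi> x) (f x) (e x) = 0"
    "riem g x (\<xi> x) (f x) (f x) = (- l / 2) *\<^sub>R \<xi> x"
proof -
  note o = orthonormal[OF x]
  show r1: "riem g x (\<xi> x) (e x) (\<xi> x) = (- l / 2) *\<^sub>R e x"
    and r2: "riem g x (\<xi> x) (f x) (\<xi> x) = (- l / 2) *\<^sub>R f x"
    and r3: "riem g x (e x) (f x) (\<xi> x) = 0"
    using riem_xi[OF x] kappa[OF x] xi_beta2[OF x] e_beta1[OF x] f_beta1[OF x] by simp_all
  \<comment> \<open>Once R(e, f)\<xi> vanishes, the first Bianchi identity makes R(\<xi>, e)f and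
    R(\<xi>, f)e equal; skewness then kills their components along e and f.\<close>
  have b: "riem g x (\<xi> x) (f x) (e x) = riem g x (\<xi> x) (e x) (f x)"
    using riem_bianchi[OF x, of "\<xi> x" "e x" "f x"] r3 riem_antisym[OF x, of "f x" "\<xi> x" "e x"] by simp
  note sk = riem_skew_diag[OF x] riem_skew[OF x, of _ _ "e x" "\<xi> x"] riem_skew[OF x, of _ _ "f x" "\<xi> x"]
  have ef: "bil (g x) (riem g x (\<xi> x) (e x) (e x)) (f x) = 0"
    using riem_skew[OF x, of "\<xi> x" "e x" "e x" "f x"] b riem_skew_diag[OF x, of "\<xi> x" "f x" "e x"] by simp
  show r5: "riem g x (\<xi> x) (e x) (f x) = 0"
    by (rule frame_eqI[OF x];
        simp add: bil_simps o sk r1 riem_skew[OF x, of _ _ "f x" "e x"] ef)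
  then show r6: "riem g x (\<xi> x) (f x) (e x) = 0" using b by simp
  show "riem g x (\<xi> x) (e x) (e x) = (l / 2) *\<^sub>R \<xi> x"
    by (rule frame_eqI[OF x]; simp add: bil_simps o sk r1 ef)
  show "riem g x (\<xi> x) (f x) (f x) = (- l / 2) *\<^sub>R \<xi> x"
    by (rule frame_eqI[OF x];
        simp add: bil_simps o sk r2 riem_skew[OF x, of _ _ "f x" "e x"] r6)
qed

text \<open>The \<open>f\<close>-component of the second Bianchi identity for \<xi>, e, f acting on
  \<open>e\<close>: all curvature coefficients but \<open>?m\<close> are constant, so only its
  derivative along \<xi> appears.\<close>

lemma xi_beta1:
  assumes x: "x \<in> S"
  shows "dderiv \<beta>1 x (\<xi> x) = - 2 * (\<beta>1 x)\<^sup>2"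
proof -
  note sm = xi_smooth e_smooth f_smooth coefficients_smooth
  let ?m = "\<lambda>y. 2 * \<beta>1 y - l / 2"
  have curv_smooth: "smooth_on S (curvature g X Y Z)" if "smooth_on S X" "smooth_on S Y" "smooth_on S Z" for X Y Z
    unfolding curvature_def[abs_def]
    by (intro smooth_on_diff[OF open_S] cov_deriv_smooth smooth_on_lie_bracket[OF open_S] that)
  note cong = cov_deriv_cong_right[OF open_S x curv_smooth]
  have m: "smooth_on S ?m"
    by (intro smooth_on_diff[OF open_S] smooth_on_mult[OF open_S] smooth_on_const sm)
  have dm: "dderiv ?m x v = 2 * dderiv \<beta>1 x v" for v
    by (simp add: dderiv_diff[OF smooth_on_mult[OF open_S smooth_on_const sm(4)] smooth_on_const x]
        dderiv_mult[OF smooth_on_const sm(4) x])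
  have "cov_deriv g \<xi> (curvature g e f e) x = cov_deriv g \<xi> (\<lambda>y. ?m y *\<^sub>R f y) x"
    by (rule cong[OF sm(2,3,2)]) (simp add: curvature_eq_riem sm riem_e_f_e)
  then have 1: "cov_deriv g \<xi> (curvature g e f e) x = (2 * dderiv \<beta>1 x (\<xi> x)) *\<^sub>R f x + (?m x * p x) *\<^sub>R e x"
    by (simp add: cov_deriv_scaleR[OF m sm(3) x] connection[OF x] dm)
  have "cov_deriv g e (curvature g f \<xi> e) x = cov_deriv g e (\<lambda>y. 0) x"
    by (rule cong[OF sm(3,1,2)])
       (simp add: curvature_eq_riem sm riem_table riem_antisym[of _ "f _" "\<xi> _"])
  then have 2: "cov_deriv g e (curvature g f \<xi> e) x = 0" by (simp add: cov_deriv_eq mv_simps)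
  have "cov_deriv g f (curvature g \<xi> e e) x = cov_deriv g f (\<lambda>y. (l / 2) *\<^sub>R \<xi> y) x"
    by (rule cong[OF sm(1,2,2)]) (simp add: curvature_eq_riem sm riem_table)
  then have 3: "cov_deriv g f (curvature g \<xi> e e) x = (l / 2) *\<^sub>R (\<beta>2 x *\<^sub>R e x + \<beta>1 x *\<^sub>R f x)"
    by (simp only: cov_deriv_scaleR[OF smooth_on_const sm(1) x] connection[OF x]) simp
  note br = smooth_on_lie_bracket[OF open_S]
  note an = riem_antisym[OF x, of "f x" "\<xi> x"] riem_antisym[OF x, of "e x" "\<xi> x"] riem_antisym[OF x, of "f x" "e x"]
  \<comment> \<open>The simplifier collects \<open>f x + f x\<close> into the componentwise product \<open>2 * f x\<close>.\<close>
  have two: "2 * f x = 2 *\<^sub>R f x" by (simp only: mult_2 scaleR_2)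
  have "bil (g x) (cov_deriv g \<xi> (curvature g e f e) x + cov_deriv g e (curvature g f \<xi> e) x
      + cov_deriv g f (curvature g \<xi> e e) x) (f x)
    = bil (g x) (riem g x (e x) (f x) (cov_deriv g \<xi> e x) + riem g x (f x) (\<xi> x) (cov_deriv g e e x)
      + riem g x (\<xi> x) (e x) (cov_deriv g f e x) + riem g x (lie_bracket \<xi> e x) (f x) (e x)
      + riem g x (lie_bracket e f x) (\<xi> x) (e x) + riem g x (lie_bracket f \<xi> x) (e x) (e x)) (f x)"
    unfolding second_bianchi[OF sm(1-3) sm(2) x]
    by (simp add: curvature_eq_riem[OF _ _ _ x] sm br cov_deriv_smooth)
  also have "\<dots> = 2 * (\<beta>1 x * ?m x) + \<beta>1 x * l / 2"
    unfolding connection[OF x] brackets[OF x]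
    by (simp add: riem_simps[OF x] riem_self[OF x] an riem_table[OF x] riem_e_f_e[OF x] riem_e_f_f[OF x]
        bil_simps orthonormal[OF x] two)
  also have "bil (g x) (cov_deriv g \<xi> (curvature g e f e) x + cov_deriv g e (curvature g f \<xi> e) x
      + cov_deriv g f (curvature g \<xi> e e) x) (f x) = - 2 * dderiv \<beta>1 x (\<xi> x) - l / 2 * \<beta>1 x"
    unfolding 1 2 3 by (simp add: bil_simps orthonormal[OF x])
  \<comment> \<open>With D the derivative of \<open>\<beta>1\<close> along \<xi>: \<open>- 2 D - l/2
    \<beta>1 = 2 \<beta>1 (2 \<beta>1 - l/2) + l/2 \<beta>1\<close>, where the terms in
    \<open>l\<close> cancel.\<close>
  finally show ?thesis by (simp add: algebra_simps power2_eq_square)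
qed

lemma l_eq:
  assumes "x \<in> S"
  shows "l = 2 * ((\<beta>1 x)\<^sup>2 - (\<beta>2 x)\<^sup>2)"
  using kappa[OF assms] xi_beta1[OF assms] by simp

text \<open>The squares of \<open>\<beta>1\<close> and \<open>\<beta>2\<close> both have derivative
  \<open>-4 \<beta>1\<close> times themselves along \<xi>, and so does their difference, which is
  the constant \<open>l/2\<close>.\<close>

lemma beta1_l:
  assumes x: "x \<in> S"
  shows "\<beta>1 x * l = 0"
proof -
  note sm = coefficients_smooth
  have sq: "smooth_on S (\<lambda>y. \<beta>1 y * \<beta>1 y)" "smooth_on S (\<lambda>y. \<beta>2 y * \<beta>2 y)"
    by (intro smooth_on_mult[OF open_S] sm)+
  have "dderiv (\<lambda>y. \<beta>1 y * \<beta>1 y - \<beta>2 y * \<beta>2 y) x = dderiv (\<lambda>y. l / 2) x"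
    by (rule dderiv_cong[OF open_S x smooth_on_diff[OF open_S sq]])
       (use l_eq in \<open>simp add: power2_eq_square\<close>)
  then have "dderiv (\<lambda>y. \<beta>1 y * \<beta>1 y - \<beta>2 y * \<beta>2 y) x (\<xi> x) = 0" by simp
  then have "\<beta>1 x * ((\<beta>1 x)\<^sup>2 - (\<beta>2 x)\<^sup>2) = 0"
    unfolding dderiv_diff[OF sq x] dderiv_mult[OF sm(1,1) x] dderiv_mult[OF sm(2,2) x]
      xi_beta1[OF x] xi_beta2[OF x]
    by (auto simp: power2_eq_square algebra_simps)
  then show ?thesis by (subst l_eq[OF x]) simp
qed

lemma scalar_curvature_frame:
  assumes x: "x \<in> S"
  shows "scalar_curvature g x = 3 * l - 4 * \<beta>1 x"
proof -
  have "\<eta> x = g x *v \<xi> x"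
    by (rule vector_eq_rdot[THEN iffD1], rule allI, subst eta_eq[OF x])
       (simp add: bil_def inner_commute)
  from scalar_curvature_eq[OF x ricci_eq[OF x] this] show ?thesis
    by (simp add: eta_xi[OF x] algebra_simps)
qed

text \<open>\<open>T\<close> measures the deviation from constant curvature \<open>l/2\<close>; it
  is linear in each argument and vanishes on frame vectors because
  \<open>\<beta>1 = 0\<close>.\<close>

lemma riem_unsteady:
  assumes x: "x \<in> S" and l: "l \<noteq> 0"
  shows "riem g x u v w = (l / 2) *\<^sub>R (bil (g x) v w *\<^sub>R u - bil (g x) u w *\<^sub>R v)"
proof -
  have b0: "\<beta>1 x = 0" using beta1_l[OF x] l by simp
  note an = riem_antisym[OF x, of "f x" "\<xi> x"] riem_antisym[OF x, of "e x" "\<xi> x"] riem_antisym[OF x, of "f x" "e x"]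
  define T where "T u v w = riem g x u v w - (l / 2) *\<^sub>R (bil (g x) v w *\<^sub>R u - bil (g x) u w *\<^sub>R v)" for u v w
  have lin: "linear (\<lambda>u. T u v w)" "linear (\<lambda>v. T u v w)" "linear (\<lambda>w. T u v w)" for u v w
    unfolding T_def by (auto intro!: linearI simp: riem_simps[OF x] bil_simps algebra_simps
        add_divide_distrib scaleR_add_left)
  have exp: "L v = 0" if "linear L" "L (\<xi> x) = 0" "L (e x) = 0" "L (f x) = 0" for v and L :: "R3 \<Rightarrow> R3"
    by (subst frame_expand[OF x, of v]) (simp add: linear_add linear_diff linear_scale that)
  have T0: "T a b c = 0" if "a \<in> {\<xi> x, e x, f x}" "b \<in> {\<xi> x, e x, f x}" "c \<in> {\<xi> x, e x, f x}" for a b c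
    using that unfolding T_def
    by (auto simp: an riem_self[OF x] riem_table[OF x] riem_e_f_e[OF x] riem_e_f_f[OF x] b0 orthonormal[OF x])
  have "T a b w = 0" if "a \<in> {\<xi> x, e x, f x}" "b \<in> {\<xi> x, e x, f x}" for a b
    by (rule exp[OF lin(3)]) (use T0 that in auto)
  note T1 = this
  have "T a v w = 0" if "a \<in> {\<xi> x, e x, f x}" for a
    by (rule exp[OF lin(2)]) (use T1 that in auto)
  note T2 = this
  have "T u v w = 0" by (rule exp[OF lin(1)]) (use T2 in auto)
  then show ?thesis by (simp add: T_def)
qed

lemma sectional_unsteady:
  assumes x: "x \<in> S" and l: "l \<noteq> 0" and "plane_gram g x u v \<noteq> 0"
  shows "sectional_curvature g x u v = - (\<beta>2 x)\<^sup>2"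
proof -
  have "bil (g x) (riem g x u v v) u = (l / 2) * plane_gram g x u v"
    using bil_commute[OF x, of v u]
    by (simp add: riem_unsteady[OF x l] plane_gram_def bil_simps power2_eq_square algebra_simps)
  moreover have "l / 2 = - (\<beta>2 x)\<^sup>2" using l_eq[OF x] beta1_l[OF x] l by simp
  ultimately show ?thesis using assms(3) by (simp add: sectional_curvature_def)
qed

end

section \<open>Local choice of the sign\<close>

text \<open>A step of length \<open>1/N\<close> in time, so that \<open>N\<close> of them
  approximate the time-one flow of \<open>V\<close>.\<close>

definition euler_step :: "nat \<Rightarrow> (R3 \<Rightarrow> R3) \<Rightarrow> R3 \<Rightarrow> R3" where
  "euler_step N V x = x + (1 / real N) *\<^sub>R V x"

text \<open>The bound on \<open>V\<close> holds in the ball only, so staying inside is proved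
  together with the displacement bound \<open>k/N * M\<close>, at most \<open>R/2\<close>.\<close>

lemma euler_near:
  assumes V: "\<And>y. y \<in> cball p R \<Longrightarrow> norm (V y) \<le> M" and M: "M \<le> R / 2"
    and x0: "x0 \<in> cball p (R / 2)" and k: "k \<le> N" and R: "0 < R"
  shows "(euler_step N V ^^ k) x0 \<in> cball p R"
proof -
  have "dist x0 ((euler_step N V ^^ k) x0) \<le> k / N * M \<and> (euler_step N V ^^ k) x0 \<in> cball p R"
    using k
  proof (induction k)
    case 0
    then show ?case using x0 R by simp
  next
    case (Suc k)
    let ?x = "(euler_step N V ^^ k) x0"
    have IH: "dist x0 ?x \<le> k / N * M" "?x \<in> cball p R" using Suc by auto
    have N: "real N > 0" using Suc.prems by simp
    have "dist ?x (euler_step N V ?x) = norm (V ?x) / N"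
      by (simp add: euler_step_def dist_norm)
    also have "\<dots> \<le> M / N" using V[OF IH(2)] N by (simp add: divide_right_mono)
    finally have s: "dist x0 (euler_step N V ?x) \<le> k / N * M + M / N"
      using IH(1) dist_triangle[of x0 "euler_step N V ?x" ?x] by linarith
    have Mn: "0 \<le> M" using V[OF IH(2)] norm_ge_zero order_trans by blast
    have s': "dist x0 (euler_step N V ?x) \<le> real (Suc k) / N * M"
      using s N by (simp add: field_simps)
    moreover have "real (Suc k) / N * M \<le> 1 * M"
      using Suc.prems N Mn by (intro mult_right_mono) auto
    ultimately have "dist x0 (euler_step N V ?x) \<le> R / 2" using M by linarith
    then have "dist p (euler_step N V ?x) \<le> R"
      using x0 dist_triangle[of p "euler_step N V ?x" x0] by (simp add: field_simps)
    then show ?case using s' by simp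
  qed
  then show ?thesis by blast
qed

text \<open>The displacement is the mean of the \<open>N\<close> velocities met on the way, each
  within \<open>w\<close> of \<open>a\<close>.\<close>

lemma euler_endpoint:
  assumes near: "\<And>k. k \<le> N \<Longrightarrow> (euler_step N V ^^ k) x0 \<in> B"
    and V: "\<And>y. y \<in> B \<Longrightarrow> norm (V y - a) \<le> w" and N: "N > 0"
  shows "norm ((euler_step N V ^^ N) x0 - x0 - a) \<le> w"
proof -
  have "norm ((euler_step N V ^^ k) x0 - x0 - (k / N) *\<^sub>R a) \<le> k / N * w" if "k \<le> N" for k
    using that
  proof (induction k)
    case 0
    then show ?case by simp
  next
    case (Suc k)
    let ?x = "(euler_step N V ^^ k) x0"
    have "euler_step N V ?x - x0 - (Suc k / N) *\<^sub>R a
      = (?x - x0 - (k / N) *\<^sub>R a) + (1 / N) *\<^sub>R (V ?x - a)"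
      by (simp add: euler_step_def algebra_simps add_divide_distrib)
    then have "norm (euler_step N V ?x - x0 - (Suc k / N) *\<^sub>R a)
      \<le> norm (?x - x0 - (k / N) *\<^sub>R a) + (1 / N) * norm (V ?x - a)"
      by (metis norm_triangle_ineq norm_scaleR abs_of_nonneg of_nat_0_le_iff zero_le_divide_1_iff)
    also have "\<dots> \<le> k / N * w + 1 / N * w"
      using Suc near[of k] V by (intro add_mono mult_left_mono) auto
    also have "\<dots> = Suc k / N * w" by (simp add: add_divide_distrib algebra_simps)
    finally show ?case by simp
  qed
  from this[of N] show ?thesis using N by simp
qed

text \<open>A discrete Gronwall estimate. One step loses at most the factor
  \<open>1 - 1/(2N)\<close> by \<open>b\<close> and an error \<open>M * d / N\<close> from the
  variation of the derivative, so after \<open>N\<close> steps at least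
  \<open>\<bar>u x0\<bar>/2 - M * d\<close> remains.\<close>

lemma euler_nonzero:
  assumes u: "smooth_on W u" "B \<subseteq> W" "convex B"
    and near: "\<And>k. k \<le> N \<Longrightarrow> (euler_step N V ^^ k) x0 \<in> B"
    and V: "\<And>y. y \<in> B \<Longrightarrow> norm (V y) \<le> M"
    and b: "\<And>y. y \<in> B \<Longrightarrow> \<bar>dderiv u y (V y)\<bar> \<le> \<bar>u y\<bar> / 2"
    and uc: "\<And>y z t. y \<in> B \<Longrightarrow> z \<in> B \<Longrightarrow> dist y z \<le> M / N \<Longrightarrow>
      \<bar>dderiv u z t - dderiv u y t\<bar> \<le> d * norm t"
    and d: "0 \<le> d" "M * d < \<bar>u x0\<bar> / 2" and N: "N > 0"
  shows "u ((euler_step N V ^^ N) x0) \<noteq> (0::real)"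
proof -
  let ?c = "1 - 1 / (2 * real N)"
  have c: "0 \<le> ?c" "?c \<le> 1" using N by (auto simp: field_simps)
  have "?c ^ k * \<bar>u x0\<bar> - k / N * (M * d) \<le> \<bar>u ((euler_step N V ^^ k) x0)\<bar>" if "k \<le> N" for k
    using that
  proof (induction k)
    case 0
    then show ?case by simp
  next
    case (Suc k)
    let ?x = "(euler_step N V ^^ k) x0" and ?y = "(euler_step N V ^^ Suc k) x0"
    let ?v = "(1 / real N) *\<^sub>R V ?x"
    have x: "?x \<in> B" "?y \<in> B" using near[of k] near[of "Suc k"] Suc.prems by auto
    have y: "?y = ?x + ?v" by (simp add: euler_step_def)
    have seg: "?x + t *\<^sub>R ?v \<in> B" if "0 \<le> t" "t \<le> 1" for t
    proof -
      have "?x + t *\<^sub>R ?v = (1 - t) *\<^sub>R ?x + t *\<^sub>R ?y" unfolding y by (simp add: algebra_simps)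
      then show ?thesis using convexD[OF u(3) x, of "1 - t" t] that by simp
    qed
    have "\<exists>t>0. t < 1 \<and> u (?x + 1 *\<^sub>R ?v) - u (?x + 0 *\<^sub>R ?v) = (1 - 0) * dderiv u (?x + t *\<^sub>R ?v) ?v"
      by (rule MVT2, simp, rule DERIV_comp_line[OF u(1)]) (use seg u(2) in auto)
    then obtain t where t: "0 < t" "t < 1" "u ?y - u ?x = dderiv u (?x + t *\<^sub>R ?v) ?v"
      unfolding y by auto
    have nv: "norm ?v \<le> M / N" using V[OF x(1)] by (simp add: divide_right_mono)
    have "norm (t *\<^sub>R ?v) \<le> norm ?v" using t mult_left_le_one_le[of "norm ?v" t] by simp
    then have D: "dist ?x (?x + t *\<^sub>R ?v) \<le> M / N" using nv by (simp add: dist_norm)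
    have "\<bar>dderiv u (?x + t *\<^sub>R ?v) ?v - dderiv u ?x ?v\<bar> \<le> d * norm ?v"
      by (rule uc[OF x(1) seg D]) (use t in auto)
    also have "\<dots> \<le> d * (M / N)" by (rule mult_left_mono[OF nv d(1)])
    finally have 1: "\<bar>dderiv u (?x + t *\<^sub>R ?v) ?v - dderiv u ?x ?v\<bar> \<le> M * d / N" by (simp add: mult.commute)
    have "dderiv u ?x ?v = dderiv u ?x (V ?x) / N"
      using linear_scale[OF linear_dderiv[OF u(1), of ?x], of "1 / real N"] x u(2) by auto
    then have "\<bar>dderiv u ?x ?v\<bar> = \<bar>dderiv u ?x (V ?x)\<bar> / N" by (simp add: abs_divide)
    also have "\<dots> \<le> \<bar>u ?x\<bar> / 2 / N" by (rule divide_right_mono[OF b[OF x(1)]]) simp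
    finally have 2: "\<bar>dderiv u ?x ?v\<bar> \<le> \<bar>u ?x\<bar> / 2 / N" .
    have "\<bar>u ?y\<bar> \<ge> \<bar>u ?x\<bar> - \<bar>u ?x\<bar> / 2 / N - M * d / N" using t(3) 1 2 by linarith
    moreover have "\<bar>u ?x\<bar> - \<bar>u ?x\<bar> / 2 / N = ?c * \<bar>u ?x\<bar>" by (simp add: algebra_simps)
    moreover have "?c * (?c ^ k * \<bar>u x0\<bar> - k / N * (M * d)) \<le> ?c * \<bar>u ?x\<bar>"
      using Suc c by (intro mult_left_mono) auto
    moreover have "?c * (k / N * (M * d)) \<le> k / N * (M * d)"
      using c d(1) order_trans[OF norm_ge_zero V[OF x(1)]]
      by (intro mult_left_le_one_le) auto
    ultimately have "?c * (?c ^ k * \<bar>u x0\<bar>) - k / N * (M * d) - M * d / N \<le> \<bar>u ?y\<bar>"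
      by (simp only: right_diff_distrib)
    moreover have "real (Suc k) / N * (M * d) = k / N * (M * d) + M * d / N"
      by (simp add: add_divide_distrib algebra_simps)
    ultimately show ?case by (simp only: power_Suc mult.assoc)
  qed
  from this[of N] have "?c ^ N * \<bar>u x0\<bar> - M * d \<le> \<bar>u ((euler_step N V ^^ N) x0)\<bar>" using N by simp
  \<comment> \<open>Bernoulli: \<open>N\<close> factors lose at most \<open>N * 1/(2N)\<close> in
    total.\<close>
  moreover have "1 / 2 \<le> ?c ^ N"
    using Bernoulli_inequality[of "- (1 / (2 * real N))" N] N by (simp add: field_simps)
  then have "1 / 2 * \<bar>u x0\<bar> \<le> ?c ^ N * \<bar>u x0\<bar>" by (rule mult_right_mono) simp
  ultimately show ?thesis using d(2) by auto
qed

text \<open>Uniform continuity of the gradient on a compact ball gives one modulus for all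
  directions \<open>t\<close> at once.\<close>

lemma dderiv_uniformly_continuous:
  fixes u :: "R3 \<Rightarrow> real"
  assumes "open W" "smooth_on W u" "cball p R \<subseteq> W" "0 < d"
  obtains h where "0 < h" "\<And>y z t. y \<in> cball p R \<Longrightarrow> z \<in> cball p R \<Longrightarrow> dist y z < h \<Longrightarrow>
      \<bar>dderiv u z t - dderiv u y t\<bar> \<le> d * norm t"
proof -
  define G where "G = (\<lambda>x. \<chi> i. dderiv u x (axis i 1))"
  have "smooth_on W G"
    unfolding G_def by (rule smooth_on_vec[OF assms(1)]) (simp add: smooth_on_dderiv_const assms(2))
  then have "continuous_on W G" by (rule smooth_on_imp_continuous_on)
  then have "uniformly_continuous_on (cball p R) G"
    by (intro compact_uniformly_continuous continuous_on_subset[OF _ assms(3)]) auto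
  then obtain h where h: "h > 0" "\<And>y z. y \<in> cball p R \<Longrightarrow> z \<in> cball p R \<Longrightarrow> dist z y < h \<Longrightarrow> dist (G z) (G y) < d"
    using assms(4) unfolding uniformly_continuous_on_def by metis
  have du: "dderiv u y t = t \<bullet> G y" if "y \<in> cball p R" for y t
    using dderiv_expand[OF assms(2), of y t] that assms(3) by (auto simp: inner_vec_def G_def)
  show ?thesis
  proof (rule that[OF h(1)])
    fix y z t assume yz: "y \<in> cball p R" "z \<in> cball p R" "dist y z < h"
    have "\<bar>dderiv u z t - dderiv u y t\<bar> = \<bar>t \<bullet> (G z - G y)\<bar>"
      by (simp only: du[OF yz(1)] du[OF yz(2)] inner_diff_right)
    also have "\<dots> \<le> norm t * norm (G z - G y)" by (rule Cauchy_Schwarz_ineq2)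
    also have "\<dots> \<le> norm t * d"
      using h(2)[OF yz(1,2)] yz(3)
      by (intro mult_left_mono norm_ge_zero) (metis dist_commute dist_norm less_imp_le)
    finally show "\<bar>dderiv u z t - dderiv u y t\<bar> \<le> d * norm t" by (simp add: mult.commute)
  qed
qed

text \<open>With \<open>N\<close> fixed the end point is a finite composition of maps continuous in
  the parameter, as Brouwer's theorem requires.\<close>

lemma euler_continuous:
  assumes near: "\<And>t k. t \<in> T \<Longrightarrow> k \<le> N \<Longrightarrow> (euler_step N (V t) ^^ k) x0 \<in> B"
    and V: "continuous_on (T \<times> B) (\<lambda>(t, y). V t y)"
  shows "continuous_on T (\<lambda>t. (euler_step N (V t) ^^ N) x0)"
proof -
  have "continuous_on T (\<lambda>t. (euler_step N (V t) ^^ k) x0)" if "k \<le> N" for k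
    using that
  proof (induction k)
    case (Suc k)
    then have c: "continuous_on T (\<lambda>t. (euler_step N (V t) ^^ k) x0)" by simp
    have "continuous_on T (\<lambda>t. (\<lambda>(t, y). V t y) (t, (euler_step N (V t) ^^ k) x0))"
      by (rule continuous_on_compose2[OF V continuous_on_Pair[OF continuous_on_id c]])
         (use near Suc.prems in auto)
    then have "continuous_on T (\<lambda>t. (euler_step N (V t) ^^ k) x0
        + (1 / real N) *\<^sub>R V t ((euler_step N (V t) ^^ k) x0))"
      using c by (auto intro!: continuous_intros)
    then show ?case by (simp only: funpow.simps o_apply euler_step_def[of _ _ "(_ ^^ _) _"])
  qed auto
  then show ?thesis by simp
qed

text \<open>Where \<open>u\<close> and \<open>v\<close> are nonzero at nearby points \<open>y1\<close>, \<open>y2\<close>, an Euler polygon along \<open>X\<close>, \<open>Y\<close>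
  issuing from \<open>y1\<close> and one along \<open>Z\<close> issuing from \<open>y2\<close> can be made to end at the same point by
  Brouwer's theorem.  As the mesh tends to \<open>0\<close>, \<open>u\<close> and \<open>v\<close> stay away from \<open>0\<close> along them.\<close>

lemma locally_one_vanishes:
  fixes u v :: "R3 \<Rightarrow> real"
  assumes W: "open W" "p \<in> W"
    and sm: "smooth_on W u" "smooth_on W v" "smooth_on W X" "smooth_on W Y" "smooth_on W Z" "smooth_on W c"
    and uv: "\<And>y. y \<in> W \<Longrightarrow> u y * v y = 0"
    and uX: "\<And>y. y \<in> W \<Longrightarrow> dderiv u y (X y) = 0"
    and uY: "\<And>y. y \<in> W \<Longrightarrow> dderiv u y (Y y) = c y * u y"
    and vZ: "\<And>y. y \<in> W \<Longrightarrow> dderiv v y (Z y) = 0"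
    and indep: "\<And>a b d. a *\<^sub>R X p + b *\<^sub>R Y p + d *\<^sub>R Z p = 0 \<Longrightarrow> a = 0 \<and> b = 0 \<and> d = 0"
  obtains r where "0 < r" "ball p r \<subseteq> W"
    "(\<forall>y\<in>ball p r. u y = 0) \<or> (\<forall>y\<in>ball p r. v y = 0)"
proof -
  have cont: "continuous_on W h" if "smooth_on W h" for h :: "R3 \<Rightarrow> 'b::real_normed_vector"
    using smooth_on_imp_continuous_on[OF that] .
  \<comment> \<open>To first order, the difference of the two displacements: parameters 1 and 2
    drive the polygon along \<open>X\<close>, \<open>Y\<close>, parameter 3 the one along
    \<open>Z\<close>.\<close>
  define L where "L t = t $ 1 *\<^sub>R X p + t $ 2 *\<^sub>R Y p - t $ 3 *\<^sub>R Z p" for t :: R3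
  have linL: "linear L" by (rule linearI) (simp_all add: L_def algebra_simps)
  moreover have "inj L"
  proof (rule linear_inj_iff_eq_0[THEN iffD2, OF linL], intro allI impI)
    fix t assume "L t = 0"
    then show "t = 0" using indep[of "t $ 1" "t $ 2" "- t $ 3"]
      by (simp add: L_def vec_eq_iff forall_3)
  qed
  ultimately obtain L' where L': "linear L'" "\<And>t. L' (L t) = t" "\<And>t. L (L' t) = t"
    using linear_injective_isomorphism by blast
  obtain K where K: "K > 0" "\<And>t. norm (L' t) \<le> K * norm t" using linear_bounded_pos[OF L'(1)] by blast
  \<comment> \<open>Chosen so that the oscillation of the fields costs
    \<open>K * (3 * r * w) = r/2\<close> in the self-map estimate for \<open>F\<close>.\<close>
  define w where "w = 1 / (6 * K)"
  have w: "w > 0" using K by (simp add: w_def)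
  have "\<exists>d>0. \<forall>y. dist y p < d \<longrightarrow> dist (V y) (V p) < w" if "smooth_on W V" for V :: "R3 \<Rightarrow> R3"
  proof -
    have "isCont V p" using cont[OF that] W continuous_on_eq_continuous_at by blast
    then show ?thesis using w unfolding continuous_at_eps_delta by blast
  qed
  from this[OF sm(3)] this[OF sm(4)] this[OF sm(5)] obtain d1 d2 d3 where
    d: "d1 > 0" "d2 > 0" "d3 > 0" "\<And>y. dist y p < d1 \<Longrightarrow> dist (X y) (X p) < w"
    "\<And>y. dist y p < d2 \<Longrightarrow> dist (Y y) (Y p) < w" "\<And>y. dist y p < d3 \<Longrightarrow> dist (Z y) (Z p) < w"
    by blast
  obtain r0 where r0: "r0 > 0" "ball p r0 \<subseteq> W" using openE[OF W] by blast
  define R where "R = min r0 (min d1 (min d2 d3)) / 2"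
  have R: "R > 0" "R < r0" "R < d1" "R < d2" "R < d3" using r0 d unfolding R_def by auto
  let ?B = "cball p R"
  have BW: "?B \<subseteq> W" using r0 R by (auto simp: subset_iff)
  have pB: "p \<in> ?B" using R by simp
  have XYZ: "norm (X y - X p) \<le> w" "norm (Y y - Y p) \<le> w" "norm (Z y - Z p) \<le> w" if "y \<in> ?B" for y
    using d(4)[of y] d(5)[of y] d(6)[of y] R that by (auto simp: dist_norm dist_commute norm_minus_commute)
  define M0 where "M0 = norm (X p) + norm (Y p) + norm (Z p) + w"
  have M0: "M0 > 0" using w by (simp add: M0_def add_nonneg_pos)
  have bd: "norm (X y) \<le> M0" "norm (Y y) \<le> M0" "norm (Z y) \<le> M0" if "y \<in> ?B" for y
    using XYZ[OF that] norm_triangle_sub[of "X y" "X p"] norm_triangle_sub[of "Y y" "Y p"]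
      norm_triangle_sub[of "Z y" "Z p"] norm_ge_zero[of "X p"] norm_ge_zero[of "Y p"] norm_ge_zero[of "Z p"]
    unfolding M0_def by linarith+
  have "compact (c ` ?B)" by (intro compact_continuous_image continuous_on_subset[OF cont[OF sm(6)] BW]) auto
  then obtain C where C: "C > 0" "\<And>y. y \<in> ?B \<Longrightarrow> \<bar>c y\<bar> \<le> C"
    using compact_imp_bounded bounded_pos by (metis image_eqI real_norm_def)
  \<comment> \<open>The first bound keeps the polygons in the ball, with speed \<open>M\<close> at
    most \<open>R/2\<close>; the second makes the growth rate \<open>t $ 2 * c\<close> at most
    \<open>1/2\<close>.\<close>
  define r where "r = min (R / (4 * M0)) (1 / (2 * C))"
  have r: "r > 0" "2 * r * M0 \<le> R / 2" "r * C \<le> 1 / 2"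
  proof -
    show "r > 0" using R M0 C by (simp add: r_def)
    have "r \<le> R / (4 * M0)" "r \<le> 1 / (2 * C)" by (simp_all add: r_def)
    then show "2 * r * M0 \<le> R / 2" "r * C \<le> 1 / 2" using M0 C by (simp_all add: field_simps)
  qed
  define M where "M = 2 * r * M0"
  have M: "M > 0" "M \<le> R / 2" using r M0 by (simp_all add: M_def)
  \<comment> \<open>The starting points are then at most \<open>2 * rho\<close> apart, which costs
    the other half \<open>r/2\<close> of the self-map estimate.\<close>
  define rho where "rho = min (R / 2) (r / (4 * K))"
  have rho: "rho > 0" "rho \<le> R / 2" "rho \<le> r / (4 * K)" using R r K by (simp_all add: rho_def)
  define V1 where "V1 t y = t $ 1 *\<^sub>R X y + t $ 2 *\<^sub>R Y y" for t :: R3 and y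
  define V2 where "V2 t y = t $ 3 *\<^sub>R Z y" for t :: R3 and y
  have comp: "\<bar>t $ i\<bar> \<le> r" if "t \<in> cball 0 r" for t :: R3 and i
    using component_le_norm_cart[of t i] that by simp
  have scale: "norm (t $ i *\<^sub>R a) \<le> r * b" if "t \<in> cball 0 r" "norm a \<le> b" for t :: R3 and i and a :: R3 and b
    using mult_mono[OF comp[OF that(1), of i] that(2)] r(1) by simp
  have V1: "norm (V1 t y) \<le> M" if "t \<in> cball 0 r" "y \<in> ?B" for t y
    using norm_triangle_le[OF add_mono[OF scale[OF that(1) bd(1)[OF that(2)]] scale[OF that(1) bd(2)[OF that(2)]]]]
    unfolding V1_def M_def by (simp add: mult_ac)
  have V2: "norm (V2 t y) \<le> M" if "t \<in> cball 0 r" "y \<in> ?B" for t y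
    using scale[OF that(1) bd(3)[OF that(2)], of 3] r(1) M0 unfolding V2_def M_def by (simp add: mult_nonneg_nonneg order_trans)
  have "False" if y1: "y1 \<in> ball p rho" "u y1 \<noteq> 0" and y2: "y2 \<in> ball p rho" "v y2 \<noteq> 0" for y1 y2
  proof -
    \<comment> \<open>Then \<open>M * d\<close> is at most a quarter of either starting value,
      strictly below the half allowed in \<open>euler_nonzero\<close>.\<close>
    define d where "d = min \<bar>u y1\<bar> \<bar>v y2\<bar> / (4 * M)"
    have d: "d > 0" "M * d < \<bar>u y1\<bar> / 2" "M * d < \<bar>v y2\<bar> / 2"
      using y1(2) y2(2) M(1) by (simp_all add: d_def field_simps)
    obtain h1 where h1: "0 < h1" "\<And>y z t. y \<in> ?B \<Longrightarrow> z \<in> ?B \<Longrightarrow> dist y z < h1 \<Longrightarrow>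
      \<bar>dderiv u z t - dderiv u y t\<bar> \<le> d * norm t"
      using dderiv_uniformly_continuous[OF W(1) sm(1) BW d(1)] by blast
    obtain h2 where h2: "0 < h2" "\<And>y z t. y \<in> ?B \<Longrightarrow> z \<in> ?B \<Longrightarrow> dist y z < h2 \<Longrightarrow>
      \<bar>dderiv v z t - dderiv v y t\<bar> \<le> d * norm t"
      using dderiv_uniformly_continuous[OF W(1) sm(2) BW d(1)] by blast
    obtain N :: nat where N: "M / min h1 h2 < N" using reals_Archimedean2 by blast
    have "0 < M / min h1 h2" using M h1(1) h2(1) by simp
    then have N0: "real N > 0" using N by linarith
    then have N1: "N > 0" by simp
    have "0 < min h1 h2" using h1(1) h2(1) by simp
    then have Mh: "M / N < min h1 h2"
      using N N0 pos_divide_less_eq mult.commute by metis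
    have yB: "y1 \<in> cball p (R / 2)" "y2 \<in> cball p (R / 2)" using y1(1) y2(1) rho(2) by auto
    define P where "P t = (euler_step N (V1 t) ^^ N) y1" for t
    define Q where "Q t = (euler_step N (V2 t) ^^ N) y2" for t
    have n1: "(euler_step N (V1 t) ^^ k) y1 \<in> ?B" if "t \<in> cball 0 r" "k \<le> N" for t k
      by (rule euler_near[OF V1[OF that(1)] M(2) yB(1) that(2) R(1)])
    have n2: "(euler_step N (V2 t) ^^ k) y2 \<in> ?B" if "t \<in> cball 0 r" "k \<le> N" for t k
      by (rule euler_near[OF V2[OF that(1)] M(2) yB(2) that(2) R(1)])
    have contB: "continuous_on (cball 0 r \<times> ?B) (\<lambda>z. V (snd z))" if "smooth_on W V" for V :: "R3 \<Rightarrow> R3"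
      by (rule continuous_on_compose2[OF continuous_on_subset[OF cont[OF that] BW]])
         (auto intro!: continuous_intros)
    have contP: "continuous_on (cball 0 r) P" unfolding P_def
      by (rule euler_continuous[OF n1])
         (auto simp: V1_def case_prod_beta' intro!: continuous_intros contB sm)
    have contQ: "continuous_on (cball 0 r) Q" unfolding Q_def
      by (rule euler_continuous[OF n2])
         (auto simp: V2_def case_prod_beta' intro!: continuous_intros contB sm)
    have eP: "norm (P t - y1 - V1 t p) \<le> 2 * r * w" if t: "t \<in> cball 0 r" for t
      unfolding P_def
    proof (rule euler_endpoint[OF n1[OF t] _ N1], assumption)
      fix y assume y: "y \<in> ?B"
      have "V1 t y - V1 t p = t $ 1 *\<^sub>R (X y - X p) + t $ 2 *\<^sub>R (Y y - Y p)"
        by (simp add: V1_def algebra_simps)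
      then show "norm (V1 t y - V1 t p) \<le> 2 * r * w"
        using norm_triangle_le[OF add_mono[OF scale[OF t XYZ(1)[OF y], of 1] scale[OF t XYZ(2)[OF y], of 2]]]
        by simp
    qed
    have eQ: "norm (Q t - y2 - V2 t p) \<le> r * w" if t: "t \<in> cball 0 r" for t
      unfolding Q_def
    proof (rule euler_endpoint[OF n2[OF t] _ N1], assumption)
      fix y assume y: "y \<in> ?B"
      show "norm (V2 t y - V2 t p) \<le> r * w"
        using scale[OF t XYZ(3)[OF y], of 3] by (simp add: V2_def scaleR_diff_right)
    qed
    \<comment> \<open>A Newton-type correction: its fixed points are the parameters for which both
      polygons end at the same point.\<close>
    define F where "F t = t - L' (P t - Q t)" for t
    have "F t \<in> cball 0 r" if t: "t \<in> cball 0 r" for t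
    proof -
      \<comment> \<open>What is left of \<open>L t - (P t - Q t)\<close> after the linear parts
        cancel: the gap between the starting points and the two polygon errors.\<close>
      let ?E = "(y2 - y1) - (P t - y1 - V1 t p) + (Q t - y2 - V2 t p)"
      have "F t = L' (L t) - L' (P t - Q t)" by (simp add: F_def L')
      also have "\<dots> = L' (L t - (P t - Q t))" by (rule linear_diff[OF L'(1), symmetric])
      also have "L t - (P t - Q t) = ?E" by (simp add: L_def V1_def V2_def algebra_simps)
      finally have "norm (F t) \<le> K * norm ?E" using K(2) by simp
      also have "norm ?E \<le> norm (y2 - y1) + 2 * r * w + r * w"
        using norm_triangle_ineq[of "(y2 - y1) - (P t - y1 - V1 t p)" "Q t - y2 - V2 t p"]
          norm_triangle_ineq4[of "y2 - y1" "P t - y1 - V1 t p"] eP[OF t] eQ[OF t] by linarith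
      also have "norm (y2 - y1) \<le> 2 * rho"
        using dist_triangle[of y1 y2 p] y1(1) y2(1) by (simp add: dist_norm norm_minus_commute)
      also have "K * (2 * rho + 2 * r * w + r * w) \<le> r"
      proof -
        have "K * (2 * rho) \<le> r / 2" using rho(3) K(1) by (simp add: field_simps)
        moreover have "K * (2 * r * w + r * w) = r / 2" using K(1) by (simp add: w_def field_simps)
        ultimately show ?thesis by (simp only: distrib_left)
      qed
      finally show ?thesis using K(1) by (simp add: mult_left_mono)
    qed
    then have "F \<in> cball 0 r \<rightarrow> cball 0 r" by blast
    moreover have "continuous_on (cball 0 r) F"
      unfolding F_def
      by (intro continuous_intros contP contQ linear_continuous_on_compose[OF _ L'(1)])
    ultimately obtain t where t: "t \<in> cball 0 r" "F t = t"
      using brouwer[of "cball 0 r" F] r(1) by auto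
    have "L (L' (P t - Q t)) = L 0" using t(2) by (simp add: F_def)
    then have PQ: "P t = Q t" by (simp add: L' linear_0[OF linL])
    have "u (P t) \<noteq> 0"
      unfolding P_def
    proof (rule euler_nonzero[OF sm(1) BW convex_cball n1[OF t(1)] V1[OF t(1)] _ _ less_imp_le[OF d(1)] d(2) N1])
      fix y assume y: "y \<in> ?B"
      then have yW: "y \<in> W" using BW by blast
      have "dderiv u y (V1 t y) = t $ 2 * c y * u y"
        using linear_add[OF linear_dderiv[OF sm(1) yW]] linear_scale[OF linear_dderiv[OF sm(1) yW]]
        by (simp add: V1_def uX[OF yW] uY[OF yW])
      moreover have "\<bar>t $ 2 * c y\<bar> \<le> 1 / 2"
        using mult_mono[OF comp[OF t(1), of 2] C(2)[OF y]] r by (simp add: abs_mult)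
      then have "\<bar>t $ 2 * c y\<bar> * \<bar>u y\<bar> \<le> 1 / 2 * \<bar>u y\<bar>" by (rule mult_right_mono) simp
      ultimately show "\<bar>dderiv u y (V1 t y)\<bar> \<le> \<bar>u y\<bar> / 2" by (simp add: abs_mult)
    qed (use h1(2) Mh in auto)
    moreover have "v (Q t) \<noteq> 0"
      unfolding Q_def
    proof (rule euler_nonzero[OF sm(2) BW convex_cball n2[OF t(1)] V2[OF t(1)] _ _ less_imp_le[OF d(1)] d(3) N1])
      fix y assume y: "y \<in> ?B"
      then have yW: "y \<in> W" using BW by blast
      show "\<bar>dderiv v y (V2 t y)\<bar> \<le> \<bar>v y\<bar> / 2"
        using linear_scale[OF linear_dderiv[OF sm(2) yW]] by (simp add: V2_def vZ[OF yW])
    qed (use h2(2) Mh in auto)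
    moreover have "P t \<in> W" using n1[OF t(1), of N] BW by (auto simp: P_def)
    ultimately show False using uv[of "P t"] PQ by auto
  qed
  then have "(\<forall>y\<in>ball p rho. u y = 0) \<or> (\<forall>y\<in>ball p rho. v y = 0)" by blast
  moreover have "ball p rho \<subseteq> W" using BW rho(2) R(1) by (auto simp: subset_iff)
  ultimately show ?thesis using that[OF rho(1)] by blast
qed

section \<open>Passage to the manifold\<close>

context paracontact_domain begin

lemma restrict:
  assumes "open W" "W \<subseteq> S"
  shows "paracontact_domain W g \<phi> \<xi> \<eta>"
proof
  show "open W" by fact
  show "smooth_on W g" "smooth_on W \<phi>" "smooth_on W \<xi>" "smooth_on W \<eta>"
    using smooth_on_subset[OF _ assms(2)] g_smooth phi_smooth xi_smooth eta_smooth by blast+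
qed (use assms(2) g_sym g_inv phi_xi eta_phi eta_xi phi_phi compatible normal in \<open>blast+\<close>)

text \<open>If all of ker \<eta> were null, polarisation would make it orthogonal to itself and to
  \<xi>, so \<open>g\<close> would degenerate. On ker \<eta> the map \<phi> reverses the sign of
  \<open>g\<close>, so \<open>a\<close> or its image is space-like.\<close>

lemma ex_spacelike:
  assumes x: "x \<in> S"
  obtains w where "\<eta> x \<bullet> w = 0" "0 < bil (g x) w w"
proof -
  have "\<exists>a. \<eta> x \<bullet> a = 0 \<and> bil (g x) a a \<noteq> 0"
  proof (rule ccontr)
    assume "\<not> ?thesis"
    then have null: "bil (g x) a a = 0" if "\<eta> x \<bullet> a = 0" for a using that by blast
    have polar: "bil (g x) a b = 0" if "\<eta> x \<bullet> a = 0" "\<eta> x \<bullet> b = 0" for a b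
      using null[of "a + b"] null[OF that(1)] null[OF that(2)] that bil_commute[OF x, of b a]
      by (simp add: bil_simps inner_add_right)
    obtain a :: R3 where a: "a \<noteq> 0" "\<eta> x \<bullet> a = 0"
      using orthogonal_to_vector_exists[of "\<eta> x"] by (auto simp: orthogonal_def)
    have "bil (g x) w a = bil (g x) w 0" for w
    proof -
      have "bil (g x) (w - (\<eta> x \<bullet> w) *\<^sub>R \<xi> x) a = 0"
        by (rule polar) (simp_all add: a eta_xi x inner_diff_right)
      moreover have "bil (g x) (\<xi> x) a = 0"
        using a(2) eta_eq[OF x, of a] bil_commute[OF x, of a "\<xi> x"] by simp
      ultimately show ?thesis by (simp add: bil_simps)
    qed
    then show False using nondegenerate[OF x, of a 0] a(1) by blast
  qed
  then obtain a where a: "\<eta> x \<bullet> a = 0" "bil (g x) a a \<noteq> 0" by blast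
  show ?thesis
  proof (cases "0 < bil (g x) a a")
    case True
    then show ?thesis using that a by blast
  next
    case False
    then show ?thesis using that[of "\<phi> x *v a"] a by (simp add: eta_phi x compatible)
  qed
qed

text \<open>Extend a space-like vector of ker \<eta> constantly, project along \<xi> into ker
  \<eta>, and normalise where its square stays positive.\<close>

lemma ex_frame:
  assumes x: "x \<in> S"
  obtains W e where "open W" "x \<in> W" "W \<subseteq> S" "paracontact_frame W g \<phi> \<xi> \<eta> e"
proof -
  obtain w0 where w0: "\<eta> x \<bullet> w0 = 0" "0 < bil (g x) w0 w0" by (rule ex_spacelike[OF x])
  define w where "w y = w0 - (\<eta> y \<bullet> w0) *\<^sub>R \<xi> y" for y
  define h where "h y = bil (g y) (w y) (w y)" for y
  define W where "W = S \<inter> h -` {0<..}"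
  define e where "e y = inverse (sqrt (h y)) *\<^sub>R w y" for y
  have w: "smooth_on S w" unfolding w_def
    by (intro smooth_on_diff[OF open_S] smooth_on_scaleR[OF open_S] smooth_on_inner[OF open_S]
        smooth_on_const eta_smooth xi_smooth)
  have h: "smooth_on S h" unfolding h_def by (rule smooth_on_bil[OF open_S g_smooth w w])
  have W: "open W" "x \<in> W" "W \<subseteq> S"
    using continuous_open_preimage[OF smooth_on_imp_continuous_on[OF h] open_S open_greaterThan, of 0] x w0
    by (auto simp: W_def h_def w_def)
  have pos: "0 < h y" if "y \<in> W" for y using that by (simp add: W_def)
  interpret W: paracontact_domain W g \<phi> \<xi> \<eta> by (rule restrict[OF W(1,3)])
  have "paracontact_frame W g \<phi> \<xi> \<eta> e"
  proof
    show "smooth_on W e" unfolding e_def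
      by (rule smooth_on_scaleR[OF W(1) smooth_on_inverse_sqrt[OF W(1) smooth_on_subset[OF h W(3)] pos]
          smooth_on_subset[OF w W(3)]])
    fix y assume y: "y \<in> W"
    have "bil (g y) (e y) (e y) = inverse (sqrt (h y) * sqrt (h y)) * h y"
      by (simp add: e_def bil_simps h_def[symmetric] del: real_sqrt_mult_self)
    then show "bil (g y) (e y) (e y) = 1" using pos[OF y] by simp
    have "bil (g y) (w y) (\<xi> y) = 0"
      unfolding W.eta_eq[OF y, symmetric] by (simp add: w_def inner_diff_right W.eta_xi y)
    then show "bil (g y) (e y) (\<xi> y) = 0" by (simp add: e_def bil_simps)
  qed
  then show ?thesis using that W by blast
qed

end

section \<open>Reading the structure in a chart\<close>

lemma paracontact_domain_chart:
  assumes "normal_almost_paracontact_metric A \<phi> \<xi> \<eta> g" and c: "c \<in> A"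
  shows "paracontact_domain (chart_img c) (g c) (\<phi> c) (\<xi> c) (\<eta> c)"
proof -
  have *: "almost_paracontact A \<phi> \<xi> \<eta>" "pseudo_riemannian_metric A g" "normal_structure A \<phi> \<xi> \<eta>"
    "\<And>x v w. x \<in> chart_img c \<Longrightarrow> bil (g c x) (\<phi> c x *v v) (\<phi> c x *v w) =
          - bil (g c x) v w + (\<eta> c x \<bullet> v) * (\<eta> c x \<bullet> w)"
    using assms unfolding normal_almost_paracontact_metric_def almost_paracontact_metric_def by blast+
  have xi: "smooth_on (chart_img c) (\<xi> c)"
    using *(1) c unfolding almost_paracontact_def vector_field_on_def chart_img_def by (metis Int_UNIV_left)
  show ?thesis
  proof
    show "open (chart_img c)"
      using *(1) c unfolding almost_paracontact_def connected_smooth_3manifold_def is_chart_def by blast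
    show "smooth_on (chart_img c) (g c)" using *(2) c unfolding pseudo_riemannian_metric_def by blast
    show "smooth_on (chart_img c) (\<phi> c)" "smooth_on (chart_img c) (\<eta> c)"
      using *(1) c unfolding almost_paracontact_def endo_field_def one_form_def by blast+
    show "smooth_on (chart_img c) (\<xi> c)" by (rule xi)
    fix x v w assume x: "x \<in> chart_img c"
    show "transpose (g c x) = g c x" "invertible (g c x)"
      using *(2) c x unfolding pseudo_riemannian_metric_def by blast+
    show "\<phi> c x *v \<xi> c x = 0" "\<eta> c x \<bullet> (\<phi> c x *v v) = 0" "\<eta> c x \<bullet> \<xi> c x = 1"
      "\<phi> c x *v (\<phi> c x *v v) = v - (\<eta> c x \<bullet> v) *\<^sub>R \<xi> c x"
      using *(1) c x unfolding almost_paracontact_def by blast+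
    show "bil (g c x) (\<phi> c x *v v) (\<phi> c x *v w) = - bil (g c x) v w + (\<eta> c x \<bullet> v) * (\<eta> c x \<bullet> w)"
      by (rule *(4)[OF x])
    have "nijenhuis (\<phi> c) (\<xi> c) (\<lambda>_. v) x - (2 * ext_deriv (\<eta> c) (\<xi> c) (\<lambda>_. v) x) *\<^sub>R \<xi> c x = 0"
      using *(3) c x xi smooth_on_const unfolding normal_structure_def by blast
    then show "nijenhuis (\<phi> c) (\<xi> c) (\<lambda>_. v) x = (2 * ext_deriv (\<eta> c) (\<xi> c) (\<lambda>_. v) x) *\<^sub>R \<xi> c x"
      by simp
  qed
qed

lemma soliton_frame_chart:
  assumes N: "normal_almost_paracontact_metric A \<phi> \<xi> \<eta> g" and c: "c \<in> A"
    and l: "ricci_soliton A \<xi> g l" and W: "W \<subseteq> chart_img c"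
    and F: "paracontact_frame W (g c) (\<phi> c) (\<xi> c) (\<eta> c) e"
  shows "soliton_frame W (g c) (\<phi> c) (\<xi> c) (\<eta> c) e l"
proof -
  interpret D: paracontact_domain "chart_img c" "g c" "\<phi> c" "\<xi> c" "\<eta> c"
    by (rule paracontact_domain_chart[OF N c])
  interpret F: paracontact_frame W "g c" "\<phi> c" "\<xi> c" "\<eta> c" e by (rule F)
  show ?thesis
  proof
    fix x v w assume "x \<in> W"
    then have x: "x \<in> chart_img c" using W by blast
    have "lie_deriv_metric (\<xi> c) (g c) (\<lambda>_. v) (\<lambda>_. w) x + ricci (g c) x v w = l * bil (g c x) v w"
      using l c x smooth_on_const unfolding ricci_soliton_def by blast
    then show "bil (g c x) (cov_deriv (g c) (\<lambda>_. v) (\<xi> c) x) w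
        + bil (g c x) v (cov_deriv (g c) (\<lambda>_. w) (\<xi> c) x) + ricci (g c) x v w = l * bil (g c x) v w"
      by (simp add: D.lie_deriv_metric_eq[OF smooth_on_const smooth_on_const x])
  qed
qed

text \<open>All three claims are pointwise, so any frame near \<open>x\<close> will do. Writing the
  curvature as \<open>l / 2\<close> makes it the same number in every chart.\<close>

lemma unsteady_soliton_at:
  assumes N: "normal_almost_paracontact_metric A \<phi> \<xi> \<eta> g"
    and l: "ricci_soliton A \<xi> g l" "l \<noteq> 0" and c: "c \<in> A" and x: "x \<in> chart_img c"
  shows "smooth_on (chart_img c) X \<Longrightarrow> smooth_on (chart_img c) Y \<Longrightarrow>
      lie_deriv_metric (\<xi> c) (g c) X Y x = 0"
    and "l / 2 = - (b2 \<phi> \<xi> g c x)\<^sup>2"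
    and "plane_gram (g c) x u v \<noteq> 0 \<Longrightarrow> sectional_curvature (g c) x u v = l / 2"
proof -
  interpret D: paracontact_domain "chart_img c" "g c" "\<phi> c" "\<xi> c" "\<eta> c"
    by (rule paracontact_domain_chart[OF N c])
  obtain W e where W: "open W" "x \<in> W" "W \<subseteq> chart_img c"
    and F: "paracontact_frame W (g c) (\<phi> c) (\<xi> c) (\<eta> c) e" by (rule D.ex_frame[OF x])
  interpret F: soliton_frame W "g c" "\<phi> c" "\<xi> c" "\<eta> c" e l
    by (rule soliton_frame_chart[OF N c l(1) W(3) F])
  have b0: "F.\<beta>1 x = 0" using F.beta1_l[OF W(2)] l(2) by simp
  have b2: "b2 \<phi> \<xi> g c x = F.\<beta>2 x" unfolding b2_def by (rule F.b2_eq[OF W(2)])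
  show "lie_deriv_metric (\<xi> c) (g c) X Y x = 0"
    if XY: "smooth_on (chart_img c) X" "smooth_on (chart_img c) Y"
    using F.lie_eq[OF W(2), of "X x" "Y x"] b0
      D.cov_deriv_cong_left[of "\<lambda>_. X x" x X "\<xi> c"] D.cov_deriv_cong_left[of "\<lambda>_. Y x" x Y "\<xi> c"]
    by (simp add: D.lie_deriv_metric_eq[OF XY x])
  show k: "l / 2 = - (b2 \<phi> \<xi> g c x)\<^sup>2" using F.l_eq[OF W(2)] b0 b2 by simp
  show "sectional_curvature (g c) x u v = l / 2" if "plane_gram (g c) x u v \<noteq> 0"
    using F.sectional_unsteady[OF W(2) l(2) that] k b2 by simp
qed

lemma steady_soliton_near:
  assumes N: "normal_almost_paracontact_metric A \<phi> \<xi> \<eta> g"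
    and l: "ricci_soliton A \<xi> g 0" and e: "phi_basis A \<phi> \<xi> g U e"
    and c: "c \<in> A" and p: "p \<in> U \<inter> chart_dom c"
  shows "\<exists>V \<epsilon>. open V \<and> p \<in> V \<and> V \<subseteq> U \<inter> chart_dom c \<and> \<epsilon> \<in> {1, -1} \<and>
    (\<forall>x \<in> coord c ` V.
       b2 \<phi> \<xi> g c x = \<epsilon> * b1 \<xi> g c x \<and>
       dderiv (b1 \<xi> g c) x (\<xi> c x) = - 2 * (b1 \<xi> g c x)\<^sup>2 \<and>
       scalar_curvature (g c) x = - 4 * b1 \<xi> g c x \<and>
       dderiv (b1 \<xi> g c) x (e c x - \<epsilon> *\<^sub>R (\<phi> c x *v e c x)) = 0)"
proof -
  interpret D: paracontact_domain "chart_img c" "g c" "\<phi> c" "\<xi> c" "\<eta> c"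
    by (rule paracontact_domain_chart[OF N c])
  have chart: "open (chart_dom c)" "homeomorphism (chart_dom c) (chart_img c) (coord c) (param c)"
    using N c unfolding normal_almost_paracontact_metric_def almost_paracontact_metric_def
      almost_paracontact_def connected_smooth_3manifold_def is_chart_def by blast+
  have U: "open U" "smooth_on (coord c ` (U \<inter> chart_dom c)) (e c)"
    using e c unfolding phi_basis_def vector_field_on_def by blast+
  define W where "W = coord c ` (U \<inter> chart_dom c)"
  have "openin (top_of_set (chart_img c)) W"
    unfolding W_def
    by (rule homeomorphism_imp_open_map[OF chart(2)]) (use openin_open_Int[OF U(1), of "chart_dom c"] in \<open>simp add: Int_commute\<close>)
  then have W: "open W" "W \<subseteq> chart_img c"
    using D.open_S openin_open_eq by (auto dest: openin_imp_subset)
  interpret R: paracontact_domain W "g c" "\<phi> c" "\<xi> c" "\<eta> c" by (rule D.restrict[OF W])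
  have "paracontact_frame W (g c) (\<phi> c) (\<xi> c) (\<eta> c) (e c)"
  proof
    show "smooth_on W (e c)" using U(2) by (simp add: W_def)
    fix x assume x: "x \<in> W"
    then show "bil (g c x) (e c x) (e c x) = 1" "bil (g c x) (e c x) (\<xi> c x) = 0"
      using e c R.bil_commute[OF x, of "e c x" "\<xi> c x"] unfolding phi_basis_def Let_def W_def by auto
  qed
  then interpret F: soliton_frame W "g c" "\<phi> c" "\<xi> c" "\<eta> c" "e c" 0
    by (rule soliton_frame_chart[OF N c l W(2)])
  note sm = F.coefficients_smooth(1,2) F.e_smooth F.f_smooth R.xi_smooth
  let ?u = "\<lambda>y. F.\<beta>1 y + F.\<beta>2 y" and ?v = "\<lambda>y. F.\<beta>1 y - F.\<beta>2 y"
  have u: "smooth_on W ?u" and v: "smooth_on W ?v"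
    by (intro smooth_on_add smooth_on_diff W(1) sm)+
  have pW: "coord c p \<in> W" using p by (simp add: W_def)
  \<comment> \<open>Adding and subtracting the relations between the derivatives of
    \<open>F.\<beta>1\<close> and \<open>F.\<beta>2\<close> shows that the light-like fields e - f
    and e + f annihilate \<open>?u\<close> and \<open>?v\<close>; \<xi> multiplies \<open>?u\<close>
    by \<open>-2 * F.\<beta>1\<close>.\<close>
  obtain r where r: "0 < r" "ball (coord c p) r \<subseteq> W"
    "(\<forall>y\<in>ball (coord c p) r. ?u y = 0) \<or> (\<forall>y\<in>ball (coord c p) r. ?v y = 0)"
  proof (rule locally_one_vanishes[OF W(1) pW u v, of "\<lambda>y. e c y - F.f y" "\<xi> c" "\<lambda>y. e c y + F.f y"
        "\<lambda>y. -2 * F.\<beta>1 y"])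
    show "smooth_on W (\<lambda>y. e c y - F.f y)" "smooth_on W (\<xi> c)" "smooth_on W (\<lambda>y. e c y + F.f y)"
      "smooth_on W (\<lambda>y. -2 * F.\<beta>1 y)"
      by (intro smooth_on_add smooth_on_diff smooth_on_mult smooth_on_const W(1) sm)+
  next
    fix y assume y: "y \<in> W"
    note lin = linear_diff[OF linear_dderiv[OF _ y]] linear_add[OF linear_dderiv[OF _ y]]
    note D = dderiv_add[OF sm(1,2) y] dderiv_diff[OF sm(1,2) y]
    show "?u y * ?v y = 0" using F.l_eq[OF y] by (simp add: power2_eq_square algebra_simps)
    show "dderiv ?u y (e c y - F.f y) = 0"
      unfolding D by (simp add: lin sm F.e_beta1[OF y] F.f_beta1[OF y])
    show "dderiv ?v y (e c y + F.f y) = 0"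
      unfolding D by (simp add: lin sm F.e_beta1[OF y] F.f_beta1[OF y])
    show "dderiv ?u y (\<xi> c y) = -2 * F.\<beta>1 y * ?u y"
      unfolding D by (simp add: F.xi_beta1[OF y] F.xi_beta2[OF y] power2_eq_square algebra_simps)
  next
    fix a b d
    let ?G = "bil (g c (coord c p))" and ?z = "coord c p"
    assume "a *\<^sub>R (e c ?z - F.f ?z) + b *\<^sub>R \<xi> c ?z + d *\<^sub>R (e c ?z + F.f ?z) = 0"
    then have "?G (a *\<^sub>R (e c ?z - F.f ?z) + b *\<^sub>R \<xi> c ?z + d *\<^sub>R (e c ?z + F.f ?z)) t = 0" for t
      by (simp add: bil_simps)
    \<comment> \<open>The products with \<xi>, e and f give \<open>b = 0\<close>,
      \<open>a + d = 0\<close> and \<open>a - d = 0\<close>.\<close>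
    from this[of "\<xi> c ?z"] this[of "e c ?z"] this[of "F.f ?z"] show "a = 0 \<and> b = 0 \<and> d = 0"
      by (simp add: bil_simps F.orthonormal[OF pW])
  qed
  let ?B = "ball (coord c p) r"
  have b: "b1 \<xi> g c x = F.\<beta>1 x" "b2 \<phi> \<xi> g c x = F.\<beta>2 x" if "x \<in> W" for x
    unfolding b1_def b2_def by (rule F.b1_eq[OF that], rule F.b2_eq[OF that])
  have db: "dderiv (b1 \<xi> g c) x = dderiv F.\<beta>1 x" if "x \<in> W" for x
    by (rule dderiv_cong[OF W(1) that sm(1), symmetric]) (simp add: b)
  define V where "V = chart_dom c \<inter> coord c -` ?B"
  have "continuous_on (chart_dom c) (coord c)" using chart(2) homeomorphism_cont1 by blast
  then have V: "open V" "p \<in> V"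
    using continuous_open_preimage chart(1) p r(1) by (auto simp: V_def)
  have VU: "V \<subseteq> U \<inter> chart_dom c"
  proof
    fix q assume q: "q \<in> V"
    \<comment> \<open>Lying over \<open>W\<close> yields only some point of \<open>U\<close> with
      the same coordinates; injectivity of the chart identifies it with \<open>q\<close>.\<close>
    then obtain q' where q': "q' \<in> U \<inter> chart_dom c" "coord c q = coord c q'"
      using r(2) unfolding V_def W_def by blast
    then have "q = q'" using q homeomorphism_apply1[OF chart(2)] unfolding V_def by (metis IntD1 IntD2)
    then show "q \<in> U \<inter> chart_dom c" using q' by simp
  qed
  have imV: "x \<in> ?B" if "x \<in> coord c ` V" for x using that by (auto simp: V_def)
  have main: "b2 \<phi> \<xi> g c x = \<epsilon> * b1 \<xi> g c x \<and>
       dderiv (b1 \<xi> g c) x (\<xi> c x) = - 2 * (b1 \<xi> g c x)\<^sup>2 \<and>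
       scalar_curvature (g c) x = - 4 * b1 \<xi> g c x \<and>
       dderiv (b1 \<xi> g c) x (e c x - \<epsilon> *\<^sub>R (\<phi> c x *v e c x)) = 0"
    if x: "x \<in> ?B" and eps: "\<And>y. y \<in> ?B \<Longrightarrow> F.\<beta>2 y = \<epsilon> * F.\<beta>1 y" "\<epsilon> \<in> {1, -1}" for x \<epsilon>
  proof -
    have xW: "x \<in> W" using x r(2) by blast
    \<comment> \<open>The sign is the same on the whole ball, so the relation may be differentiated;
      with \<open>F.e_beta1\<close> it gives the derivative along
      \<open>e - \<epsilon> f\<close>.\<close>
    have "dderiv F.\<beta>2 x = dderiv (\<lambda>y. \<epsilon> * F.\<beta>1 y) x"
      by (rule dderiv_cong[OF open_ball x smooth_on_subset[OF sm(2) r(2)] eps(1)])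
    then have d2: "dderiv F.\<beta>2 x v = \<epsilon> * dderiv F.\<beta>1 x v" for v
      by (simp add: dderiv_mult[OF smooth_on_const sm(1) xW])
    have f: "\<phi> c x *v e c x = F.f x" by (simp add: F.f_def)
    have "dderiv F.\<beta>1 x (e c x - \<epsilon> *\<^sub>R F.f x) = dderiv F.\<beta>1 x (e c x) - \<epsilon> * dderiv F.\<beta>1 x (F.f x)"
      using linear_diff[OF linear_dderiv[OF sm(1) xW]] linear_scale[OF linear_dderiv[OF sm(1) xW]] by simp
    also have "\<dots> = 0" using F.e_beta1[OF xW] d2 by simp
    finally show ?thesis
      using F.xi_beta1[OF xW] F.scalar_curvature_frame[OF xW] eps(1)[OF x]
      by (simp add: b[OF xW] db[OF xW] f)
  qed
  show ?thesis
  proof (cases "\<forall>y\<in>?B. ?v y = 0")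
    case True
    then have "\<And>y. y \<in> ?B \<Longrightarrow> F.\<beta>2 y = 1 * F.\<beta>1 y" by simp
    then show ?thesis using main[of _ 1] imV V VU by (intro exI[of _ V] exI[of _ 1]) auto
  next
    case False
    then have "\<And>y. y \<in> ?B \<Longrightarrow> F.\<beta>2 y = -1 * F.\<beta>1 y"
      using r(3) by (metis add_eq_0_iff mult_minus1)
    then show ?thesis using main[of _ "-1"] imV V VU by (intro exI[of _ V] exI[of _ "-1"]) auto
  qed
qed

theorem theorem5p3:
  fixes A :: "'a::{t2_space, second_countable_topology} chart set"
    and \<phi> :: "'a endo_field" and \<xi> :: "'a vec_field" and \<eta> :: "'a one_form"
    and g :: "'a bilin_field"
  assumes "normal_almost_paracontact_metric A \<phi> \<xi> \<eta> g"
  shows "(\<forall>l. l \<noteq> 0 \<and> ricci_soliton A \<xi> g l \<longrightarrow>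
            killing A \<xi> g \<and>
            (\<exists>k<0. constant_sectional_curvature A g k \<and>
                   (\<forall>c\<in>A. \<forall>x\<in>chart_img c. k = - (b2 \<phi> \<xi> g c x)\<^sup>2)))
       \<and> (ricci_soliton A \<xi> g 0 \<longrightarrow>
            (\<forall>U e. phi_basis A \<phi> \<xi> g U e \<longrightarrow>
               (\<forall>c\<in>A. \<forall>p \<in> U \<inter> chart_dom c.
                  \<exists>V \<epsilon>. open V \<and> p \<in> V \<and> V \<subseteq> U \<inter> chart_dom c \<and> \<epsilon> \<in> {1, -1} \<and>
                    (\<forall>x \<in> coord c ` V.
                       b2 \<phi> \<xi> g c x = \<epsilon> * b1 \<xi> g c x \<and>
                       dderiv (b1 \<xi> g c) x (\<xi> c x) = - 2 * (b1 \<xi> g c x)\<^sup>2 \<and>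
                       scalar_curvature (g c) x = - 4 * b1 \<xi> g c x \<and>
                       dderiv (b1 \<xi> g c) x (e c x - \<epsilon> *\<^sub>R (\<phi> c x *v e c x)) = 0))))"
proof (intro conjI allI impI ballI)
  fix l assume l: "l \<noteq> 0 \<and> ricci_soliton A \<xi> g l"
  note U = unsteady_soliton_at[OF assms, of l]
  show "killing A \<xi> g" unfolding killing_def using U(1) l by blast
  show "\<exists>k<0. constant_sectional_curvature A g k \<and>
                   (\<forall>c\<in>A. \<forall>x\<in>chart_img c. k = - (b2 \<phi> \<xi> g c x)\<^sup>2)"
  proof (intro exI[of _ "l / 2"] conjI ballI)
    show "constant_sectional_curvature A g (l / 2)"
      unfolding constant_sectional_curvature_def using U(3) l by blast
    show "l / 2 = - (b2 \<phi> \<xi> g c x)\<^sup>2" if "c \<in> A" "x \<in> chart_img c" for c x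
      using U(2) l that by blast
    \<comment> \<open>Strict negativity needs one actual point at which \<open>l / 2\<close> is
      minus a square; the charts cover the type, which is nonempty.\<close>
    have "(\<Union>c\<in>A. chart_dom c) = UNIV"
      using assms unfolding normal_almost_paracontact_metric_def almost_paracontact_metric_def
        almost_paracontact_def connected_smooth_3manifold_def by blast
    then obtain c q where "c \<in> A" "q \<in> chart_dom c" by blast
    then have "l / 2 = - (b2 \<phi> \<xi> g c (coord c q))\<^sup>2" using U(2) l by (simp add: chart_img_def)
    then have "l / 2 \<le> 0" by simp
    then show "l / 2 < 0" using l by linarith
  qed
qed (rule steady_soliton_near[OF assms])

end
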